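(* Suppose $w\in S_n$ is defined by inclusions. Then the ideals $I_w$ and $J_w$ of $S$ are equal (for any admissible choice of ordering of $E'(w)$ used in defining $J_w$). Hence $I_w$ defines a local complete intersection, i.e. $\operatorname{Spec}(S/I_w)$ is a local complete intersection.
   Context: Write $[a,b]=\{x\in\mathbb{Z}: a\le x\le b\}$ (empty if $b<a$). Positions $(p,q)\in[1,n]\times[1,n]$ are matrix positions: row $p$ from the top, column $q$ from the left. For $w\in S_n$ set $r_w(p,q)=\#\{k\le q : w(k)\ge p\}$. The diagram is $D(w)=\{(p,q)\in[1,n]^2 : w(q)<p,\ w^{-1}(p)>q\}$ and the essential set is $E(w)=\{(p,q)\in D(w): (p,q+1)\notin D(w),\ (p-1,q)\notin D(w)\}$. Call $w$ defined by inclusions if $q-r_w(p,q)=\min\{p-1,q\}$ for every $(p,q)\in E(w)$. Let $D'(w)=\{(x,y)\in D(w): r_w(x,y)>0\}$ and $E'(w)=\{(p,q)\in E(w): r_w(p,q)>0\}$. A position $(x,y)$ is weakly SW of $(p,q)$ if $x\ge p$ and $y\le q$. Let $S=\mathbb{C}[z_{p,q}]_{1\le q<p\le n}$, and let $M$ be the $n\times n$ lower unitriangular matrix with entry $z_{p,q}$ at $(p,q)$ for $p>q$, $1$'s on the diagonal, and $0$'s above it. For $A,B\subseteq[1,n]$ with $\#A=\#B$, let $d_{A,B}$ be the minor of $M$ with rows $A$ and columns $B$. Let $I_{(p,q,r)}\subseteq S$ be the ideal generated by all $d_{A,B}$ with $A\subseteq[p,n]$, $B\subseteq[1,q]$, $\#A=\#B=r+1$,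 and let $I_w=\sum_{(p,q)\in E(w)}I_{(p,q,r_w(p,q))}$. Definition of $J_w$: order the elements of $E'(w)$ as $(p_1,q_1),\dots,(p_k,q_k)$ so that, with $r_m=r_w(p_m,q_m)$, one has $r_1\le\cdots\le r_k$ (ties broken arbitrarily). Let $R_m$ be the set of $(x,y)\in D'(w)$ that are weakly SW of $(p_m,q_m)$ but not weakly SW of $(p_{m'},q_{m'})$ for any $m'<m$; these sets partition $D'(w)$. For $(x,y)\in D(w)$: if $r_w(x,y)=0$ put $f_{(x,y)}=d_{\{x\},\{y\}}=z_{x,y}$; otherwise $(x,y)\in R_m$ for a unique $m$, and put $f_{(x,y)}=d_{A(x,y),B(x,y)}$ with $A(x,y)=[p_m,p_m+r_m-1]\cup\{x+r_m\}$ and $B(x,y)=\{y-r_m\}\cup[q_m-r_m+1,q_m]$. Let $J_w$ be the ideal of $S$ generated by all $f_{(x,y)}$, $(x,y)\in D(w)$. *)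

theory Defs
  imports Complex_Main
    "HOL-Library.Poly_Mapping"
    "HOL-Combinatorics.Permutations"
    "HOL-Algebra.QuotRing"
    "Jordan_Normal_Form.Determinant"
begin

text \<open>
  Permutations in \<open>S\<^sub>n\<close> are functions \<open>w :: nat \<Rightarrow> nat\<close> with \<open>w permutes {1..n}\<close>. Positions are
  pairs (row, column), counted from 1, rows from the top.
\<close>

subsection \<open>Permutation combinatorics\<close>

definition rk :: "(nat \<Rightarrow> nat) \<Rightarrow> nat \<Rightarrow> nat \<Rightarrow> nat" where
  "rk w p q = card {k \<in> {1..q}. w k \<ge> p}"

definition diagram :: "nat \<Rightarrow> (nat \<Rightarrow> nat) \<Rightarrow> (nat \<times> nat) set" where
  "diagram n w = {(p, q). p \<in> {1..n} \<and> q \<in> {1..n} \<and> w q < p \<and> Hilbert_Choice.inv w p > q}"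

definition essential_set :: "nat \<Rightarrow> (nat \<Rightarrow> nat) \<Rightarrow> (nat \<times> nat) set" where
  "essential_set n w =
     {(p, q) \<in> diagram n w. (p, q + 1) \<notin> diagram n w \<and> (p - 1, q) \<notin> diagram n w}"

definition defined_by_inclusions :: "nat \<Rightarrow> (nat \<Rightarrow> nat) \<Rightarrow> bool" where
  "defined_by_inclusions n w \<longleftrightarrow>
     (\<forall>(p, q) \<in> essential_set n w. int q - int (rk w p q) = min (int p - 1) (int q))"

definition diagram_pos :: "nat \<Rightarrow> (nat \<Rightarrow> nat) \<Rightarrow> (nat \<times> nat) set" where
  "diagram_pos n w = {(x, y) \<in> diagram n w. rk w x y > 0}"

definition essential_pos :: "nat \<Rightarrow> (nat \<Rightarrow> nat) \<Rightarrow> (nat \<times> nat) set" where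
  "essential_pos n w = {(p, q) \<in> essential_set n w. rk w p q > 0}"

definition weakly_SW :: "nat \<times> nat \<Rightarrow> nat \<times> nat \<Rightarrow> bool" where
  "weakly_SW a b \<longleftrightarrow> fst a \<ge> fst b \<and> snd a \<le> snd b"

subsection \<open>Polynomial rings over the complex numbers\<close>

text \<open>
  A polynomial is a finitely supported map from exponent vectors to coefficients. The ring
  \<open>poly_ring V\<close> is \<open>\<complex>[z\<^sub>v : v \<in> V]\<close>, consisting of the polynomials that involve only variables
  from \<open>V\<close>.
\<close>

type_synonym 'v cpoly = "('v \<Rightarrow>\<^sub>0 nat) \<Rightarrow>\<^sub>0 complex"

definition poly_ring :: "'v set \<Rightarrow> 'v cpoly ring" where
  "poly_ring V =
     \<lparr>carrier = {f. \<forall>m \<in> Poly_Mapping.keys f. Poly_Mapping.keys m \<subseteq> V},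
      monoid.mult = (*), one = 1, zero = 0, add = (+)\<rparr>"

definition pvar :: "'v \<Rightarrow> 'v cpoly" where
  "pvar v = Poly_Mapping.single (Poly_Mapping.single v 1) 1"

definition S_ring :: "nat \<Rightarrow> (nat \<times> nat) cpoly ring" where
  "S_ring n = poly_ring {(p, q). 1 \<le> q \<and> q < p \<and> p \<le> n}"

subsection \<open>The ideals \<open>I\<^sub>w\<close> and \<open>J\<^sub>w\<close>\<close>

definition M_entry :: "nat \<Rightarrow> nat \<Rightarrow> (nat \<times> nat) cpoly" where
  "M_entry p q = (if p > q then pvar (p, q) else if p = q then 1 else 0)"

text \<open>
  The matrices of \<open>Jordan_Normal_Form\<close> are indexed from 0; the rows and columns of the minor are
  those in \<open>A\<close> and \<open>B\<close>, in increasing order.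
\<close>

definition M_minor :: "nat set \<Rightarrow> nat set \<Rightarrow> (nat \<times> nat) cpoly" where
  "M_minor A B =
     det (mat (card A) (card B)
       (\<lambda>(i, j). M_entry (sorted_list_of_set A ! i) (sorted_list_of_set B ! j)))"

definition rank_ideal :: "nat \<Rightarrow> nat \<Rightarrow> nat \<Rightarrow> nat \<Rightarrow> (nat \<times> nat) cpoly set" where
  "rank_ideal n p q r =
     Idl\<^bsub>S_ring n\<^esub> {M_minor A B | A B. A \<subseteq> {p..n} \<and> B \<subseteq> {1..q} \<and> card A = r + 1 \<and> card B = r + 1}"

text \<open>The sum of a family of ideals is the ideal generated by their union.\<close>

definition I_ideal :: "nat \<Rightarrow> (nat \<Rightarrow> nat) \<Rightarrow> (nat \<times> nat) cpoly set" where
  "I_ideal n w =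
     Idl\<^bsub>S_ring n\<^esub> (\<Union>(p, q) \<in> essential_set n w. rank_ideal n p q (rk w p q))"

definition admissible_order :: "nat \<Rightarrow> (nat \<Rightarrow> nat) \<Rightarrow> (nat \<times> nat) list \<Rightarrow> bool" where
  "admissible_order n w es \<longleftrightarrow>
     distinct es \<and> set es = essential_pos n w \<and> sorted (map (\<lambda>(p, q). rk w p q) es)"

text \<open>In an enumeration \<open>es\<close> of the essential positions of positive rank, indices start at 0.\<close>

definition region :: "nat \<Rightarrow> (nat \<Rightarrow> nat) \<Rightarrow> (nat \<times> nat) list \<Rightarrow> nat \<Rightarrow> (nat \<times> nat) set" where
  "region n w es m =
     {a \<in> diagram_pos n w. weakly_SW a (es ! m) \<and> (\<forall>m' < m. \<not> weakly_SW a (es ! m'))}"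

text \<open>
  The subtraction in \<open>y - r\<close> does not truncate: for a diagram position \<open>(x, y)\<close> in region \<open>m\<close> the
  rank \<open>r\<close> at \<open>es ! m\<close> equals the rank at \<open>(x, y)\<close>, which is less than \<open>y\<close>.
\<close>

definition f_gen ::
  "nat \<Rightarrow> (nat \<Rightarrow> nat) \<Rightarrow> (nat \<times> nat) list \<Rightarrow> nat \<times> nat \<Rightarrow> (nat \<times> nat) cpoly" where
  "f_gen n w es = (\<lambda>(x, y).
     if rk w x y = 0 then M_minor {x} {y}
     else
       let m = (THE m. m < length es \<and> (x, y) \<in> region n w es m);
           (p, q) = es ! m;
           r = rk w p q
       in M_minor ({p..p + r - 1} \<union> {x + r}) ({y - r} \<union> {q - r + 1..q}))"

definition J_ideal ::
  "nat \<Rightarrow> (nat \<Rightarrow> nat) \<Rightarrow> (nat \<times> nat) list \<Rightarrow> (nat \<times> nat) cpoly set" where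
  "J_ideal n w es = Idl\<^bsub>S_ring n\<^esub> (f_gen n w es ` diagram n w)"

subsection \<open>Local complete intersections\<close>

text \<open>
  \<open>loc_frac R P a s\<close> is the fraction \<open>a / s\<close> in the localization of \<open>R\<close> at the prime \<open>P\<close>, as the class
  of all \<open>(b, t)\<close> such that \<open>u (a t - b s) = 0\<close> for some \<open>u\<close> outside \<open>P\<close>.
\<close>

definition loc_frac :: "('a, 'm) ring_scheme \<Rightarrow> 'a set \<Rightarrow> 'a \<Rightarrow> 'a \<Rightarrow> ('a \<times> 'a) set" where
  "loc_frac R P a s =
     {(b, t). b \<in> carrier R \<and> t \<in> carrier R - P \<and>
        (\<exists>u \<in> carrier R - P. u \<otimes>\<^bsub>R\<^esub> (a \<otimes>\<^bsub>R\<^esub> t) = u \<otimes>\<^bsub>R\<^esub> (b \<otimes>\<^bsub>R\<^esub> s))}"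

definition localization :: "('a, 'm) ring_scheme \<Rightarrow> 'a set \<Rightarrow> ('a \<times> 'a) set ring" where
  "localization R P =
     \<lparr>carrier = {loc_frac R P a s | a s. a \<in> carrier R \<and> s \<in> carrier R - P},
      monoid.mult = (\<lambda>X Y. \<Union>(a, s) \<in> X. \<Union>(b, t) \<in> Y. loc_frac R P (a \<otimes>\<^bsub>R\<^esub> b) (s \<otimes>\<^bsub>R\<^esub> t)),
      one = loc_frac R P \<one>\<^bsub>R\<^esub> \<one>\<^bsub>R\<^esub>,
      zero = loc_frac R P \<zero>\<^bsub>R\<^esub> \<one>\<^bsub>R\<^esub>,
      add = (\<lambda>X Y. \<Union>(a, s) \<in> X. \<Union>(b, t) \<in> Y.
               loc_frac R P (a \<otimes>\<^bsub>R\<^esub> t \<oplus>\<^bsub>R\<^esub> b \<otimes>\<^bsub>R\<^esub> s) (s \<otimes>\<^bsub>R\<^esub> t))\<rparr>"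

text \<open>
  Each \<open>fs ! i\<close> is a nonzerodivisor modulo the ideal generated by its predecessors, and the
  sequence does not generate the unit ideal.
\<close>

definition regular_sequence :: "('a, 'm) ring_scheme \<Rightarrow> 'a list \<Rightarrow> bool" where
  "regular_sequence R fs \<longleftrightarrow>
     set fs \<subseteq> carrier R \<and>
     Idl\<^bsub>R\<^esub> (set fs) \<noteq> carrier R \<and>
     (\<forall>i < length fs. \<forall>g \<in> carrier R.
        fs ! i \<otimes>\<^bsub>R\<^esub> g \<in> Idl\<^bsub>R\<^esub> (set (take i fs)) \<longrightarrow> g \<in> Idl\<^bsub>R\<^esub> (set (take i fs)))"

text \<open>
  A local ring is a complete intersection if it is the quotient of a regular local ring by a
  regular sequence. For local rings of schemes of finite type over \<open>\<complex>\<close>, the regular local ring may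
  be taken to be the localization of a polynomial ring over \<open>\<complex>\<close> at a prime ideal: such localizations
  are regular, every such local ring is a quotient of one of them, and whether the kernel is
  generated by a regular sequence does not depend on the presentation. The index type of
  the variables only needs to be infinite.
\<close>

definition complete_intersection_local_ring :: "('a, 'm) ring_scheme \<Rightarrow> bool" where
  "complete_intersection_local_ring B \<longleftrightarrow>
     (\<exists>(V :: (nat \<times> nat) set) P fs.
        finite V \<and>
        primeideal P (poly_ring V) \<and>
        regular_sequence (localization (poly_ring V) P) fs \<and>
        B \<simeq> localization (poly_ring V) P Quot (Idl\<^bsub>localization (poly_ring V) P\<^esub> (set fs)))"

text \<open>
  \<open>Spec A\<close> is a local complete intersection, for a ring \<open>A\<close> that is a finitely generated
  \<open>\<complex>\<close>-algebra: all local rings of \<open>Spec A\<close> are complete intersections.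
\<close>

definition Spec_local_complete_intersection :: "('a, 'm) ring_scheme \<Rightarrow> bool" where
  "Spec_local_complete_intersection A \<longleftrightarrow>
     (\<forall>Q. primeideal Q A \<longrightarrow> complete_intersection_local_ring (localization A Q))"

end

theory Submission
  imports Defs "HOL-Library.Infinite_Typeclass"
begin

text \<open>
  Let \<open>N\<close> be the inverse of \<open>M\<close> and let \<open>r\<close> be the rank at an essential position \<open>(p, q)\<close>. If the
  condition there is an inclusion and \<open>r > 0\<close>, then \<open>r = q - p + 1\<close>, and \<open>M N = I\<close> shows that modulo
  the entries \<open>N\<^bsub>x,y\<^esub>\<close> with \<open>x > q\<close>, \<open>y < p\<close>, the first \<open>q\<close> columns of \<open>M\<close> below row \<open>p\<close> are
  combinations of the \<open>r\<close> columns \<open>p, \<dots>, q\<close>. So the minors of size \<open>r + 1\<close> lie in the ideal of these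
  entries. All entries \<open>N\<^bsub>x,y\<^esub>\<close> with \<open>x > max w\<inverse>[1, y]\<close> belong to \<open>J\<^sub>w\<close>, by induction on \<open>x - y\<close>:
  either \<open>N M = I\<close> or \<open>M N = I\<close> expresses such an entry by earlier ones, or it is, up to sign and
  earlier entries, the generator of \<open>J\<^sub>w\<close> at the diagram position \<open>(x - r, y + r)\<close>, where \<open>(p, q)\<close> is
  the first essential position with \<open>x > q\<close> and \<open>y < p\<close>. Hence \<open>I\<^sub>w = J\<^sub>w\<close> has \<open>#D(w)\<close> generators.

  The grade of \<open>I\<^sub>w\<close> is at least \<open>#D(w)\<close>. The matrices that satisfy the rank conditions are
  stratified by their pivot positions \<open>v\<close>, the codimension of a stratum is at least the one for
  \<open>v = w\<close> by an induction along the Bruhat order, and an LU decomposition passes from generic to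
  unitriangular matrices. An ideal with as many generators as its grade is generated by a regular
  sequence, after adjoining variables for generic combinations of the generators.
\<close>

text \<open>The argument rests on a count: the ideal has \<open>card D\<close> generators, and grade
  at least this number turns them into a regular sequence. Grade is handled directly through
  iterated nonzerodivisors, so neither dimensions nor associated primes enter. The obstacle is to
  find one element that is regular modulo several ideals at once. Instead of prime avoidance an
  indeterminate is adjoined: by McCoy's theorem a polynomial in a new variable is regular as soon as
  its coefficients have no common annihilator. The inverse matrix \<open>N\<close> enters because an
  inclusion condition, determinantal in the entries of \<open>M\<close>, is linear in those of
  \<open>N\<close>: it says that a rectangular block of \<open>N\<close> vanishes. The
  stratification needs an independent variable in every matrix position. The constants of
  \<open>M\<close> on and above the diagonal would spoil this, which is why generic matrices come
  first.\<close>

global_interpretation rid: Modules.module "times :: 'a::comm_ring_1 \<Rightarrow> 'a \<Rightarrow> 'a"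
  by unfold_locales (auto simp: algebra_simps)

declare rid.scale_scale [simp del]

section \<open>Polynomial algebra: coefficients in one variable and substitution\<close>

section \<open>Polynomials\<close>

definition pvars :: "'v cpoly \<Rightarrow> 'v set" where
  "pvars f = (\<Union>m \<in> Poly_Mapping.keys f. Poly_Mapping.keys m)"

abbreviation pconst :: "complex \<Rightarrow> 'v cpoly" where
  "pconst c \<equiv> Poly_Mapping.single 0 c"

lemma finite_pvars [simp]: "finite (pvars f)"
  by (simp add: pvars_def)

lemma pvars_0 [simp]: "pvars 0 = {}" and pvars_1 [simp]: "pvars 1 = {}"
  by (auto simp: pvars_def)

lemma pvars_pvar [simp]: "pvars (pvar v) = {v}"
  by (simp add: pvars_def pvar_def)

lemma pvars_add: "pvars (f + g) \<subseteq> pvars f \<union> pvars g"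
  using Poly_Mapping.keys_add[of f g] by (auto simp: pvars_def)

lemma pvars_uminus [simp]: "pvars (- f) = pvars f"
  by (simp add: pvars_def in_keys_iff)

lemma pvars_diff: "pvars (f - g) \<subseteq> pvars f \<union> pvars g"
  using pvars_add[of f "- g"] by simp

lemma keys_add_nat: "Poly_Mapping.keys (a + b) = Poly_Mapping.keys a \<union> Poly_Mapping.keys b"
  for a b :: "'v \<Rightarrow>\<^sub>0 nat"
  by (auto simp: in_keys_iff lookup_add)

lemma pvars_mult: "pvars (f * g) \<subseteq> pvars f \<union> pvars g"
proof
  fix v assume "v \<in> pvars (f * g)"
  then obtain m where "m \<in> Poly_Mapping.keys (f * g)" "v \<in> Poly_Mapping.keys m"
    by (auto simp: pvars_def)
  moreover then obtain a b where "m = a + b" "a \<in> Poly_Mapping.keys f" "b \<in> Poly_Mapping.keys g"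
    using keys_mult by blast
  ultimately show "v \<in> pvars f \<union> pvars g" by (auto simp: pvars_def keys_add_nat)
qed

lemma pvars_sum: "pvars (sum f I) \<subseteq> (\<Union>i \<in> I. pvars (f i))"
proof (cases "finite I")
  case True
  then show ?thesis
  proof (induction I)
    case (insert x I)
    then show ?case using pvars_add[of "f x" "sum f I"] by auto
  qed auto
qed auto

lemma pvars_prod: "pvars (prod f I) \<subseteq> (\<Union>i \<in> I. pvars (f i))"
proof (cases "finite I")
  case True
  then show ?thesis
  proof (induction I)
    case (insert x I)
    then show ?case using pvars_mult[of "f x" "prod f I"] by auto
  qed auto
qed auto

lemma pvars_power: "pvars (f ^ k) \<subseteq> pvars f"
proof (induction k)
  case (Suc k)
  then show ?case using pvars_mult[of f "f ^ k"] by auto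
qed auto

lemma cpoly_sum_single:
  fixes f :: "'v cpoly"
  shows "(\<Sum>m \<in> Poly_Mapping.keys f. Poly_Mapping.single m (Poly_Mapping.lookup f m)) = f"
proof (rule poly_mapping_eqI)
  fix k
  have "(\<Sum>m \<in> Poly_Mapping.keys f. Poly_Mapping.lookup (Poly_Mapping.single m (Poly_Mapping.lookup f m)) k)
    = (\<Sum>m \<in> Poly_Mapping.keys f. if m = k then Poly_Mapping.lookup f k else 0)"
    by (rule sum.cong) (auto simp: lookup_single when_def)
  then show "Poly_Mapping.lookup (\<Sum>m \<in> Poly_Mapping.keys f. Poly_Mapping.single m (Poly_Mapping.lookup f m)) k
    = Poly_Mapping.lookup f k"
    by (auto simp: lookup_sum in_keys_iff)
qed

lemma cpoly_induct [case_names single add]: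
  fixes f :: "'v cpoly"
  assumes single: "\<And>m c. P (Poly_Mapping.single m c)"
    and add: "\<And>f g. P f \<Longrightarrow> P g \<Longrightarrow> P (f + g)"
  shows "P f"
proof -
  have "P (\<Sum>m \<in> M. Poly_Mapping.single m (Poly_Mapping.lookup f m))" if "finite M" for M
    using that
  proof (induction M)
    case empty
    then show ?case using single[of 0 0] by simp
  next
    case (insert x M)
    then show ?case using single add by auto
  qed
  then show ?thesis using cpoly_sum_single[of f] by (metis finite_keys)
qed

lemma pvar_power: "pvar v ^ j = Poly_Mapping.single (Poly_Mapping.single v j) 1"
proof (induction j)
  case (Suc j)
  have "Poly_Mapping.single v (Suc j) = Poly_Mapping.single v 1 + Poly_Mapping.single v j"
    by (simp flip: Poly_Mapping.single_add)
  then show ?case using Suc by (simp add: pvar_def mult_single)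
qed simp

text \<open>The coefficient of \<open>pvar v ^ i\<close> when \<open>f\<close> is read as a
  polynomial in \<open>v\<close>. The guard admits only monomials \<open>m\<close> free of
  \<open>v\<close>, so the coefficient no longer involves \<open>v\<close>.\<close>

lift_definition vcoeff :: "'v \<Rightarrow> nat \<Rightarrow> 'v cpoly \<Rightarrow> 'v cpoly" is
  "\<lambda>v i f m. if Poly_Mapping.lookup m v = 0 then f (m + Poly_Mapping.single v i) else 0"
proof -
  fix v :: 'v and i :: nat and f :: "('v \<Rightarrow>\<^sub>0 nat) \<Rightarrow> complex"
  assume fin: "finite {x. f x \<noteq> 0}"
  have "inj (\<lambda>m. m + Poly_Mapping.single v i)" by (rule injI) (erule add_right_imp_eq)
  then have "finite ((\<lambda>m. m + Poly_Mapping.single v i) -` {x. f x \<noteq> 0})"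
    by (rule finite_vimageI[OF fin])
  then show "finite {m. (if Poly_Mapping.lookup m v = 0 then f (m + Poly_Mapping.single v i) else 0) \<noteq> 0}"
    by (rule rev_finite_subset) auto
qed

lemma vcoeff_add: "vcoeff v i (f + g) = vcoeff v i f + vcoeff v i g"
  by (rule poly_mapping_eqI) (simp add: vcoeff.rep_eq lookup_add)

lemma vcoeff_0 [simp]: "vcoeff v i 0 = 0"
  by (rule poly_mapping_eqI) (simp add: vcoeff.rep_eq)

lemma vcoeff_uminus: "vcoeff v i (- f) = - vcoeff v i f"
  by (rule poly_mapping_eqI) (simp add: vcoeff.rep_eq)

lemma vcoeff_diff: "vcoeff v i (f - g) = vcoeff v i f - vcoeff v i g"
  using vcoeff_add[of v i f "- g"] by (simp add: vcoeff_uminus)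

lemma vcoeff_sum: "vcoeff v i (sum f I) = (\<Sum>j \<in> I. vcoeff v i (f j))"
  by (induction I rule: infinite_finite_induct) (auto simp: vcoeff_add)

lemma pvars_vcoeff: "pvars (vcoeff v i f) \<subseteq> pvars f - {v}"
proof
  fix u assume "u \<in> pvars (vcoeff v i f)"
  then obtain m where m: "Poly_Mapping.lookup (vcoeff v i f) m \<noteq> 0" "Poly_Mapping.lookup m u \<noteq> 0"
    by (auto simp: pvars_def in_keys_iff)
  then have "Poly_Mapping.lookup m v = 0" "Poly_Mapping.lookup f (m + Poly_Mapping.single v i) \<noteq> 0"
    by (auto simp: vcoeff.rep_eq split: if_splits)
  moreover have "Poly_Mapping.lookup (m + Poly_Mapping.single v i) u \<noteq> 0"
    using m by (simp add: lookup_add)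
  ultimately show "u \<in> pvars f - {v}" using m by (auto simp: pvars_def in_keys_iff)
qed

definition mdel :: "'v \<Rightarrow> ('v \<Rightarrow>\<^sub>0 nat) \<Rightarrow> ('v \<Rightarrow>\<^sub>0 nat)" where
  "mdel v m = m - Poly_Mapping.single v (Poly_Mapping.lookup m v)"

lemma mdel_eq_iff:
  "m = k + Poly_Mapping.single v i \<longleftrightarrow> mdel v m = k \<and> Poly_Mapping.lookup m v = i"
  if "Poly_Mapping.lookup k v = 0"
proof
  assume "m = k + Poly_Mapping.single v i"
  then show "mdel v m = k \<and> Poly_Mapping.lookup m v = i"
    using that by (auto simp: mdel_def lookup_add)
next
  assume *: "mdel v m = k \<and> Poly_Mapping.lookup m v = i"
  show "m = k + Poly_Mapping.single v i"
  proof (rule poly_mapping_eqI)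
    fix u
    show "Poly_Mapping.lookup m u = Poly_Mapping.lookup (k + Poly_Mapping.single v i) u"
      using * by (auto simp: mdel_def lookup_add lookup_minus lookup_single when_def)
  qed
qed

lemma vcoeff_single:
  "vcoeff v i (Poly_Mapping.single m c) =
    (if Poly_Mapping.lookup m v = i then Poly_Mapping.single (mdel v m) c else 0)"
proof (rule poly_mapping_eqI)
  fix k
  have "Poly_Mapping.lookup (mdel v m) v = 0" by (simp add: mdel_def lookup_minus)
  then show "Poly_Mapping.lookup (vcoeff v i (Poly_Mapping.single m c)) k =
      Poly_Mapping.lookup (if Poly_Mapping.lookup m v = i then Poly_Mapping.single (mdel v m) c else 0) k"
    by (cases "Poly_Mapping.lookup k v = 0")
      (auto simp: vcoeff.rep_eq lookup_single when_def mdel_eq_iff)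
qed

lemma mdel_add: "mdel v (m + k) = mdel v m + mdel v k"
proof (rule poly_mapping_eqI)
  fix u
  show "Poly_Mapping.lookup (mdel v (m + k)) u = Poly_Mapping.lookup (mdel v m + mdel v k) u"
    by (auto simp: mdel_def lookup_add lookup_minus lookup_single when_def)
qed

lemma mdel_free: "Poly_Mapping.lookup m v = 0 \<Longrightarrow> mdel v m = m"
  by (simp add: mdel_def)

lemma vcoeff_single_mult:
  assumes "Poly_Mapping.lookup m v = 0"
  shows "vcoeff v i (Poly_Mapping.single m c * f) = Poly_Mapping.single m c * vcoeff v i f"
proof (induction f rule: cpoly_induct)
  case (single k d)
  then show ?case using assms
    by (auto simp: mult_single vcoeff_single lookup_add mdel_add mdel_free)
qed (auto simp: vcoeff_add distrib_left)

lemma vcoeff_mult: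
  assumes "v \<notin> pvars g"
  shows "vcoeff v i (g * f) = g * vcoeff v i f"
proof -
  have "vcoeff v i (Poly_Mapping.single m (Poly_Mapping.lookup g m) * f) =
      Poly_Mapping.single m (Poly_Mapping.lookup g m) * vcoeff v i f"
    if "m \<in> Poly_Mapping.keys g" for m
    using assms that by (intro vcoeff_single_mult) (auto simp: pvars_def in_keys_iff)
  then have "vcoeff v i ((\<Sum>m \<in> Poly_Mapping.keys g. Poly_Mapping.single m (Poly_Mapping.lookup g m)) * f)
      = (\<Sum>m \<in> Poly_Mapping.keys g. Poly_Mapping.single m (Poly_Mapping.lookup g m)) * vcoeff v i f"
    by (simp add: vcoeff_sum sum_distrib_right)
  then show ?thesis by (simp add: cpoly_sum_single)
qed

lemma vcoeff_pvar_power_mult: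
  "vcoeff v i (pvar v ^ j * f) = (if j \<le> i then vcoeff v (i - j) f else 0)"
proof (induction j arbitrary: i)
  case (Suc j)
  have *: "vcoeff v i (pvar v * f) = (case i of 0 \<Rightarrow> 0 | Suc i \<Rightarrow> vcoeff v i f)" for i and f :: "'a cpoly"
  proof (induction f rule: cpoly_induct)
    case (single m c)
    show ?case
      by (auto simp: pvar_def mult_single vcoeff_single lookup_add mdel_add split: nat.splits)
        (auto simp: mdel_def)
  qed (auto simp: vcoeff_add distrib_left split: nat.splits)
  have "vcoeff v i (pvar v ^ Suc j * f) = vcoeff v i (pvar v * (pvar v ^ j * f))"
    by (simp only: power_Suc mult.assoc)
  also have "\<dots> = (case i of 0 \<Rightarrow> 0 | Suc i \<Rightarrow> vcoeff v i (pvar v ^ j * f))"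
    by (rule *)
  finally show ?case by (auto simp: Suc split: nat.splits)
qed simp

lemma vcoeff_free:
  assumes "v \<notin> pvars f"
  shows "vcoeff v i f = (if i = 0 then f else 0)"
proof -
  have "vcoeff v i (1 :: 'a cpoly) = (if i = 0 then 1 else 0)"
    using vcoeff_single[of v i 0 1] by (auto simp: mdel_def)
  then show ?thesis using vcoeff_mult[OF assms, of i 1] by simp
qed

lemma vcoeff_expansion:
  obtains N where "f = (\<Sum>i<N. pvar v ^ i * vcoeff v i f)" "\<And>i. i \<ge> N \<Longrightarrow> vcoeff v i f = 0"
proof -
  \<comment> \<open>All longer expansions are asserted too, so that those of two summands can be
    brought to a common length.\<close>
  have "\<exists>N. (\<forall>M \<ge> N. f = (\<Sum>i<M. pvar v ^ i * vcoeff v i f)) \<and> (\<forall>i \<ge> N. vcoeff v i f = 0)"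
  proof (induction f rule: cpoly_induct)
    case (single m c)
    let ?l = "Poly_Mapping.lookup m v"
    have "Poly_Mapping.single m c = (\<Sum>i<M. pvar v ^ i * vcoeff v i (Poly_Mapping.single m c))"
      if "M \<ge> Suc ?l" for M
    proof -
      have "(\<Sum>i<M. pvar v ^ i * vcoeff v i (Poly_Mapping.single m c))
          = (\<Sum>i<M. if i = ?l then pvar v ^ i * vcoeff v i (Poly_Mapping.single m c) else 0)"
        by (rule sum.cong) (auto simp: vcoeff_single)
      also have "\<dots> = pvar v ^ ?l * Poly_Mapping.single (mdel v m) c"
        using that by (simp add: vcoeff_single)
      also have "\<dots> = Poly_Mapping.single m c"
      proof -
        have "m = mdel v m + Poly_Mapping.single v ?l"
          using mdel_eq_iff[of "mdel v m" v m ?l] by (simp add: mdel_def lookup_minus)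
        then show ?thesis by (simp add: pvar_power mult_single add.commute)
      qed
      finally show ?thesis by simp
    qed
    moreover have "vcoeff v i (Poly_Mapping.single m c) = 0" if "i \<ge> Suc ?l" for i
      using that by (auto simp: vcoeff_single)
    ultimately show ?case by blast
  next
    case (add f g)
    then obtain N1 N2 where
      N: "\<forall>M \<ge> N1. f = (\<Sum>i<M. pvar v ^ i * vcoeff v i f)" "\<forall>i \<ge> N1. vcoeff v i f = 0"
      "\<forall>M \<ge> N2. g = (\<Sum>i<M. pvar v ^ i * vcoeff v i g)" "\<forall>i \<ge> N2. vcoeff v i g = 0"
      by blast
    have "f + g = (\<Sum>i<M. pvar v ^ i * vcoeff v i (f + g))" if "M \<ge> max N1 N2" for M
    proof -
      have "f = (\<Sum>i<M. pvar v ^ i * vcoeff v i f)" "g = (\<Sum>i<M. pvar v ^ i * vcoeff v i g)"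
        using N that by auto
      then have "f + g = (\<Sum>i<M. pvar v ^ i * vcoeff v i f) + (\<Sum>i<M. pvar v ^ i * vcoeff v i g)"
        by (rule arg_cong2)
      also have "\<dots> = (\<Sum>i<M. pvar v ^ i * vcoeff v i (f + g))"
        by (simp only: vcoeff_add distrib_left sum.distrib)
      finally show ?thesis .
    qed
    moreover have "vcoeff v i (f + g) = 0" if "i \<ge> max N1 N2" for i
      using N that by (simp add: vcoeff_add)
    ultimately show ?case by blast
  qed
  then show ?thesis using that by blast
qed

lemma exists_fresh:
  fixes X :: "'v::infinite cpoly set"
  assumes "finite X" "finite U"
  obtains v where "v \<notin> U" "\<And>f. f \<in> X \<Longrightarrow> v \<notin> pvars f"
proof -
  have "finite (U \<union> (\<Union>f \<in> X. pvars f))" using assms by auto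
  then obtain v where "v \<notin> U \<union> (\<Union>f \<in> X. pvars f)"
    by (metis ex_new_if_finite infinite_UNIV)
  then show ?thesis using that by blast
qed

section \<open>Substitution\<close>

definition psubst :: "('v \<Rightarrow> 'w cpoly) \<Rightarrow> 'v cpoly \<Rightarrow> 'w cpoly" where
  "psubst g f = (\<Sum>m \<in> Poly_Mapping.keys f.
     pconst (Poly_Mapping.lookup f m) * (\<Prod>v \<in> Poly_Mapping.keys m. g v ^ Poly_Mapping.lookup m v))"

lemma psubst_superset:
  assumes "finite K" "Poly_Mapping.keys f \<subseteq> K"
  shows "psubst g f = (\<Sum>m \<in> K.
     pconst (Poly_Mapping.lookup f m) * (\<Prod>v \<in> Poly_Mapping.keys m. g v ^ Poly_Mapping.lookup m v))"
  unfolding psubst_def using assms by (intro sum.mono_neutral_left) (auto simp: in_keys_iff)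

lemma psubst_add: "psubst g (f1 + f2) = psubst g f1 + psubst g f2"
proof -
  let ?K = "Poly_Mapping.keys f1 \<union> Poly_Mapping.keys f2"
  have "psubst g f = (\<Sum>m \<in> ?K.
     pconst (Poly_Mapping.lookup f m) * (\<Prod>v \<in> Poly_Mapping.keys m. g v ^ Poly_Mapping.lookup m v))"
    if "f \<in> {f1, f2, f1 + f2}" for f
    using that Poly_Mapping.keys_add[of f1 f2] by (intro psubst_superset) auto
  then show ?thesis
    by (simp add: lookup_add Poly_Mapping.single_add distrib_right sum.distrib)
qed

lemma psubst_single:
  "psubst g (Poly_Mapping.single m c) =
    pconst c * (\<Prod>v \<in> Poly_Mapping.keys m. g v ^ Poly_Mapping.lookup m v)"
  using psubst_superset[of "{m}" "Poly_Mapping.single m c" g] by simp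

lemma psubst_mult:
  fixes g :: "'v \<Rightarrow> 'w cpoly"
  shows "psubst g (f1 * f2) = psubst g f1 * psubst g f2"
proof -
  have mono: "(\<Prod>v \<in> Poly_Mapping.keys (m + k). g v ^ Poly_Mapping.lookup (m + k) v) =
      (\<Prod>v \<in> Poly_Mapping.keys m. g v ^ Poly_Mapping.lookup m v) *
      (\<Prod>v \<in> Poly_Mapping.keys k. g v ^ Poly_Mapping.lookup k v)" for m k
  proof -
    let ?K = "Poly_Mapping.keys m \<union> Poly_Mapping.keys k"
    have *: "(\<Prod>v \<in> Poly_Mapping.keys l. g v ^ Poly_Mapping.lookup l v) = (\<Prod>v \<in> ?K. g v ^ Poly_Mapping.lookup l v)"
      if "Poly_Mapping.keys l \<subseteq> ?K" for l
      using that by (intro prod.mono_neutral_left) (auto simp: in_keys_iff)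
    show ?thesis
      by (simp add: * keys_add_nat lookup_add power_add prod.distrib)
  qed
  have 1: "psubst g (Poly_Mapping.single m c * f2) = psubst g (Poly_Mapping.single m c) * psubst g f2" for m c
  proof (induction f2 rule: cpoly_induct)
    case (single k d)
    have *: "pconst (c * d) = (pconst c * pconst d :: 'w cpoly)" by (simp add: mult_single)
    have "psubst g (Poly_Mapping.single m c * Poly_Mapping.single k d) = (pconst c * pconst d) *
        ((\<Prod>v \<in> Poly_Mapping.keys m. g v ^ Poly_Mapping.lookup m v) *
        (\<Prod>v \<in> Poly_Mapping.keys k. g v ^ Poly_Mapping.lookup k v))"
      by (simp only: mult_single[of m] psubst_single mono *)
    then show ?case
      by (simp only: psubst_single mult_ac)
  qed (auto simp: psubst_add distrib_left)
  show ?thesis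
    by (induction f1 rule: cpoly_induct) (auto simp: 1 psubst_add distrib_right)
qed

lemma psubst_const [simp]: "psubst g (pconst c) = pconst c"
  by (simp add: psubst_single)

lemma psubst_1 [simp]: "psubst g 1 = 1" and psubst_0 [simp]: "psubst g 0 = 0"
  using psubst_const[of g 1] psubst_const[of g 0] by simp_all

lemma psubst_uminus: "psubst g (- f) = - psubst g f"
  using psubst_add[of g f "- f"] by (simp add: add_eq_0_iff2)

lemma psubst_diff: "psubst g (f1 - f2) = psubst g f1 - psubst g f2"
  using psubst_add[of g f1 "- f2"] by (simp add: psubst_uminus)

lemma psubst_sum: "psubst g (sum f I) = (\<Sum>i \<in> I. psubst g (f i))"
  by (induction I rule: infinite_finite_induct) (auto simp: psubst_add)

lemma psubst_prod: "psubst g (prod f I) = (\<Prod>i \<in> I. psubst g (f i))"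
  by (induction I rule: infinite_finite_induct) (auto simp: psubst_mult)

lemma psubst_power: "psubst g (f ^ k) = psubst g f ^ k"
  by (induction k) (auto simp: psubst_mult)

lemma psubst_pvar [simp]: "psubst g (pvar v) = g v"
  by (simp add: pvar_def psubst_single)

lemma psubst_cong:
  assumes "\<And>v. v \<in> pvars f \<Longrightarrow> g v = h v"
  shows "psubst g f = psubst h f"
  unfolding psubst_def using assms
  by (intro sum.cong prod.cong arg_cong2[of _ _ _ _ "(*)"] arg_cong2[of _ _ _ _ "(^)"]) (auto simp: pvars_def)

lemma prod_pvar: "(\<Prod>v \<in> Poly_Mapping.keys m. pvar v ^ Poly_Mapping.lookup m v) = Poly_Mapping.single m 1"
proof -
  have "(\<Prod>v \<in> K. pvar v ^ Poly_Mapping.lookup m v) =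
      Poly_Mapping.single (\<Sum>v \<in> K. Poly_Mapping.single v (Poly_Mapping.lookup m v)) 1" if "finite K" for K
    using that by (induction K) (auto simp: pvar_power mult_single)
  moreover have "(\<Sum>v \<in> Poly_Mapping.keys m. Poly_Mapping.single v (Poly_Mapping.lookup m v)) = m"
  proof (rule poly_mapping_eqI)
    fix k
    have "(\<Sum>v \<in> Poly_Mapping.keys m. Poly_Mapping.lookup (Poly_Mapping.single v (Poly_Mapping.lookup m v)) k)
      = (\<Sum>v \<in> Poly_Mapping.keys m. if v = k then Poly_Mapping.lookup m k else 0)"
      by (rule sum.cong) (auto simp: lookup_single when_def)
    then show "Poly_Mapping.lookup (\<Sum>v \<in> Poly_Mapping.keys m. Poly_Mapping.single v (Poly_Mapping.lookup m v)) k
      = Poly_Mapping.lookup m k"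
      by (auto simp: lookup_sum in_keys_iff)
  qed
  ultimately show ?thesis by simp
qed

lemma psubst_id [simp]: "psubst pvar f = f"
proof -
  have "psubst pvar f = (\<Sum>m \<in> Poly_Mapping.keys f. Poly_Mapping.single m (Poly_Mapping.lookup f m))"
    by (simp add: psubst_def mult_single prod_pvar)
  then show ?thesis by (simp only: cpoly_sum_single)
qed

lemma psubst_psubst: "psubst g (psubst h f) = psubst (\<lambda>v. psubst g (h v)) f"
  by (induction f rule: cpoly_induct)
    (auto simp: psubst_single psubst_mult psubst_prod psubst_power psubst_add)

lemma pvars_psubst: "pvars (psubst g f) \<subseteq> (\<Union>v \<in> pvars f. pvars (g v))"
proof -
  have c: "pvars (pconst c) = {}" for c by (simp add: pvars_def)
  have "pvars (pconst (Poly_Mapping.lookup f m) * (\<Prod>v \<in> Poly_Mapping.keys m. g v ^ Poly_Mapping.lookup m v))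
      \<subseteq> (\<Union>v \<in> pvars f. pvars (g v))" if "m \<in> Poly_Mapping.keys f" for m
  proof -
    have "pvars (\<Prod>v \<in> Poly_Mapping.keys m. g v ^ Poly_Mapping.lookup m v)
        \<subseteq> (\<Union>v \<in> Poly_Mapping.keys m. pvars (g v ^ Poly_Mapping.lookup m v))"
      by (rule pvars_prod)
    also have "\<dots> \<subseteq> (\<Union>v \<in> Poly_Mapping.keys m. pvars (g v))"
      by (intro UN_mono pvars_power subset_refl)
    also have "\<dots> \<subseteq> (\<Union>v \<in> pvars f. pvars (g v))"
      using that by (auto simp: pvars_def)
    finally show ?thesis using pvars_mult[of "pconst (Poly_Mapping.lookup f m)"] c by fastforce
  qed
  then have "(\<Union>m \<in> Poly_Mapping.keys f. pvars (pconst (Poly_Mapping.lookup f m) *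
      (\<Prod>v \<in> Poly_Mapping.keys m. g v ^ Poly_Mapping.lookup m v))) \<subseteq> (\<Union>v \<in> pvars f. pvars (g v))"
    by (rule UN_least)
  then show ?thesis unfolding psubst_def using pvars_sum by (rule subset_trans[rotated])
qed

section \<open>Commutative algebra of grade and regular sequences\<close>

section \<open>Grade\<close>

text \<open>The zero quotient is not excluded: every element is a nonzerodivisor there, and the unit
  ideal gets infinite grade. Case distinctions can then treat empty pieces like any other.\<close>

definition nzd_mod :: "'a::comm_ring_1 \<Rightarrow> 'a set \<Rightarrow> bool" where
  "nzd_mod a F \<longleftrightarrow> (\<forall>g. a * g \<in> rid.span F \<longrightarrow> g \<in> rid.span F)"

text \<open>The ideal of \<open>B\<close> has no nonzero annihilator in the quotient by
  \<open>F\<close>. Over a Noetherian ring this already yields a nonzerodivisor in that ideal; here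
  it yields one after a variable is adjoined.\<close>

definition faithful_mod :: "'a::comm_ring_1 set \<Rightarrow> 'a set \<Rightarrow> bool" where
  "faithful_mod B F \<longleftrightarrow> (\<forall>g. (\<forall>b \<in> B. b * g \<in> rid.span F) \<longrightarrow> g \<in> rid.span F)"

lemma nzd_modD: "nzd_mod a F \<Longrightarrow> a * g \<in> rid.span F \<Longrightarrow> g \<in> rid.span F"
  by (simp add: nzd_mod_def)

lemma faithful_modD:
  "faithful_mod B F \<Longrightarrow> (\<And>b. b \<in> B \<Longrightarrow> b * g \<in> rid.span F) \<Longrightarrow> g \<in> rid.span F"
  by (simp add: faithful_mod_def)

text \<open>The grade of the ideal \<open>\<langle>B\<rangle>\<close> on the quotient by \<open>\<langle>F\<rangle>\<close> is at least \<open>k\<close>.\<close>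

primrec grade_ge :: "nat \<Rightarrow> 'a::comm_ring_1 set \<Rightarrow> 'a set \<Rightarrow> bool" where
  "grade_ge 0 F B = True"
| "grade_ge (Suc k) F B = (\<exists>a \<in> rid.span (F \<union> B). nzd_mod a F \<and> grade_ge k (insert a F) B)"

lemma span_mult_left: "x \<in> rid.span S \<Longrightarrow> c * x \<in> rid.span S"
  by (rule rid.span_scale)

lemma span_mult_right: "x \<in> rid.span S \<Longrightarrow> x * c \<in> rid.span S"
  using rid.span_scale[of x S c] by (simp add: mult.commute)

lemma span_add_cancel_right: "x + y \<in> rid.span S \<Longrightarrow> y \<in> rid.span S \<Longrightarrow> x \<in> rid.span S"
  using rid.span_diff[of "x + y" S y] by simp

lemma span_add_cancel_left: "x + y \<in> rid.span S \<Longrightarrow> x \<in> rid.span S \<Longrightarrow> y \<in> rid.span S"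
  using rid.span_diff[of "x + y" S x] by simp

lemma span_insertE:
  assumes "x \<in> rid.span (insert a S)"
  obtains c y where "y \<in> rid.span S" "x = c * a + y"
proof -
  obtain k where "x - k * a \<in> rid.span S"
    using assms by (auto simp: rid.span_insert)
  then show ?thesis using that[of "x - k * a" k] by simp
qed

lemma span_insertI: "y \<in> rid.span S \<Longrightarrow> c * a + y \<in> rid.span (insert a S)"
  using rid.span_mono[of S "insert a S"]
  by (intro rid.span_add rid.span_scale) (auto intro: rid.span_base)

lemma span_subset_span: "S \<subseteq> rid.span T \<Longrightarrow> rid.span S \<subseteq> rid.span T"
  by (metis rid.span_minimal rid.subspace_span)

lemma span_insert_cong:
  "rid.span S = rid.span T \<Longrightarrow> rid.span (insert a S) = rid.span (insert a T)"
  by (simp add: rid.span_insert)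

lemma span_Un_cong:
  assumes "rid.span S = rid.span T" shows "rid.span (S \<union> B) = rid.span (T \<union> B)"
  using assms by (auto simp: rid.span_Un)

lemma nzd_mod_cong: "rid.span F = rid.span G \<Longrightarrow> nzd_mod a F = nzd_mod a G"
  by (simp add: nzd_mod_def)

lemma grade_ge_mono:
  assumes "grade_ge k F B" "B \<subseteq> rid.span (F \<union> C)"
  shows "grade_ge k F C"
  using assms
proof (induction k arbitrary: F)
  case (Suc k)
  obtain a where a: "a \<in> rid.span (F \<union> B)" "nzd_mod a F" "grade_ge k (insert a F) B"
    using Suc.prems by auto
  have "F \<union> B \<subseteq> rid.span (F \<union> C)"
    using Suc.prems(2) rid.span_superset[of "F \<union> C"] by auto
  then have "a \<in> rid.span (F \<union> C)" using a(1) span_subset_span by blast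
  moreover have "grade_ge k (insert a F) C"
    using Suc.IH[OF a(3)] Suc.prems(2) rid.span_mono[of "F \<union> C" "insert a F \<union> C"] by blast
  ultimately show ?case using a(2) by auto
qed auto

lemma grade_ge_unit:
  assumes "1 \<in> rid.span (F \<union> B)" shows "grade_ge k F B"
  using assms
proof (induction k arbitrary: F)
  case (Suc k)
  have "nzd_mod 1 F" by (simp add: nzd_mod_def)
  moreover have "grade_ge k (insert 1 F) B"
    by (rule Suc.IH) (simp add: rid.span_base)
  ultimately show ?case using Suc.prems by auto
qed auto

lemma grade_ge_le: "grade_ge k F B \<Longrightarrow> j \<le> k \<Longrightarrow> grade_ge j F B"
proof (induction k arbitrary: j F)
  case (Suc k)
  then show ?case by (cases j) auto
qed auto

text \<open>Modulo \<open>F\<close>, what \<open>B\<close> kills is killed by every combination of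
  \<open>F\<close> and \<open>B\<close>, in particular by the first nonzerodivisor.\<close>

lemma grade_ge_faithful:
  assumes "grade_ge (Suc k) F B" shows "faithful_mod B F"
  unfolding faithful_mod_def
proof (intro allI impI)
  fix g assume g: "\<forall>b \<in> B. b * g \<in> rid.span F"
  obtain a where a: "a \<in> rid.span (F \<union> B)" "nzd_mod a F"
    using assms by auto
  have "a * g \<in> rid.span F"
    using a(1)
  proof (induction rule: rid.span_induct_alt)
    case (step c x y)
    have "x * g \<in> rid.span F" using step(1) g by (auto intro: span_mult_right rid.span_base)
    then have "c * (x * g) + y * g \<in> rid.span F"
      using step(2) by (intro rid.span_add span_mult_left[of "x * g"])
    then show ?case by (simp add: algebra_simps)
  qed (simp add: rid.span_zero)
  then show "g \<in> rid.span F" using nzd_modD[OF a(2)] by blast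
qed

text \<open>Modulo \<open>F\<close>, \<open>a * g = s * c\<close> gives \<open>s = d * a\<close>
  plus a term in the ideal because \<open>c\<close> is regular modulo \<open>a\<close>, and
  cancelling \<open>a\<close> leaves \<open>g = d * c\<close>.\<close>

lemma nzd_mod_swap:
  assumes "nzd_mod a F" "nzd_mod c F" "nzd_mod c (insert a F)"
  shows "nzd_mod a (insert c F)"
  unfolding nzd_mod_def
proof (intro allI impI)
  fix g assume "a * g \<in> rid.span (insert c F)"
  then obtain s y where y: "y \<in> rid.span F" "a * g = s * c + y" by (rule span_insertE)
  have "c * s = g * a + (- y)" using y(2) by (simp add: algebra_simps)
  then have "c * s \<in> rid.span (insert a F)"
    using span_insertI[OF rid.span_neg[OF y(1)], of g a] by simp
  then have "s \<in> rid.span (insert a F)" using nzd_modD[OF assms(3)] by blast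
  then obtain d z where z: "z \<in> rid.span F" "s = d * a + z" by (rule span_insertE)
  have "a * (g - d * c) = c * z + y" using y(2) z(2) by (simp add: algebra_simps)
  then have "a * (g - d * c) \<in> rid.span F"
    using y(1) z(1) by (simp add: rid.span_add span_mult_left)
  then have "g - d * c \<in> rid.span F" using nzd_modD[OF assms(1)] by blast
  then show "g \<in> rid.span (insert c F)" using span_insertI[of "g - d * c" F d c] by simp
qed

subsection \<open>Generic elements\<close>

lemma vcoeff_bounded: obtains N where "\<And>i. i \<ge> N \<Longrightarrow> vcoeff v i f = 0"
  by (rule vcoeff_expansion[of f v]) (rule that)

text \<open>Taking a coefficient is linear over polynomials free of \<open>v\<close>. Together with
  \<open>span_vcoeff\<close>, membership in an ideal with generators free of \<open>v\<close> can be
  tested coefficient by coefficient.\<close>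

lemma vcoeff_span:
  assumes "f \<in> rid.span F" "\<And>x. x \<in> F \<Longrightarrow> v \<notin> pvars x"
  shows "vcoeff v i f \<in> rid.span F"
  using assms(1)
proof (induction rule: rid.span_induct_alt)
  case (step c x y)
  have "vcoeff v i (x * c) = x * vcoeff v i c" using assms(2) step(1) by (intro vcoeff_mult)
  then have "vcoeff v i (c * x + y) = vcoeff v i c * x + vcoeff v i y"
    by (simp add: vcoeff_add mult.commute)
  then show ?case using step by (simp add: rid.span_add rid.span_base span_mult_left)
qed (simp add: rid.span_zero)

lemma span_vcoeff:
  assumes "\<And>i. vcoeff v i f \<in> rid.span F" shows "f \<in> rid.span F"
proof -
  obtain N where N: "f = (\<Sum>i<N. pvar v ^ i * vcoeff v i f)" by (rule vcoeff_expansion)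
  have "(\<Sum>i<N. pvar v ^ i * vcoeff v i f) \<in> rid.span F"
    using assms by (intro rid.span_sum span_mult_left)
  then show ?thesis using N by simp
qed

text \<open>Powers of one variable take the place of independent coefficients: for McCoy's theorem
  only the common annihilator of \<open>bs\<close> matters, not the shape of the polynomial.\<close>

definition generic :: "'v \<Rightarrow> 'v cpoly list \<Rightarrow> 'v cpoly" where
  "generic u bs = (\<Sum>i<length bs. pvar u ^ i * bs ! i)"

lemma generic_in_span: "generic u bs \<in> rid.span (set bs)"
  unfolding generic_def by (intro rid.span_sum span_mult_left rid.span_base) auto

text \<open>McCoy's theorem: a polynomial in \<open>u\<close> is a zero divisor only if its coefficients have a common
  annihilator. The induction is on a bound for the degree in \<open>u\<close>, modulo the ideal.\<close>

lemma nzd_mod_generic: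
  assumes faithful: "faithful_mod (set bs) F"
    and F: "\<And>x. x \<in> F \<Longrightarrow> u \<notin> pvars x"
    and bs: "\<And>b. b \<in> set bs \<Longrightarrow> u \<notin> pvars b"
  shows "nzd_mod (generic u bs) F"
proof -
  let ?a = "generic u bs"
  \<comment> \<open>\<open>d\<close> bounds the degree of \<open>g\<close> in \<open>u\<close>
    modulo \<open>F\<close>: all coefficients from \<open>d\<close> on lie in the ideal.\<close>
  have main: "g \<in> rid.span F" if "?a * g \<in> rid.span F" "\<forall>k \<ge> d. vcoeff u k g \<in> rid.span F" for g d
    using that
  proof (induction d arbitrary: g)
    case 0
    then have "vcoeff u i g \<in> rid.span F" for i by simp
    then show ?case by (rule span_vcoeff)
  next
    case (Suc d)
    have "bs ! i * g \<in> rid.span F" if "i < length bs" for i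
      using that
    proof (induction "length bs - Suc i" arbitrary: i rule: less_induct)
      case less
      let ?n = "length bs"
      have split: "?a * g = (\<Sum>j<Suc i. pvar u ^ j * (bs ! j * g)) + (\<Sum>j=Suc i..<?n. pvar u ^ j * (bs ! j * g))"
      proof -
        have "{..<?n} = {..<Suc i} \<union> {Suc i..<?n}" "{..<Suc i} \<inter> {Suc i..<?n} = {}"
          using less(2) by auto
        then have "(\<Sum>j<?n. pvar u ^ j * (bs ! j * g)) =
            (\<Sum>j<Suc i. pvar u ^ j * (bs ! j * g)) + (\<Sum>j=Suc i..<?n. pvar u ^ j * (bs ! j * g))"
          by (simp only: sum.union_disjoint finite_lessThan finite_atLeastLessThan)
        then show ?thesis by (simp add: generic_def sum_distrib_right mult.assoc)
      qed
      have "(\<Sum>j=Suc i..<?n. pvar u ^ j * (bs ! j * g)) \<in> rid.span F"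
      proof (rule rid.span_sum)
        fix j assume "j \<in> {Suc i..<?n}"
        then have "bs ! j * g \<in> rid.span F" by (intro less(1)) auto
        then show "pvar u ^ j * (bs ! j * g) \<in> rid.span F" by (rule span_mult_left)
      qed
      then have low: "(\<Sum>j<Suc i. pvar u ^ j * (bs ! j * g)) \<in> rid.span F"
        using Suc.prems(1) span_add_cancel_right unfolding split by blast
      \<comment> \<open>In degree \<open>i + d\<close> the terms with \<open>j < i\<close> involve
        coefficients of \<open>g\<close> of index greater than \<open>d\<close>, which lie in the
        ideal. So the product of \<open>bs ! i\<close> with the coefficient of index
        \<open>d\<close> lies there too.\<close>
      have "vcoeff u (i + d) (\<Sum>j<Suc i. pvar u ^ j * (bs ! j * g)) =
          (\<Sum>j<Suc i. bs ! j * vcoeff u (i + d - j) g)"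
        unfolding vcoeff_sum
      proof (rule sum.cong)
        fix j assume j: "j \<in> {..<Suc i}"
        then have "u \<notin> pvars (bs ! j)" "j \<le> i + d" using bs less(2) by auto
        then show "vcoeff u (i + d) (pvar u ^ j * (bs ! j * g)) = bs ! j * vcoeff u (i + d - j) g"
          by (simp add: vcoeff_pvar_power_mult vcoeff_mult del: mult.assoc)
      qed simp
      then have "(\<Sum>j<i. bs ! j * vcoeff u (i + d - j) g) + bs ! i * vcoeff u d g \<in> rid.span F"
        using vcoeff_span[OF low F, of "i + d"] by simp
      moreover have "(\<Sum>j<i. bs ! j * vcoeff u (i + d - j) g) \<in> rid.span F"
        using Suc.prems(2) by (intro rid.span_sum span_mult_left) auto
      ultimately have top: "bs ! i * vcoeff u d g \<in> rid.span F"
        by (rule span_add_cancel_left)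
      have bi: "u \<notin> pvars (bs ! i)" using bs less(2) by auto
      \<comment> \<open>After multiplication by \<open>bs ! i\<close> the degree bound drops from
        \<open>Suc d\<close> to \<open>d\<close>, and the outer induction applies.\<close>
      have "?a * (bs ! i * g) \<in> rid.span F"
        using span_mult_left[OF Suc.prems(1), of "bs ! i"] by (simp add: mult.left_commute)
      moreover have "\<forall>k \<ge> d. vcoeff u k (bs ! i * g) \<in> rid.span F"
      proof (intro allI impI)
        fix k assume "d \<le> k"
        then show "vcoeff u k (bs ! i * g) \<in> rid.span F"
          using top Suc.prems(2) by (cases "k = d") (auto simp: vcoeff_mult[OF bi] intro!: span_mult_left)
      qed
      ultimately show ?case by (rule Suc.IH)
    qed
    then show ?case using faithful_modD[OF faithful, of g] by (auto simp: in_set_conv_nth)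
  qed
  show ?thesis unfolding nzd_mod_def
  proof (intro allI impI)
    fix g assume *: "?a * g \<in> rid.span F"
    obtain N where "\<And>i. i \<ge> N \<Longrightarrow> vcoeff u i g = 0" using vcoeff_bounded[of u g] by blast
    then show "g \<in> rid.span F" using main[OF *, of N] by (simp add: rid.span_zero)
  qed
qed

lemma faithful_mod_unit: "c * d = 1 \<Longrightarrow> c \<in> B \<Longrightarrow> faithful_mod B F"
  unfolding faithful_mod_def
  by (metis mult.assoc mult.commute mult_1 span_mult_left)

text \<open>\<open>pvar u + s\<close> is the generic element with coefficients \<open>s\<close> and
  1, and a unit among the coefficients excludes a common annihilator. The same works for
  \<open>pvar t * x - 1\<close> in \<open>nzd_mod_inverse\<close>.\<close>

lemma nzd_mod_monic:
  assumes "\<And>x. x \<in> F \<Longrightarrow> u \<notin> pvars x" "u \<notin> pvars s"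
  shows "nzd_mod (pvar u + s) F"
proof -
  have "nzd_mod (generic u [s, 1]) F"
    by (rule nzd_mod_generic) (use assms in \<open>auto intro: faithful_mod_unit[of 1 1]\<close>)
  then show ?thesis by (simp add: generic_def numeral_2_eq_2 add.commute)
qed

lemma nzd_mod_inverse:
  assumes "\<And>x. x \<in> F \<Longrightarrow> t \<notin> pvars x" "t \<notin> pvars x"
  shows "nzd_mod (pvar t * x - 1) F"
proof -
  have "nzd_mod (generic t [-1, x]) F"
    by (rule nzd_mod_generic) (use assms in \<open>auto intro: faithful_mod_unit[of "-1" "-1"]\<close>)
  then show ?thesis by (simp add: generic_def numeral_2_eq_2)
qed

lemma generic_element:
  fixes B :: "'v::infinite cpoly set"
  assumes "finite X" "finite B" "finite U"
    and "\<And>F. F \<in> \<F> \<Longrightarrow> F \<subseteq> X" "\<And>F. F \<in> \<F> \<Longrightarrow> faithful_mod B F"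
  obtains a u where "a \<in> rid.span B" "\<And>F. F \<in> \<F> \<Longrightarrow> nzd_mod a F"
    "u \<notin> U" "\<And>x. x \<in> X \<Longrightarrow> u \<notin> pvars x" "pvars a \<subseteq> insert u (\<Union>b \<in> B. pvars b)"
proof -
  obtain u where u: "u \<notin> U" "\<And>f. f \<in> X \<union> B \<Longrightarrow> u \<notin> pvars f"
    using exists_fresh[of "X \<union> B" U] assms by auto
  obtain bs where bs: "set bs = B" using assms(2) finite_list by blast
  show ?thesis
  proof (rule that[of "generic u bs" u])
    show "generic u bs \<in> rid.span B" using generic_in_span[of u bs] bs by simp
    show "nzd_mod (generic u bs) F" if "F \<in> \<F>" for F
      by (rule nzd_mod_generic) (use bs u assms(4,5) that in auto)
    have *: "pvars (pvar u ^ i * b) \<subseteq> insert u (\<Union>b \<in> B. pvars b)" if "b \<in> B" for i b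
      using pvars_mult[of "pvar u ^ i" b] pvars_power[of "pvar u" i] that by auto
    show "pvars (generic u bs) \<subseteq> insert u (\<Union>b \<in> B. pvars b)"
      unfolding generic_def
      by (rule subset_trans[OF pvars_sum], rule UN_least, rule *) (use bs in auto)
  qed (use u in auto)
qed

text \<open>Elementary form of Hom(R/I, M/aM) = Ext(R/I, M) = Hom(R/I, M/bM), with the first Ext,
  where I is generated by \<open>B\<close> and M is the quotient by \<open>F\<close>. The
  correspondence sends \<open>r\<close> to the \<open>d\<close> with \<open>a * r = d * b\<close>
  modulo \<open>F\<close>.\<close>

lemma faithful_exchange:
  assumes a: "a \<in> rid.span (F \<union> B)" "nzd_mod a F" "faithful_mod B (insert a F)"
    and b: "b \<in> rid.span (F \<union> B)" "nzd_mod b F"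
  shows "faithful_mod B (insert b F)"
  unfolding faithful_mod_def
proof (intro allI impI)
  fix r assume r: "\<forall>c \<in> B. c * r \<in> rid.span (insert b F)"
  have "a * r \<in> rid.span (insert b F)"
    using a(1)
  proof (induction rule: rid.span_induct_alt)
    case (step c x y)
    have "x * r \<in> rid.span (insert b F)"
    proof (cases "x \<in> B")
      case False
      then have "x \<in> rid.span (insert b F)" using step(1) by (auto intro: rid.span_base)
      then show ?thesis by (rule span_mult_right)
    qed (use r in auto)
    then have "c * (x * r) + y * r \<in> rid.span (insert b F)"
      using step(2) by (intro rid.span_add span_mult_left[of "x * r"])
    then show ?case by (simp add: algebra_simps)
  qed (simp add: rid.span_zero)
  then obtain d f where f: "f \<in> rid.span F" "a * r = d * b + f" by (rule span_insertE)
  have "c * d \<in> rid.span (insert a F)" if "c \<in> B" for c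
  proof -
    obtain e f' where f': "f' \<in> rid.span F" "c * r = e * b + f'"
      using r \<open>c \<in> B\<close> span_insertE by blast
    have "b * (c * d - a * e) = a * f' - c * f"
    proof -
      have "a * (c * r) = c * (a * r)" by (simp add: mult.left_commute)
      then show ?thesis unfolding f(2) f'(2) by (simp add: algebra_simps)
    qed
    moreover have "a * f' - c * f \<in> rid.span F"
      using f(1) f'(1) by (intro rid.span_diff span_mult_left)
    ultimately have "c * d - a * e \<in> rid.span F" using nzd_modD[OF b(2)] by metis
    then show ?thesis using span_insertI[of "c * d - a * e" F e a] by (simp add: mult.commute)
  qed
  then have "d \<in> rid.span (insert a F)" using faithful_modD[OF a(3)] by blast
  then obtain g f'' where f'': "f'' \<in> rid.span F" "d = g * a + f''" by (rule span_insertE)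
  have "a * (r - g * b) = b * f'' + f"
    using f(2) unfolding f''(2) by (simp add: algebra_simps)
  moreover have "b * f'' + f \<in> rid.span F"
    using f(1) f''(1) by (intro rid.span_add span_mult_left)
  ultimately have "r - g * b \<in> rid.span F" using nzd_modD[OF a(2)] by metis
  then show "r \<in> rid.span (insert b F)" using span_insertI[of "r - g * b" F g b] by simp
qed

lemma span_Un_mono: "a \<in> rid.span B \<Longrightarrow> a \<in> rid.span (F \<union> B)"
  using rid.span_mono[of B "F \<union> B"] by blast

text \<open>A generic \<open>c\<close>, regular modulo \<open>F\<close> and also after adding
  \<open>a\<close> or \<open>b\<close>, mediates. The induction hypothesis makes \<open>c\<close>
  the second element after \<open>a\<close>; a swap puts \<open>c\<close> first; the induction
  hypothesis modulo \<open>c\<close> then replaces \<open>a\<close> by \<open>b\<close>.\<close>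

theorem grade_ge_exchange:
  fixes F :: "'v::infinite cpoly set"
  assumes "finite F" "finite B" "grade_ge (Suc k) F B" "b \<in> rid.span (F \<union> B)" "nzd_mod b F"
  shows "grade_ge k (insert b F) B"
  using assms
proof (induction k arbitrary: F b)
  case (Suc k)
  obtain a where a: "a \<in> rid.span (F \<union> B)" "nzd_mod a F" "grade_ge (Suc k) (insert a F) B"
    using Suc.prems(3) by (auto simp del: grade_ge.simps(2) simp add: grade_ge.simps(2)[of "Suc k"])
  have faithful: "faithful_mod B F" "faithful_mod B (insert a F)" "faithful_mod B (insert b F)"
    using grade_ge_faithful[OF Suc.prems(3)] grade_ge_faithful[OF a(3)] faithful_exchange a(1,2) Suc.prems(4,5)
    by blast+
  obtain c where c: "c \<in> rid.span B" "nzd_mod c F" "nzd_mod c (insert a F)" "nzd_mod c (insert b F)"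
    by (rule generic_element[of "insert a (insert b F)" B "{}" "{F, insert a F, insert b F}"])
      (use faithful Suc.prems(1,2) in auto)
  have cF: "c \<in> rid.span (insert x F \<union> B)" for x using c(1) by (rule span_Un_mono)
  have "grade_ge k (insert c (insert a F)) B"
    using Suc.IH[of "insert a F" c] a(3) Suc.prems(1,2) cF c(3) by auto
  then have "grade_ge k (insert a (insert c F)) B" by (simp add: insert_commute)
  moreover have "nzd_mod a (insert c F)" using a(2) c(2,3) by (rule nzd_mod_swap)
  moreover have in_c: "x \<in> rid.span (insert c F \<union> B)" if "x \<in> rid.span (F \<union> B)" for x
    using that rid.span_mono[of "F \<union> B" "insert c F \<union> B"] by blast
  ultimately have "grade_ge (Suc k) (insert c F) B" using a(1) by auto
  moreover have "nzd_mod b (insert c F)" using Suc.prems(5) c(2,4) by (rule nzd_mod_swap)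
  ultimately have "grade_ge k (insert b (insert c F)) B"
    using Suc.IH[of "insert c F" b] Suc.prems(1,2,4) in_c by auto
  then have "grade_ge k (insert c (insert b F)) B" by (simp add: insert_commute)
  then show ?case using c(4) cF by auto
qed simp

lemma grade_ge_generic:
  fixes F :: "'v::infinite cpoly set"
  assumes "finite F" "finite B" "grade_ge (Suc k) F B" "a \<in> rid.span B" "nzd_mod a F"
  shows "grade_ge k (insert a F) B"
  using grade_ge_exchange[OF assms(1-3)] assms(4,5) span_Un_mono by blast

subsection \<open>Inverting and killing an element\<close>

text \<open>Comparing coefficients of \<open>t\<close> in \<open>r = c * (pvar t * x - 1)\<close>
  modulo \<open>F\<close> gives c_0 = -r and c_i = x c_(i-1), hence c_i = - x^i r. As
  \<open>c\<close> has finite degree in \<open>t\<close>, some power of \<open>x\<close> kills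
  \<open>r\<close>.\<close>

lemma span_inverse:
  assumes F: "\<And>y. y \<in> F \<Longrightarrow> t \<notin> pvars y" and x: "t \<notin> pvars x" and r: "t \<notin> pvars r"
    and mem: "r \<in> rid.span (insert (pvar t * x - 1) F)"
  obtains e where "x ^ e * r \<in> rid.span F"
proof -
  obtain c y where y: "y \<in> rid.span F" "r = c * (pvar t * x - 1) + y"
    using mem by (rule span_insertE)
  have co: "vcoeff t i r - (vcoeff t i (pvar t * (x * c)) - vcoeff t i c) \<in> rid.span F" for i
  proof -
    have "y = r - (pvar t * (x * c) - c)" using y(2) by (simp add: algebra_simps)
    then show ?thesis using vcoeff_span[OF y(1) F, of i] by (simp add: vcoeff_diff)
  qed
  have tx: "vcoeff t i (pvar t * (x * c)) = (if i = 0 then 0 else x * vcoeff t (i - 1) c)" for i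
    using vcoeff_pvar_power_mult[of t i 1 "x * c"] x by (auto simp: vcoeff_mult)
  have pow: "x ^ i * r + vcoeff t i c \<in> rid.span F" for i
  proof (induction i)
    case 0
    then show ?case using co[of 0] tx[of 0] r by (simp add: vcoeff_free)
  next
    case (Suc i)
    have "- (x * vcoeff t i c - vcoeff t (Suc i) c) \<in> rid.span F"
      using co[of "Suc i"] tx[of "Suc i"] r by (simp add: vcoeff_free)
    then have "- (x * vcoeff t i c - vcoeff t (Suc i) c) + x * (x ^ i * r + vcoeff t i c) \<in> rid.span F"
      using span_mult_left[OF Suc] by (intro rid.span_add)
    then show ?case by (simp add: algebra_simps)
  qed
  obtain N where "\<And>i. i \<ge> N \<Longrightarrow> vcoeff t i c = 0" using vcoeff_bounded[of t c] by blast
  then show ?thesis using pow[of N] that by force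
qed

text \<open>\<open>V(B)\<close> is the union of its intersection with \<open>x = 0\<close> and of its part where \<open>x\<close> is invertible.\<close>

theorem grade_ge_split:
  fixes F :: "'v::infinite cpoly set"
  assumes "finite F" "finite B" "grade_ge k F (insert x B)" "grade_ge k (insert (pvar t * x - 1) F) B"
    and "\<And>y. y \<in> insert x (F \<union> B) \<Longrightarrow> t \<notin> pvars y"
  shows "grade_ge k F B"
  using assms
proof (induction k arbitrary: F)
  case (Suc k)
  let ?G = "insert (pvar t * x - 1) F"
  have t: "t \<notin> pvars x" "\<And>y. y \<in> F \<Longrightarrow> t \<notin> pvars y" "\<And>y. y \<in> B \<Longrightarrow> t \<notin> pvars y"
    using Suc.prems(5) by auto
  have fx: "faithful_mod (insert x B) F" and fG: "faithful_mod B ?G"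
    using grade_ge_faithful Suc.prems(3,4) by blast+
  \<comment> \<open>An element killed by \<open>B\<close> vanishes where \<open>x\<close> is
    invertible, so a power of \<open>x\<close> kills it. The factors \<open>x\<close> are then
    removed one at a time, because \<open>x\<close> and \<open>B\<close> together are
    faithful.\<close>
  have free: "r \<in> rid.span F" if rB: "\<forall>b \<in> B. b * r \<in> rid.span F" and r: "t \<notin> pvars r" for r
  proof -
    have "\<forall>b \<in> B. b * r \<in> rid.span ?G" using rB rid.span_mono[of F ?G] by blast
    then have "r \<in> rid.span ?G" using faithful_modD[OF fG] by blast
    then obtain e where "x ^ e * r \<in> rid.span F" using span_inverse[of F t x r] t r by auto
    then show ?thesis
    proof (induction e)
      case (Suc e)
      have "b * (x ^ e * r) \<in> rid.span F" if "b \<in> insert x B" for b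
      proof (cases "b = x")
        case True
        then show ?thesis using Suc.prems by (simp only: power_Suc mult.assoc)
      next
        case False
        then have "b * r \<in> rid.span F" using that rB by blast
        then have "x ^ e * (b * r) \<in> rid.span F" by (rule span_mult_left)
        then show ?thesis by (simp only: mult.left_commute)
      qed
      then have "x ^ e * r \<in> rid.span F" using faithful_modD[OF fx] by blast
      then show ?case by (rule Suc.IH)
    qed simp
  qed
  have fF: "faithful_mod B F" unfolding faithful_mod_def
  proof (intro allI impI)
    fix r assume r: "\<forall>b \<in> B. b * r \<in> rid.span F"
    show "r \<in> rid.span F"
    proof (rule span_vcoeff)
      fix i
      show "vcoeff t i r \<in> rid.span F"
      proof (rule free)
        show "\<forall>b \<in> B. b * vcoeff t i r \<in> rid.span F"
          using vcoeff_span[of _ F t i] r t by (metis vcoeff_mult)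
        show "t \<notin> pvars (vcoeff t i r)" using pvars_vcoeff by fastforce
      qed
    qed
  qed
  \<comment> \<open>One \<open>c\<close> in the ideal of \<open>B\<close> is regular for both
    hypotheses, so the grade can be lowered by one in all three places at once.\<close>
  obtain c u where c: "c \<in> rid.span B" "nzd_mod c F" "nzd_mod c ?G" "u \<noteq> t" "pvars c \<subseteq> insert u (\<Union>b \<in> B. pvars b)"
    by (rule generic_element[of ?G B "{t}" "{F, ?G}"]) (use fF fG Suc.prems(1,2) in auto)
  have tc: "t \<notin> pvars c" using c(4,5) t(3) by auto
  have "c \<in> rid.span (insert x B)" using c(1) rid.span_mono[of B "insert x B"] by blast
  then have 1: "grade_ge k (insert c F) (insert x B)"
    using grade_ge_generic[OF _ _ Suc.prems(3)] Suc.prems(1,2) c(2) by auto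
  have "grade_ge k (insert c ?G) B"
    using grade_ge_generic[OF _ _ Suc.prems(4) c(1,3)] Suc.prems(1,2) by auto
  then have 2: "grade_ge k (insert (pvar t * x - 1) (insert c F)) B" by (simp add: insert_commute)
  have "grade_ge k (insert c F) B"
    by (rule Suc.IH[OF _ _ 1 2]) (use Suc.prems(1,2) t tc in auto)
  then show ?case using c(1,2) span_Un_mono by auto
qed simp

text \<open>Localization is flat, so the grade cannot drop. In each step the generic element and the
  equation \<open>pvar t * x - 1\<close> change places; the latter is regular modulo every ideal
  whose generators do not involve \<open>t\<close>.\<close>

theorem grade_ge_localize:
  fixes F :: "'v::infinite cpoly set"
  assumes "finite F" "finite B" "grade_ge k F B"
    and "\<And>y. y \<in> insert x (F \<union> B) \<Longrightarrow> t \<notin> pvars y"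
  shows "grade_ge k (insert (pvar t * x - 1) F) B"
  using assms
proof (induction k arbitrary: F)
  case (Suc k)
  obtain c u where c: "c \<in> rid.span B" "nzd_mod c F" "u \<noteq> t" "pvars c \<subseteq> insert u (\<Union>b \<in> B. pvars b)"
    by (rule generic_element[of F B "{t}" "{F}"])
      (use grade_ge_faithful[OF Suc.prems(3)] Suc.prems(1,2) in auto)
  have tc: "t \<notin> pvars c" using c(3,4) Suc.prems(4) by auto
  have "grade_ge k (insert (pvar t * x - 1) (insert c F)) B"
    by (rule Suc.IH) (use grade_ge_generic[OF Suc.prems(1-3) c(1,2)] Suc.prems tc in auto)
  then have "grade_ge k (insert c (insert (pvar t * x - 1) F)) B" by (simp add: insert_commute)
  moreover have "nzd_mod c (insert (pvar t * x - 1) F)"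
    by (rule nzd_mod_swap[OF c(2)]) (use Suc.prems(4) tc in \<open>auto intro!: nzd_mod_inverse\<close>)
  moreover have "c \<in> rid.span (insert (pvar t * x - 1) F \<union> B)" using c(1) by (rule span_Un_mono)
  ultimately show ?case by auto
qed simp

subsection \<open>Descent along a substitution with a retraction\<close>

lemma psubst_span: "f \<in> rid.span F \<Longrightarrow> psubst g f \<in> rid.span (psubst g ` F)"
proof (induction rule: rid.span_induct_alt)
  case (step c x y)
  have "psubst g x \<in> rid.span (psubst g ` F)" using step(1) by (intro rid.span_base imageI)
  then have "psubst g c * psubst g x + psubst g y \<in> rid.span (psubst g ` F)"
    using step(2) by (intro rid.span_add span_mult_left[of "psubst g x"])
  then show ?case by (simp only: psubst_add psubst_mult)
qed (simp add: rid.span_zero)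

theorem grade_ge_descent:
  fixes F :: "'v::infinite cpoly set" and G :: "'w::infinite cpoly set"
  assumes "finite F" "finite B" "finite G"
    and "grade_ge k G (psubst \<sigma> ` B)"
    and "\<And>f. f \<in> F \<Longrightarrow> psubst \<sigma> f \<in> rid.span G" "\<And>g. g \<in> G \<Longrightarrow> psubst \<tau> g \<in> rid.span F"
    and retract: "\<And>v. psubst \<tau> (\<sigma> v) = pvar v"
    and fresh: "\<And>U U'. finite U \<Longrightarrow> finite U' \<Longrightarrow> \<exists>u u'. \<sigma> u = pvar u' \<and> u \<notin> U \<and> u' \<notin> U'"
  shows "grade_ge k F B"
  using assms(1-6)
proof (induction k arbitrary: F G)
  case (Suc k)
  let ?s = "psubst \<sigma>"
  have ts: "psubst \<tau> (?s f) = f" for f by (simp add: psubst_psubst retract)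
  have sF: "?s f \<in> rid.span G" if "f \<in> rid.span F" for f
    using psubst_span[OF that, of \<sigma>] span_subset_span[of "?s ` F" G] Suc.prems(5) by auto
  have tG: "psubst \<tau> g \<in> rid.span F" if "g \<in> rid.span G" for g
    using psubst_span[OF that, of \<tau>] span_subset_span[of "psubst \<tau> ` G" F] Suc.prems(6) by auto
  have fG: "faithful_mod (?s ` B) G" using grade_ge_faithful Suc.prems(4) by blast
  have fF: "faithful_mod B F" unfolding faithful_mod_def
  proof (intro allI impI)
    fix r assume "\<forall>b \<in> B. b * r \<in> rid.span F"
    then have "\<forall>b \<in> ?s ` B. b * ?s r \<in> rid.span G" using sF by (auto simp flip: psubst_mult)
    then have "?s r \<in> rid.span G" using faithful_modD[OF fG] by blast
    then show "r \<in> rid.span F" using tG ts by metis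
  qed
  obtain bs where bs: "set bs = B" using Suc.prems(2) finite_list by blast
  let ?U = "\<Union>f \<in> F \<union> B. pvars f" and ?U' = "\<Union>f \<in> G \<union> ?s ` B. pvars f"
  have "finite ?U" "finite ?U'" using Suc.prems by auto
  then obtain u u' where u: "\<sigma> u = pvar u'" "u \<notin> ?U" "u' \<notin> ?U'" using fresh by meson
  let ?c = "generic u bs"
  have sc: "?s ?c = generic u' (map ?s bs)"
    by (simp add: generic_def psubst_sum psubst_mult psubst_power u(1))
  have c: "nzd_mod ?c F" by (rule nzd_mod_generic) (use bs fF u in auto)
  have c': "nzd_mod (?s ?c) G" unfolding sc by (rule nzd_mod_generic) (use bs fG u in auto)
  have cB: "?c \<in> rid.span B" using generic_in_span[of u bs] bs by simp
  have "?s ?c \<in> rid.span (?s ` B)" using psubst_span[OF cB] .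
  then have "grade_ge k (insert (?s ?c) G) (?s ` B)"
    using grade_ge_generic[OF _ _ Suc.prems(4)] Suc.prems(2,3) c' by auto
  moreover have "psubst \<tau> (?s ?c) \<in> rid.span (insert ?c F)" "?s ?c \<in> rid.span (insert (?s ?c) G)"
    by (auto simp: ts intro: rid.span_base)
  ultimately have "grade_ge k (insert ?c F) B"
    using Suc.prems rid.span_mono[of F "insert ?c F"] rid.span_mono[of G "insert (?s ?c) G"]
    by (intro Suc.IH[of _ "insert (?s ?c) G"]) auto
  then show ?case using c cB span_Un_mono by auto
qed simp

subsection \<open>Regular sequences\<close>

fun reg_seq_mod :: "'a::comm_ring_1 list \<Rightarrow> 'a set \<Rightarrow> bool" where
  "reg_seq_mod [] F = True"
| "reg_seq_mod (a # xs) F = (nzd_mod a F \<and> reg_seq_mod xs (insert a F))"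

lemma grade_ge_reg_seq:
  assumes "reg_seq_mod xs F" "set xs \<subseteq> rid.span (F \<union> B)" "grade_ge k (F \<union> set xs) B"
  shows "grade_ge (length xs + k) F B"
  using assms
proof (induction xs arbitrary: F)
  case (Cons a xs)
  have "rid.span (F \<union> B) \<subseteq> rid.span (insert a F \<union> B)" by (rule rid.span_mono) auto
  then have "grade_ge (length xs + k) (insert a F) B"
    using Cons.prems by (intro Cons.IH) auto
  then show ?case using Cons.prems by auto
qed simp

text \<open>An ideal that is generated by as many elements as its grade is generated by a regular sequence,
  obtained from the given generators by adding generic combinations of the later ones.\<close>

theorem grade_ge_imp_reg_seq:
  fixes F :: "'v::infinite cpoly set"
  assumes "finite F" "grade_ge (length bs) F (set bs)"
  obtains ys where "length ys = length bs" "reg_seq_mod ys F" "rid.span (F \<union> set ys) = rid.span (F \<union> set bs)"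
  using assms
proof (induction bs arbitrary: F thesis)
  case (Cons b bs)
  obtain u where u: "\<And>f. f \<in> F \<union> set (b # bs) \<Longrightarrow> u \<notin> pvars f"
    using exists_fresh[of "F \<union> set (b # bs)" "{}"] Cons.prems(2) by auto
  let ?y = "generic u (b # bs)"
  have y: "nzd_mod ?y F"
    by (rule nzd_mod_generic) (use u grade_ge_faithful[of "length bs" F "set (b # bs)"] Cons.prems(3) in auto)
  \<comment> \<open>\<open>b\<close> enters the generic element with coefficient 1, so it can be
    traded for that element without changing the ideal.\<close>
  have y_eq: "?y = b + pvar u * generic u bs"
    by (simp add: generic_def sum.lessThan_Suc_shift sum_distrib_left mult.assoc del: sum.lessThan_Suc)
  have gen: "generic u bs \<in> rid.span (set bs)" by (rule generic_in_span)
  have span_eq: "rid.span (insert ?y F \<union> set bs) = rid.span (F \<union> set (b # bs))"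
  proof (intro antisym span_subset_span subsetI)
    fix x assume "x \<in> insert ?y F \<union> set bs"
    then show "x \<in> rid.span (F \<union> set (b # bs))"
      using span_Un_mono[OF generic_in_span[of u "b # bs"], of F] by (auto intro: rid.span_base)
  next
    fix x assume x: "x \<in> F \<union> set (b # bs)"
    show "x \<in> rid.span (insert ?y F \<union> set bs)"
    proof (cases "x = b")
      case True
      have "?y \<in> rid.span (insert ?y F \<union> set bs)" by (simp add: rid.span_base)
      then have "?y - pvar u * generic u bs \<in> rid.span (insert ?y F \<union> set bs)"
        using span_mult_left[OF span_Un_mono[OF gen]] by (rule rid.span_diff)
      then show ?thesis using True y_eq by simp
    qed (use x in \<open>auto intro: rid.span_base\<close>)
  qed
  have "grade_ge (length bs) (insert ?y F) (set (b # bs))"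
    by (rule grade_ge_generic[OF Cons.prems(2) finite_set _ generic_in_span y])
      (use Cons.prems(3) in simp)
  then have "grade_ge (length bs) (insert ?y F) (set bs)"
  proof (rule grade_ge_mono)
    show "set (b # bs) \<subseteq> rid.span (insert ?y F \<union> set bs)"
      unfolding span_eq by (auto intro: rid.span_base)
  qed
  then obtain ys where "length ys = length bs" "reg_seq_mod ys (insert ?y F)"
    "rid.span (insert ?y F \<union> set ys) = rid.span (insert ?y F \<union> set bs)"
    using Cons.IH[of "insert ?y F"] Cons.prems(2) by auto
  then show ?case using y span_eq by (intro Cons.prems(1)[of "?y # ys"]) auto
qed auto

section \<open>Lower bound for the grade of the rank conditions: stratification, Bruhat order, LU
  decomposition\<close>

section \<open>Minors modulo an ideal\<close>

definition cong_mod :: "'a::comm_ring_1 \<Rightarrow> 'a \<Rightarrow> 'a set \<Rightarrow> bool" where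
  "cong_mod x y F \<longleftrightarrow> x - y \<in> rid.span F"

lemma cong_mod_refl [simp]: "cong_mod x x F"
  by (simp add: cong_mod_def rid.span_zero)

lemma cong_mod_add: "cong_mod a b F \<Longrightarrow> cong_mod c d F \<Longrightarrow> cong_mod (a + c) (b + d) F"
  unfolding cong_mod_def using rid.span_add[of "a - b" F "c - d"] by (simp add: algebra_simps)

lemma cong_mod_mult:
  assumes "cong_mod a b F" "cong_mod c d F" shows "cong_mod (a * c) (b * d) F"
proof -
  have "(a - b) * c + b * (c - d) \<in> rid.span F"
    using assms by (intro rid.span_add span_mult_right[of "a - b"] span_mult_left[of "c - d"])
      (auto simp: cong_mod_def)
  moreover have "a * c - b * d = (a - b) * c + b * (c - d)" by (simp add: algebra_simps)
  ultimately show ?thesis by (simp only: cong_mod_def)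
qed

lemma cong_mod_sum: "(\<And>i. i \<in> I \<Longrightarrow> cong_mod (f i) (g i) F) \<Longrightarrow> cong_mod (sum f I) (sum g I) F"
  by (induction I rule: infinite_finite_induct) (auto intro: cong_mod_add)

lemma cong_mod_prod: "(\<And>i. i \<in> I \<Longrightarrow> cong_mod (f i) (g i) F) \<Longrightarrow> cong_mod (prod f I) (prod g I) F"
  by (induction I rule: infinite_finite_induct) (auto intro: cong_mod_mult)

lemma cong_mod_mem: "cong_mod x y F \<Longrightarrow> x \<in> rid.span F \<longleftrightarrow> y \<in> rid.span F"
  unfolding cong_mod_def using span_add_cancel_left rid.span_add
  by (metis diff_add_cancel)

lemma cong_mod_mono: "cong_mod x y F \<Longrightarrow> rid.span F \<subseteq> rid.span G \<Longrightarrow> cong_mod x y G"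
  by (auto simp: cong_mod_def)

lemma det_cong_mod:
  assumes "A \<in> carrier_mat n n" "B \<in> carrier_mat n n"
    and "\<And>i j. i < n \<Longrightarrow> j < n \<Longrightarrow> cong_mod (A $$ (i, j)) (B $$ (i, j)) F"
  shows "cong_mod (det A) (det B) F"
  unfolding det_def'[OF assms(1)] det_def'[OF assms(2)]
proof (intro cong_mod_sum cong_mod_mult cong_mod_prod cong_mod_refl)
  fix p i assume "p \<in> {p. p permutes {0..<n}}" "i \<in> {0..<n}"
  then show "cong_mod (A $$ (i, p i)) (B $$ (i, p i)) F"
    using permutes_in_image[of p "{0..<n}" i] by (intro assms(3)) auto
qed

text \<open>Lists instead of sets of indices: rows and columns may be put in front, reordered or
  repeated, as needed for pivoting and for expanding products.\<close>

definition lminor :: "('i \<Rightarrow> 'j \<Rightarrow> 'a::comm_ring_1) \<Rightarrow> 'i list \<Rightarrow> 'j list \<Rightarrow> 'a" where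
  "lminor Y rs cs = det (mat (length rs) (length cs) (\<lambda>(i, j). Y (rs ! i) (cs ! j)))"

lemma lminor_cong_mod:
  assumes "length rs = length cs"
    and "\<And>r c. r \<in> set rs \<Longrightarrow> c \<in> set cs \<Longrightarrow> cong_mod (Y r c) (Z r c) F"
  shows "cong_mod (lminor Y rs cs) (lminor Z rs cs) F"
  unfolding lminor_def
  by (rule det_cong_mod[where n = "length cs"]) (use assms in auto)

lemma lminor_single: "lminor Y [r] [c] = Y r c"
  by (simp add: lminor_def det_single)

lemma det_first_column:
  fixes A :: "'a::comm_ring_1 mat"
  assumes A: "A \<in> carrier_mat (Suc n) (Suc n)" and "\<And>i. 0 < i \<Longrightarrow> i < Suc n \<Longrightarrow> A $$ (i, 0) = 0"
  shows "det A = A $$ (0, 0) * det (mat n n (\<lambda>(i, j). A $$ (Suc i, Suc j)))"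
proof -
  have "det A = (\<Sum>i<Suc n. A $$ (i, 0) * cofactor A i 0)"
    by (rule laplace_expansion_column[OF A]) simp
  also have "\<dots> = A $$ (0, 0) * cofactor A 0 0"
    using assms(2) by (simp add: sum.lessThan_Suc_shift del: sum.lessThan_Suc)
  also have "mat_delete A 0 0 = mat n n (\<lambda>(i, j). A $$ (Suc i, Suc j))"
    using A by (intro eq_matI) (auto simp: mat_delete_def)
  ultimately show ?thesis by (simp add: cofactor_def)
qed

text \<open>Schur complement of the pivot \<open>Y p c\<close>. The row operations have determinant
  1, but \<open>t\<close> inverts the pivot only modulo \<open>F\<close>, so they clear the first
  column only modulo \<open>F\<close>.\<close>

lemma lminor_pivot:
  assumes t: "cong_mod (t * Y p c) 1 F" and len: "length rs = length cs"
  shows "cong_mod (lminor Y (p # rs) (c # cs))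
    (Y p c * lminor (\<lambda>a b. Y a b - t * Y a c * Y p b) rs cs) F"
proof -
  let ?k = "length cs"
  let ?A = "mat (Suc ?k) (Suc ?k) (\<lambda>(i, j). Y ((p # rs) ! i) ((c # cs) ! j))"
  let ?L = "mat (Suc ?k) (Suc ?k) (\<lambda>(i, j). if i = j then 1 else if j = 0 then - (t * Y (rs ! (i - 1)) c) else 0)"
  let ?C = "mat (Suc ?k) (Suc ?k) (\<lambda>(i, j). if i = 0 then Y p ((c # cs) ! j) else if j = 0 then 0
     else Y (rs ! (i - 1)) (cs ! (j - 1)) - t * Y (rs ! (i - 1)) c * Y p (cs ! (j - 1)))"
  have L1: "det ?L = 1"
  proof -
    have "det ?L = prod_list (diag_mat ?L)"
      by (rule det_lower_triangular[where n = "Suc ?k"]) auto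
    also have "diag_mat ?L = replicate (Suc ?k) 1"
      by (rule nth_equalityI) (auto simp: diag_mat_def nth_append simp del: replicate_Suc upt_Suc)
    finally show ?thesis by simp
  qed
  have LA: "(?L * ?A) $$ (i, j) = (if i = 0 then ?A $$ (0, j) else ?A $$ (i, j) - t * Y (rs ! (i - 1)) c * ?A $$ (0, j))"
    if ij: "i < Suc ?k" "j < Suc ?k" for i j
  proof -
    have "(?L * ?A) $$ (i, j) = (\<Sum>l<Suc ?k. ?L $$ (i, l) * ?A $$ (l, j))"
      using ij by (simp add: scalar_prod_def lessThan_atLeast0 del: sum.lessThan_Suc sum.op_ivl_Suc)
    also have "\<dots> = (\<Sum>l \<in> {0, i}. ?L $$ (i, l) * ?A $$ (l, j))"
      using ij by (intro sum.mono_neutral_right) auto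
    finally show ?thesis using ij by auto
  qed
  have "det ?A = det (?L * ?A)" using L1 by (subst det_mult[where n = "Suc ?k"]) auto
  moreover have "cong_mod (det (?L * ?A)) (det ?C) F"
  proof (rule det_cong_mod[where n = "Suc ?k"])
    fix i j assume ij: "i < Suc ?k" "j < Suc ?k"
    have "cong_mod (Y (rs ! (i - 1)) c - t * Y (rs ! (i - 1)) c * Y p c) 0 F"
    proof -
      have "(- Y (rs ! (i - 1)) c) * (t * Y p c - 1) \<in> rid.span F"
        by (rule span_mult_left) (use t in \<open>simp add: cong_mod_def\<close>)
      then show ?thesis by (simp add: cong_mod_def algebra_simps)
    qed
    then show "cong_mod ((?L * ?A) $$ (i, j)) (?C $$ (i, j)) F"
      unfolding LA[OF ij] using ij by (cases i; cases j) auto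
  qed auto
  moreover have "det ?C = Y p c * lminor (\<lambda>a b. Y a b - t * Y a c * Y p b) rs cs"
  proof -
    have "det ?C = ?C $$ (0, 0) * det (mat ?k ?k (\<lambda>(i, j). ?C $$ (Suc i, Suc j)))"
      by (rule det_first_column) auto
    also have "mat ?k ?k (\<lambda>(i, j). ?C $$ (Suc i, Suc j)) =
        mat (length rs) (length cs) (\<lambda>(i, j). Y (rs ! i) (cs ! j) - t * Y (rs ! i) c * Y p (cs ! j))"
      using len by (intro eq_matI) auto
    finally show ?thesis by (simp add: lminor_def)
  qed
  moreover have "lminor Y (p # rs) (c # cs) = det ?A" by (simp add: lminor_def len)
  ultimately show ?thesis by simp
qed

section \<open>Rank conditions on a generic matrix\<close>

text \<open>The codimension of a stratum: each column contributes the rows below its pivot that are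
  not rows of earlier pivots. Without a pivot, \<open>v c = 0\<close> makes it contribute all rows
  still free. For a permutation this is the size of the diagram, see
  \<open>card_diagram\<close>.\<close>

definition unhit :: "nat set \<Rightarrow> nat \<Rightarrow> nat \<Rightarrow> (nat \<Rightarrow> nat) \<Rightarrow> nat" where
  "unhit A j n v = (\<Sum>c \<in> {j<..n}. card {a \<in> A. v c < a \<and> a \<notin> v ` {j<..<c}})"

text \<open>\<open>v c\<close> is the row of the pivot in column \<open>c\<close>, or 0 if there is none.\<close>

definition pivoting :: "nat set \<Rightarrow> nat \<Rightarrow> nat \<Rightarrow> (nat \<times> nat) set \<Rightarrow> (nat \<Rightarrow> nat \<Rightarrow> nat) \<Rightarrow> (nat \<Rightarrow> nat) \<Rightarrow> bool" where
  "pivoting A j n P \<rho> v \<longleftrightarrow> v ` {j<..n} \<subseteq> insert 0 A \<and> inj_on v {c \<in> {j<..n}. v c \<noteq> 0} \<and>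
     (\<forall>(a, b) \<in> P. card {c \<in> {j<..b}. a \<le> v c} \<le> \<rho> a b)"

lemma pivotingI:
  assumes "v ` {j<..n} \<subseteq> insert 0 A" "inj_on v {c \<in> {j<..n}. v c \<noteq> 0}"
    and "\<And>a b. (a, b) \<in> P \<Longrightarrow> card {c \<in> {j<..b}. a \<le> v c} \<le> \<rho> a b"
  shows "pivoting A j n P \<rho> v"
  using assms unfolding pivoting_def by blast

lemma pivotingD:
  "pivoting A j n P \<rho> v \<Longrightarrow> (a, b) \<in> P \<Longrightarrow> card {c \<in> {j<..b}. a \<le> v c} \<le> \<rho> a b"
  unfolding pivoting_def by blast

lemma unhit_step:
  assumes "j < n"
  shows "unhit A j n v = card {a \<in> A. v (Suc j) < a} + unhit (A - {v (Suc j)}) (Suc j) n v"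
proof -
  have cols: "{j<..n} = insert (Suc j) {Suc j<..n}" using assms by auto
  have "card {a \<in> A. v c < a \<and> a \<notin> v ` {j<..<c}}
      = card {a \<in> A - {v (Suc j)}. v c < a \<and> a \<notin> v ` {Suc j<..<c}}" if "c \<in> {Suc j<..n}" for c
  proof -
    have "{j<..<c} = insert (Suc j) {Suc j<..<c}" using that by auto
    then show ?thesis by (intro arg_cong[of _ _ card]) auto
  qed
  then have "(\<Sum>c \<in> {Suc j<..n}. card {a \<in> A. v c < a \<and> a \<notin> v ` {j<..<c}})
      = unhit (A - {v (Suc j)}) (Suc j) n v"
    unfolding unhit_def by (rule sum.cong[OF refl])
  moreover have "{j<..<Suc j} = {}" by auto
  ultimately show ?thesis unfolding unhit_def cols by simp
qed

lemma unhit_cong: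
  assumes "\<And>c. c \<in> {j<..n} \<Longrightarrow> v c = v' c"
  shows "unhit A j n v = unhit A j n v'"
proof -
  have "v ` {j<..<c} = v' ` {j<..<c}" if "c \<in> {j<..n}" for c
    using assms that by (intro image_cong) auto
  then show ?thesis unfolding unhit_def using assms by (intro sum.cong) auto
qed

text \<open>Each element is monic of degree one in a variable of its own, which occurs neither in
  \<open>F\<close> nor in the other elements.\<close>

lemma reg_seq_fresh_variables:
  assumes "distinct xs" "inj_on \<phi> (set xs)"
    and "\<And>f a. f \<in> F \<Longrightarrow> a \<in> set xs \<Longrightarrow> \<phi> a \<notin> pvars f"
    and "\<And>a a'. a \<in> set xs \<Longrightarrow> a' \<in> set xs \<Longrightarrow> \<phi> a \<notin> pvars (s a')"
  shows "reg_seq_mod (map (\<lambda>a. pvar (\<phi> a) + s a) xs) F"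
  using assms
proof (induction xs arbitrary: F)
  case (Cons x xs)
  have "\<phi> a \<notin> pvars (pvar (\<phi> x) + s x)" if "a \<in> set xs" for a
    using Cons.prems that pvars_add[of "pvar (\<phi> x)" "s x"] by (auto simp: inj_on_def)
  then have "reg_seq_mod (map (\<lambda>a. pvar (\<phi> a) + s a) xs) (insert (pvar (\<phi> x) + s x) F)"
    using Cons.prems by (intro Cons.IH) (auto simp: inj_on_def)
  moreover have "nzd_mod (pvar (\<phi> x) + s x) F"
    using Cons.prems by (intro nzd_mod_monic) auto
  ultimately show ?case by simp
qed simp

text \<open>The space of matrices is stratified by the positions of the pivots in column echelon form. On the
  stratum of \<open>v\<close>, the entries below the pivots, outside of the rows of earlier pivots, form a regular
  sequence of length \<open>unhit v\<close>.\<close>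

theorem grade_ge_rank_conditions:
  fixes F B :: "'v::infinite cpoly set" and \<phi> :: "nat \<Rightarrow> nat \<Rightarrow> 'v"
  assumes "finite F" "finite B" "finite A" "0 \<notin> A"
    and "inj_on (case_prod \<phi>) (A \<times> {j<..n})"
    and "\<And>f a b. f \<in> F \<Longrightarrow> a \<in> A \<Longrightarrow> b \<in> {j<..n} \<Longrightarrow> \<phi> a b \<notin> pvars f"
    and "\<And>a b a' b'. \<lbrakk>a \<in> A; b \<in> {j<..n}; a' \<in> A; b' \<in> {j<..n}\<rbrakk> \<Longrightarrow> \<phi> a b \<notin> pvars (s a' b')"
    and "\<And>a b. (a, b) \<in> P \<Longrightarrow> 1 \<le> a \<and> b \<le> n"
    and "\<And>a b rs cs. \<lbrakk>(a, b) \<in> P; set rs \<subseteq> {x \<in> A. a \<le> x}; set cs \<subseteq> {j<..b};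
      length rs = \<rho> a b + 1; length cs = \<rho> a b + 1\<rbrakk>
      \<Longrightarrow> lminor (\<lambda>a b. pvar (\<phi> a b) + s a b) rs cs \<in> rid.span (F \<union> B)"
    and "\<And>v. pivoting A j n P \<rho> v \<Longrightarrow> K \<le> unhit A j n v"
  shows "grade_ge K F B"
  using assms
proof (induction "n - j" arbitrary: j A F s \<rho> K)
  case 0
  have "card {c \<in> {j<..b}. a \<le> (0::nat)} \<le> \<rho> a b" if "(a, b) \<in> P" for a b
  proof -
    have "{j<..b} = {}" using that 0(1) 0(9)[of a b] by auto
    then have "{c \<in> {j<..b}. a \<le> (0::nat)} = {}" by blast
    then show ?thesis by (simp only: card.empty)
  qed
  then have "pivoting A j n P \<rho> (\<lambda>_. 0)" using 0(1) by (auto simp: pivoting_def)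
  then have "K \<le> unhit A j n (\<lambda>_. 0)" by (rule 0(11))
  then show ?case using 0(1) by (simp add: unhit_def)
next
  case (Suc l)
  note finF = Suc.prems(1) and finB = Suc.prems(2) and finA = Suc.prems(3) and A0 = Suc.prems(4)
    and inj = Suc.prems(5) and freshF = Suc.prems(6) and freshs = Suc.prems(7) and P = Suc.prems(8)
    and minors = Suc.prems(9) and K = Suc.prems(10)
  note IH = Suc.hyps(1) and l = Suc.hyps(2)
  \<comment> \<open>The current entries: a private variable plus a correction \<open>s\<close> that
    avoids all remaining variables. Elimination preserves this shape, since it adds a product of
    \<open>t\<close>, an entry of the finished column and one of the pivot row.\<close>
  define Y where "Y a b = pvar (\<phi> a b) + s a b" for a b
  let ?c = "Suc j"
  have jn: "j < n" using Suc.hyps(2) by simp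
  have inj': "\<phi> a b = \<phi> a' b' \<longleftrightarrow> a = a' \<and> b = b'"
    if "a \<in> A" "a' \<in> A" "b \<in> {j<..n}" "b' \<in> {j<..n}" for a b a' b'
    using inj that by (auto simp: inj_on_def)
  have freshY: "\<phi> a b \<notin> pvars (Y a' b')"
    if "a \<in> A" "a' \<in> A" "b \<in> {j<..n}" "b' \<in> {j<..n}" "(a, b) \<noteq> (a', b')" for a b a' b'
  proof -
    have "\<phi> a b \<noteq> \<phi> a' b'" using inj'[OF that(1-4)] that(5) by simp
    moreover have "\<phi> a b \<notin> pvars (s a' b')" using freshs[OF that(1,3,2,4)] .
    ultimately show ?thesis using pvars_add[of "pvar (\<phi> a' b')" "s a' b'"] by (auto simp: Y_def)
  qed
  \<comment> \<open>Requiring the entries in rows \<open>T\<close> of the column to vanish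
    contributes \<open>card T\<close> to the grade, since they form a regular sequence modulo
    \<open>G\<close>.\<close>
  have take: "grade_ge K G (B \<union> (\<lambda>a. Y a ?c) ` T)"
    if "T \<subseteq> A" "finite G" and Gfresh: "\<And>f a. f \<in> G \<Longrightarrow> a \<in> T \<Longrightarrow> \<phi> a ?c \<notin> pvars f"
      and rest: "grade_ge (K - card T) (G \<union> (\<lambda>a. Y a ?c) ` T) B" for G T
  proof -
    obtain xs where xs: "set xs = T" "distinct xs"
      using finite_distinct_list finite_subset[OF \<open>T \<subseteq> A\<close> finA] by blast
    let ?ys = "map (\<lambda>a. pvar (\<phi> a ?c) + s a ?c) xs"
    have ys: "set ?ys = (\<lambda>a. Y a ?c) ` T" using xs by (auto simp: Y_def)
    have cn: "?c \<in> {j<..n}" using jn by auto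
    have "reg_seq_mod ?ys G"
    proof (rule reg_seq_fresh_variables[OF xs(2)])
      show "inj_on (\<lambda>a. \<phi> a ?c) (set xs)"
        using xs(1) \<open>T \<subseteq> A\<close> inj' cn by (intro inj_onI) blast
      show "\<phi> a ?c \<notin> pvars (s a' ?c)" if "a \<in> set xs" "a' \<in> set xs" for a a'
        using xs(1) \<open>T \<subseteq> A\<close> that freshs cn by blast
    qed (use xs Gfresh in auto)
    moreover have "set ?ys \<subseteq> rid.span (G \<union> (B \<union> (\<lambda>a. Y a ?c) ` T))"
      unfolding ys by (auto intro: rid.span_base)
    moreover have "grade_ge (K - card T) (G \<union> set ?ys) (B \<union> (\<lambda>a. Y a ?c) ` T)"
      unfolding ys by (rule grade_ge_mono[OF rest]) (auto intro: rid.span_base)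
    ultimately have "grade_ge (length ?ys + (K - card T)) G (B \<union> (\<lambda>a. Y a ?c) ` T)"
      by (rule grade_ge_reg_seq)
    moreover have "length ?ys = card T" using xs distinct_card by fastforce
    ultimately show ?thesis by (auto intro: grade_ge_le)
  qed
  \<comment> \<open>Rows are examined from the bottom: the entries in \<open>T\<close>, the rows of
    \<open>A\<close> below some point, are made to vanish. The next entry above either vanishes too
    or is inverted and becomes the pivot. The empty \<open>T\<close> gives the claim.\<close>
  have upper: "grade_ge K F (B \<union> (\<lambda>a. Y a ?c) ` T)"
    if "T \<subseteq> A" "\<And>x y. x \<in> A \<Longrightarrow> y \<in> T \<Longrightarrow> y < x \<Longrightarrow> x \<in> T" for T
    using that
  proof (induction "card (A - T)" arbitrary: T)
    case 0
    then have "T = A" using finA by auto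
    show ?case unfolding \<open>T = A\<close>
    proof (rule take)
      show "grade_ge (K - card A) (F \<union> (\<lambda>a. Y a ?c) ` A) B"
      proof (rule Suc.hyps(1)[of ?c _ A s \<rho>])
        fix v assume v: "pivoting A ?c n P \<rho> v"
        \<comment> \<open>The column is zero here, so it has no pivot and all rows of
          \<open>A\<close> are counted for it.\<close>
        let ?v = "v(?c := 0)"
        have "{c \<in> {j<..b}. a \<le> ?v c} = {c \<in> {?c<..b}. a \<le> v c}" if "(a, b) \<in> P" for a b
          using P[OF that] by (auto split: if_splits intro: Suc_lessI)
        moreover have "inj_on ?v {c \<in> {j<..n}. ?v c \<noteq> 0}"
        proof -
          have "{c \<in> {j<..n}. ?v c \<noteq> 0} = {c \<in> {?c<..n}. v c \<noteq> 0}"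
            by (auto intro: Suc_lessI)
          then show ?thesis using v by (auto simp: pivoting_def inj_on_def)
        qed
        moreover have "?v ` {j<..n} \<subseteq> insert 0 A"
          using v by (auto simp: pivoting_def image_subset_iff intro: Suc_lessI)
        ultimately have "pivoting A j n P \<rho> ?v"
          using pivotingD[OF v] by (intro pivotingI) simp_all
        then have "K \<le> unhit A j n ?v" by (rule K)
        also have "\<dots> = card {a \<in> A. 0 < a} + unhit (A - {0}) ?c n ?v"
          unfolding unhit_step[OF jn] by simp
        also have "unhit (A - {0}) ?c n ?v = unhit A ?c n v"
        proof -
          have "A - {0} = A" using A0 by auto
          moreover have "unhit A ?c n ?v = unhit A ?c n v" by (rule unhit_cong) auto
          ultimately show ?thesis by simp
        qed
        also have "{a \<in> A. 0 < a} = A" using A0 by (auto intro: gr0I)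
        finally show "K - card A \<le> unhit A ?c n v" by simp
      next
        fix a b rs cs
        assume "(a, b) \<in> P" "set rs \<subseteq> {x \<in> A. a \<le> x}" "set cs \<subseteq> {?c<..b}"
          "length rs = \<rho> a b + 1" "length cs = \<rho> a b + 1"
        then have "lminor (\<lambda>a b. pvar (\<phi> a b) + s a b) rs cs \<in> rid.span (F \<union> B)"
          by (intro minors[of a b]) auto
        then show "lminor (\<lambda>a b. pvar (\<phi> a b) + s a b) rs cs \<in> rid.span (F \<union> (\<lambda>a. Y a ?c) ` A \<union> B)"
          using rid.span_mono[of "F \<union> B" "F \<union> (\<lambda>a. Y a ?c) ` A \<union> B"] by blast
      next
        fix f a b assume f: "f \<in> F \<union> (\<lambda>a. Y a ?c) ` A" and ab: "a \<in> A" "b \<in> {?c<..n}"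
        then have b: "b \<in> {j<..n}" "b \<noteq> ?c" by auto
        show "\<phi> a b \<notin> pvars f"
          using f freshF[of f a b] ab(1) b freshY[of a _ b ?c] jn by auto
      next
        show "inj_on (case_prod \<phi>) (A \<times> {?c<..n})"
          using inj by (rule inj_on_subset) auto
      qed (use Suc.hyps(2) finF finA finB A0 freshs P in auto)
    qed (use finF freshF jn in auto)
  next
    case (Suc m)
    let ?yT = "(\<lambda>a. Y a ?c) ` T"
    have "A - T \<noteq> {}" using Suc.hyps(2) by (metis card.empty nat.distinct(1))
    define p where "p = Max (A - T)"
    have p: "p \<in> A" "p \<notin> T"
      using Max_in[of "A - T"] \<open>A - T \<noteq> {}\<close> finA unfolding p_def by auto
    have pmax: "x \<in> T" if "x \<in> A" "p < x" for x
    proof (rule ccontr)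
      assume "x \<notin> T"
      then have "x \<le> p" using that(1) finA unfolding p_def by (intro Max_ge) auto
      then show False using that(2) by simp
    qed
    have T: "T = {a \<in> A. p < a}"
    proof (intro equalityI subsetI)
      fix x assume x: "x \<in> T"
      then have "x \<noteq> p" "\<not> x < p" using Suc.prems(2)[OF p(1) x] p(2) by blast+
      then show "x \<in> {a \<in> A. p < a}" using x Suc.prems(1) by auto
    qed (use pmax in auto)
    have finT: "finite T" using Suc.prems(1) finA finite_subset by blast
    have cn: "?c \<in> {j<..n}" using jn by auto
    have "card (A - insert p T) = m"
      using Suc.hyps(2) p finA unfolding Diff_insert[of A p T] by simp
    then have kill: "grade_ge K F (B \<union> (\<lambda>a. Y a ?c) ` insert p T)"
    proof (intro Suc.hyps(1))
      show "insert p T \<subseteq> A" using Suc.prems(1) p by simp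
      show "x \<in> insert p T" if "x \<in> A" "y \<in> insert p T" "y < x" for x y
        using that pmax[OF that(1)] by (auto simp: T)
    qed simp
    let ?X = "F \<union> B \<union> ?yT \<union> {Y p ?c} \<union> case_prod s ` (A \<times> {j<..n}) \<union> case_prod Y ` (A \<times> {j<..n})"
    obtain t where t: "t \<notin> case_prod \<phi> ` (A \<times> {j<..n})" "\<And>f. f \<in> ?X \<Longrightarrow> t \<notin> pvars f"
      using exists_fresh[of ?X "case_prod \<phi> ` (A \<times> {j<..n})"] finF finB finT finA by auto
    let ?F = "insert (pvar t * Y p ?c - 1) F"
    have tx_fresh: "\<phi> a b \<notin> pvars (pvar t * Y p ?c - 1)"
      if "a \<in> A" "b \<in> {j<..n}" "(a, b) \<noteq> (p, ?c)" for a b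
    proof -
      have "\<phi> a b \<noteq> t" using t(1) that by force
      then show ?thesis
        using freshY[of a p b ?c] that p cn pvars_diff[of "pvar t * Y p ?c" 1] pvars_mult[of "pvar t" "Y p ?c"]
        by auto
    qed
    have invert: "grade_ge K ?F (B \<union> ?yT)"
    proof (rule take)
      show "grade_ge (K - card T) (?F \<union> ?yT) B"
      \<comment> \<open>If a condition of rank 0 covers the pivot position, the entry is in the
        ideal and inverted at the same time, so the piece is empty. Otherwise the subtraction of 1
        in \<open>?\<rho>\<close>, which accounts for the pivot, does not truncate for the minors
        and pivots considered below.\<close>
      proof (cases "\<exists>(a, b) \<in> P. a \<le> p \<and> ?c \<le> b \<and> \<rho> a b = 0")
        case True
        then obtain a b where ab: "(a, b) \<in> P" "a \<le> p" "?c \<le> b" "\<rho> a b = 0" by auto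
        have "lminor Y [p] [?c] \<in> rid.span (F \<union> B)"
          using minors[of a b "[p]" "[?c]"] ab p unfolding Y_def by auto
        then have "Y p ?c \<in> rid.span (?F \<union> ?yT \<union> B)"
          using rid.span_mono[of "F \<union> B" "?F \<union> ?yT \<union> B"] by (auto simp: lminor_single)
        then have "pvar t * Y p ?c \<in> rid.span (?F \<union> ?yT \<union> B)"
          by (rule span_mult_left)
        moreover have "pvar t * Y p ?c - 1 \<in> rid.span (?F \<union> ?yT \<union> B)"
          by (rule rid.span_base) simp
        ultimately have "pvar t * Y p ?c - (pvar t * Y p ?c - 1) \<in> rid.span (?F \<union> ?yT \<union> B)"
          by (rule rid.span_diff)
        then have "1 \<in> rid.span (?F \<union> ?yT \<union> B)" by (simp only: diff_diff_eq2 add_diff_cancel_left')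
        then show ?thesis by (rule grade_ge_unit)
      next
        case False
        let ?s = "\<lambda>a b. s a b - pvar t * Y a ?c * Y p b"
        let ?\<rho> = "\<lambda>a b. \<rho> a b - (if a \<le> p \<and> ?c \<le> b then 1 else 0)"
        have Y': "(\<lambda>a b. pvar (\<phi> a b) + ?s a b) = (\<lambda>a b. Y a b - pvar t * Y a ?c * Y p b)"
          by (simp add: Y_def fun_eq_iff)
        show ?thesis
        proof (rule IH[of ?c _ "A - {p}" ?s ?\<rho>])
          fix v assume v: "pivoting (A - {p}) ?c n P ?\<rho> v"
          let ?v = "v(?c := p)"
          have "card {c \<in> {j<..b}. a \<le> ?v c} \<le> \<rho> a b" if ab: "(a, b) \<in> P" for a b
          proof -
            have le: "card {c \<in> {?c<..b}. a \<le> v c} \<le> ?\<rho> a b" using pivotingD[OF v ab] .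
            show ?thesis
            proof (cases "a \<le> p \<and> ?c \<le> b")
              case True
              have "{c \<in> {j<..b}. a \<le> ?v c} = insert ?c {c \<in> {?c<..b}. a \<le> v c}"
                using True by (auto intro: Suc_lessI)
              moreover have "\<rho> a b \<noteq> 0" using False True ab by auto
              ultimately show ?thesis using le True by simp
            next
              case False
              have "{c \<in> {j<..b}. a \<le> ?v c} = {c \<in> {?c<..b}. a \<le> v c}"
                using False by (auto split: if_splits intro: Suc_lessI)
              then show ?thesis using le False by (auto split: if_splits)
            qed
          qed
          moreover have "inj_on ?v {c \<in> {j<..n}. ?v c \<noteq> 0}"
          proof -
            have "{c \<in> {j<..n}. ?v c \<noteq> 0} \<subseteq> insert ?c {c \<in> {?c<..n}. v c \<noteq> 0}"
              by (auto intro: Suc_lessI)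
            moreover have "inj_on ?v (insert ?c {c \<in> {?c<..n}. v c \<noteq> 0})"
            proof -
              have vp: "v c \<noteq> p" if "c \<in> {?c<..n}" for c
              proof -
                have "v c \<in> insert 0 (A - {p})"
                  using v that unfolding pivoting_def by blast
                then show ?thesis using p A0 by (cases "p = 0") auto
              qed
              have "inj_on v {c \<in> {?c<..n}. v c \<noteq> 0}" using v unfolding pivoting_def by blast
              then have "inj_on ?v {c \<in> {?c<..n}. v c \<noteq> 0}" by (auto simp: inj_on_def)
              moreover have "p \<notin> v ` {c \<in> {?c<..n}. v c \<noteq> 0}" using vp by blast
              then have "?v ?c \<notin> ?v ` ({c \<in> {?c<..n}. v c \<noteq> 0} - {?c})" by auto
              ultimately show ?thesis by (simp add: inj_on_insert)
            qed
            ultimately show ?thesis by (rule inj_on_subset[rotated])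
          qed
          moreover have "?v ` {j<..n} \<subseteq> insert 0 A"
          proof (rule image_subsetI)
            fix c assume "c \<in> {j<..n}"
            then consider "c = ?c" | "c \<in> {?c<..n}" "c \<noteq> ?c" by force
            then show "?v c \<in> insert 0 A"
            proof cases
              case 2
              then have "v c \<in> insert 0 (A - {p})" using v unfolding pivoting_def by blast
              then show ?thesis using 2 by auto
            qed (use p in simp)
          qed
          ultimately have "pivoting A j n P \<rho> ?v" by (intro pivotingI) blast+
          then have "K \<le> unhit A j n ?v" by (rule K)
          also have "\<dots> = card T + unhit (A - {p}) ?c n ?v"
            unfolding unhit_step[OF jn] by (simp add: T)
          also have "unhit (A - {p}) ?c n ?v = unhit (A - {p}) ?c n v"
            by (rule unhit_cong) auto
          finally show "K - card T \<le> unhit (A - {p}) ?c n v" by simp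
        next
          fix a b rs cs
          assume ab: "(a, b) \<in> P" and rs: "set rs \<subseteq> {x \<in> A - {p}. a \<le> x}" and cs: "set cs \<subseteq> {?c<..b}"
            and len: "length rs = ?\<rho> a b + 1" "length cs = ?\<rho> a b + 1"
          let ?G = "?F \<union> ?yT \<union> B"
          let ?m = "lminor (\<lambda>a b. Y a b - pvar t * Y a ?c * Y p b) rs cs"
          have cb: "?c \<le> b" using cs len by (cases cs) auto
          have "?m \<in> rid.span ?G"
          proof (cases "a \<le> p")
            case True
            then have "\<rho> a b \<noteq> 0" using False ab cb by auto
            then have "lminor Y (p # rs) (?c # cs) \<in> rid.span (F \<union> B)"
              unfolding Y_def using ab rs cs len p True cb by (intro minors[of a b]) auto
            then have 1: "lminor Y (p # rs) (?c # cs) \<in> rid.span ?G"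
              using rid.span_mono[of "F \<union> B" ?G] by blast
            have inv: "cong_mod (pvar t * Y p ?c) 1 ?G"
              unfolding cong_mod_def by (rule rid.span_base) auto
            have "cong_mod (lminor Y (p # rs) (?c # cs)) (Y p ?c * ?m) ?G"
              using inv by (rule lminor_pivot) (simp add: len)
            then have "Y p ?c * ?m \<in> rid.span ?G" using 1 cong_mod_mem by blast
            then have "pvar t * (Y p ?c * ?m) \<in> rid.span ?G" by (rule span_mult_left)
            moreover have "cong_mod (pvar t * Y p ?c * ?m) (1 * ?m) ?G"
              by (rule cong_mod_mult[OF inv cong_mod_refl])
            ultimately show ?thesis using cong_mod_mem[of "pvar t * Y p ?c * ?m" "1 * ?m" ?G]
              by (simp only: mult.assoc mult_1)
          next
            case False
            \<comment> \<open>All rows of this minor lie below the pivot, where the column has been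
              made zero, so the Schur complement does not change the entries modulo the
              ideal.\<close>
            have "lminor Y rs cs \<in> rid.span (F \<union> B)"
              unfolding Y_def using ab rs cs len False by (intro minors[of a b]) auto
            then have "lminor Y rs cs \<in> rid.span ?G"
              using rid.span_mono[of "F \<union> B" ?G] by blast
            moreover have "cong_mod ?m (lminor Y rs cs) ?G"
            proof (rule lminor_cong_mod)
              fix r c assume "r \<in> set rs"
              then have "r \<in> T" using rs False T by auto
              then have "Y r ?c \<in> rid.span ?G" by (auto intro: rid.span_base)
              then have "- (pvar t * Y r ?c * Y p c) \<in> rid.span ?G"
                by (intro rid.span_neg span_mult_right[of "pvar t * Y r ?c"] span_mult_left[of "Y r ?c"])
              then show "cong_mod (Y r c - pvar t * Y r ?c * Y p c) (Y r c) ?G"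
                by (simp add: cong_mod_def)
            qed (use len in simp)
            ultimately show ?thesis using cong_mod_mem by blast
          qed
          then show "lminor (\<lambda>a b. pvar (\<phi> a b) + ?s a b) rs cs \<in> rid.span ?G"
            by (simp only: Y')
        next
          fix f a b assume f: "f \<in> ?F \<union> ?yT" and "a \<in> A - {p}" "b \<in> {?c<..n}"
          then have ab: "a \<in> A" "b \<in> {j<..n}" "b \<noteq> ?c" by auto
          show "\<phi> a b \<notin> pvars f"
            using f freshF[OF _ ab(1,2)] tx_fresh[OF ab(1,2)] freshY[OF ab(1) _ ab(2) cn] ab(3) Suc.prems(1)
            by auto
        next
          fix a b a' b'
          assume "a \<in> A - {p}" "b \<in> {?c<..n}" "a' \<in> A - {p}" "b' \<in> {?c<..n}"
          then have ab: "a \<in> A" "a \<noteq> p" "b \<in> {j<..n}" "b \<noteq> ?c" "a' \<in> A" "b' \<in> {j<..n}" by auto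
          have "\<phi> a b \<noteq> t" using t(1) ab by force
          then have "\<phi> a b \<notin> pvars (pvar t * Y a' ?c * Y p b')"
            using pvars_mult[of "pvar t * Y a' ?c" "Y p b'"] pvars_mult[of "pvar t" "Y a' ?c"]
              freshY[OF ab(1) ab(5) ab(3) cn] freshY[OF ab(1) p(1) ab(3) ab(6)] ab(2,4) by auto
          then show "\<phi> a b \<notin> pvars (?s a' b')"
            using pvars_diff[of "s a' b'" "pvar t * Y a' ?c * Y p b'"] freshs[OF ab(1,3,5,6)] by auto
        next
          show "inj_on (case_prod \<phi>) ((A - {p}) \<times> {?c<..n})"
            using inj by (rule inj_on_subset) auto
        qed (use l finF finT finB finA A0 P in auto)
      qed
      show "\<phi> a ?c \<notin> pvars f" if "f \<in> ?F" "a \<in> T" for f a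
        using that freshF[of f a ?c] tx_fresh[of a ?c] Suc.prems(1) p cn by auto
    qed (use Suc.prems finF in auto)
    show ?case
    proof (rule grade_ge_split[where x = "Y p ?c" and t = t])
      show "grade_ge K F (insert (Y p ?c) (B \<union> ?yT))" using kill by simp
    qed (use invert finF finB finT t in auto)
  qed
  show ?case using upper[of "{}"] by simp
qed

lemma pivoting_image: "pivoting A j n P \<rho> v \<Longrightarrow> v ` {j<..n} \<subseteq> insert 0 A"
  by (simp only: pivoting_def)

lemma pivoting_inj_on: "pivoting A j n P \<rho> v \<Longrightarrow> inj_on v {c \<in> {j<..n}. v c \<noteq> 0}"
  by (simp only: pivoting_def)

section \<open>Diagrams and ranks\<close>

lemma rk_0 [simp]: "rk u a 0 = 0"
  by (simp add: rk_def)

lemma rk_Suc: "rk u a (Suc b) = rk u a b + (if a \<le> u (Suc b) then 1 else 0)"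
proof -
  have "{k \<in> {1..Suc b}. a \<le> u k} = (if a \<le> u (Suc b) then insert (Suc b) {k \<in> {1..b}. a \<le> u k} else {k \<in> {1..b}. a \<le> u k})"
    by (auto simp: le_Suc_eq)
  then show ?thesis by (simp add: rk_def)
qed

lemma rk_mono_col: "b \<le> b' \<Longrightarrow> rk u a b \<le> rk u a b'"
  unfolding rk_def by (rule card_mono) auto

lemma rk_antimono_row: "a \<le> a' \<Longrightarrow> rk u a' b \<le> rk u a b"
  unfolding rk_def by (rule card_mono) auto

lemma rk_mono: "a \<le> a' \<Longrightarrow> b' \<le> b \<Longrightarrow> rk u a' b' \<le> rk u a b"
  using rk_mono_col[of b' b u a'] rk_antimono_row[of a a' u b] by linarith

lemma rk_row_Suc_hit:
  assumes "1 \<le> k" "k \<le> b" "u k = a"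
  shows "Suc (rk u (Suc a) b) \<le> rk u a b"
proof -
  have "insert k {k \<in> {1..b}. Suc a \<le> u k} \<subseteq> {k \<in> {1..b}. a \<le> u k}" using assms by auto
  then have "card (insert k {k \<in> {1..b}. Suc a \<le> u k}) \<le> card {k \<in> {1..b}. a \<le> u k}"
    by (rule card_mono[rotated]) simp
  then show ?thesis using assms by (simp add: rk_def)
qed

lemma rk_row_Suc_inj:
  assumes "inj_on u {k \<in> {1..b}. u k = a}"
  shows "rk u a b \<le> Suc (rk u (Suc a) b)"
proof -
  have eq: "{k \<in> {1..b}. a \<le> u k} = {k \<in> {1..b}. Suc a \<le> u k} \<union> {k \<in> {1..b}. u k = a}" by auto
  have "rk u a b \<le> rk u (Suc a) b + card {k \<in> {1..b}. u k = a}"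
    unfolding rk_def eq by (rule card_Un_le)
  moreover have "card {k \<in> {1..b}. u k = a} = card (u ` {k \<in> {1..b}. u k = a})"
    by (rule card_image[symmetric, OF assms])
  moreover have "card (u ` {k \<in> {1..b}. u k = a}) \<le> card {a}" by (rule card_mono) auto
  ultimately show ?thesis by simp
qed

lemma rk_row_Suc_unhit:
  assumes "\<And>k. 1 \<le> k \<Longrightarrow> k \<le> b \<Longrightarrow> u k \<noteq> a"
  shows "rk u a b = rk u (Suc a) b"
proof -
  have "a \<le> u k \<longleftrightarrow> Suc a \<le> u k" if "k \<in> {1..b}" for k
  proof -
    have "u k \<noteq> a" using assms[of k] that by simp
    then show ?thesis by linarith
  qed
  then have "{k \<in> {1..b}. a \<le> u k} = {k \<in> {1..b}. Suc a \<le> u k}" by blast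
  then show ?thesis by (simp only: rk_def)
qed

locale permutation =
  fixes n :: nat and w :: "nat \<Rightarrow> nat"
  assumes perm: "w permutes {1..n}"
begin

abbreviation "D \<equiv> diagram n w"
abbreviation "E \<equiv> essential_set n w"
abbreviation "wi \<equiv> Hilbert_Choice.inv w"

lemma w_wi [simp]: "w (wi x) = x" and wi_w [simp]: "wi (w x) = x"
  using permutes_inverses[OF perm] by auto

lemma wi_perm: "wi permutes {1..n}"
  by (rule permutes_inv[OF perm])

lemma w_in [simp]: "w x \<in> {1..n} \<longleftrightarrow> x \<in> {1..n}" and wi_in [simp]: "wi x \<in> {1..n} \<longleftrightarrow> x \<in> {1..n}"
  using permutes_in_image[OF perm] permutes_in_image[OF wi_perm] by auto

lemma w_bounds: "1 \<le> x \<Longrightarrow> x \<le> n \<Longrightarrow> 1 \<le> w x \<and> w x \<le> n"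
  using w_in[of x] by auto

lemma wi_bounds: "1 \<le> x \<Longrightarrow> x \<le> n \<Longrightarrow> 1 \<le> wi x \<and> wi x \<le> n"
  using wi_in[of x] by auto

lemma w_eq_iff: "w x = y \<longleftrightarrow> x = wi y"
  by auto

lemma diagram_iff: "(p, q) \<in> D \<longleftrightarrow> 1 \<le> p \<and> p \<le> n \<and> 1 \<le> q \<and> q \<le> n \<and> w q < p \<and> q < wi p"
  by (auto simp: diagram_def)

lemma finite_diagram: "finite D"
  by (rule finite_subset[of _ "{1..n} \<times> {1..n}"]) (auto simp: diagram_def)

text \<open>Moving to the right or upwards inside the diagram does not change the rank.\<close>

lemma diagram_essential:
  assumes "(x, y) \<in> D"
  obtains p q where "(p, q) \<in> E" "p \<le> x" "y \<le> q" "rk w p q = rk w x y"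
  using assms
proof (induction "x + (n - y)" arbitrary: x y thesis rule: less_induct)
  case less
  have xy: "1 \<le> x" "x \<le> n" "1 \<le> y" "y \<le> n" "w y < x" "y < wi x"
    using less.prems(2) by (auto simp: diagram_iff)
  consider "(x, y) \<in> E" | "(x, Suc y) \<in> D" | "(x - 1, y) \<in> D"
    using less.prems(2) by (auto simp: essential_set_def)
  then show ?case
  proof cases
    case 1
    then show ?thesis using less.prems(1) by blast
  next
    case 2
    then have "rk w x (Suc y) = rk w x y" "x + (n - Suc y) < x + (n - y)"
      by (auto simp: rk_Suc diagram_iff)
    then show ?thesis using less.hyps[OF _ _ 2] less.prems(1) by (metis Suc_leD)
  next
    case 3
    have "rk w (x - 1) y = rk w (Suc (x - 1)) y"
      using 3 by (intro rk_row_Suc_unhit) (auto simp: diagram_iff w_eq_iff)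
    then have "rk w (x - 1) y = rk w x y" "x - 1 + (n - y) < x + (n - y)" using xy by auto
    then show ?thesis using less.hyps[OF _ _ 3] less.prems(1) by (metis diff_le_self le_trans)
  qed
qed

text \<open>Outside of the diagram, the condition at \<open>(a, b)\<close> follows from the one at \<open>(a, b - 1)\<close> or at
  \<open>(a + 1, b)\<close>, since the rank of \<open>w\<close> drops by one there.\<close>

lemma rk_le_of_essential:
  assumes ess: "\<And>p q. (p, q) \<in> E \<Longrightarrow> rk v p q \<le> rk w p q"
    and vn: "\<And>k. 1 \<le> k \<Longrightarrow> k \<le> n \<Longrightarrow> v k \<le> n"
    and inj: "inj_on v {k \<in> {1..n}. v k \<noteq> 0}"
    and "1 \<le> a" "b \<le> n"
  shows "rk v a b \<le> rk w a b"
proof (cases "a \<le> Suc n")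
  case True
  show ?thesis using True assms(4,5)
  proof (induction "Suc n - a + b" arbitrary: a b rule: less_induct)
    case less
    consider "b = 0" | "a = Suc n" "b \<noteq> 0" | "(a, b) \<in> D" | "b \<noteq> 0" "a \<le> n" "a \<le> w b" | "b \<noteq> 0" "a \<le> n" "wi a \<le> b"
      using less.prems by (force simp: diagram_iff)
    then show ?case
    proof cases
      case 2
      then have "{k \<in> {1..b}. a \<le> v k} = {}" using vn less.prems by force
      then have "rk v a b = 0" by (simp only: rk_def card.empty)
      then show ?thesis by simp
    next
      case 3
      then obtain p q where "(p, q) \<in> E" "p \<le> a" "b \<le> q" "rk w p q = rk w a b" by (rule diagram_essential)
      then show ?thesis using ess[of p q] rk_mono[of p a b q v] by linarith
    next
      case 4
      then obtain b' where b': "b = Suc b'" by (cases b) auto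
      have "rk v a b' \<le> rk w a b'" using less b' by auto
      then show ?thesis using 4 by (auto simp: b' rk_Suc)
    next
      case 5
      have "rk v (Suc a) b \<le> rk w (Suc a) b" using less 5 by auto
      moreover have "rk v a b \<le> Suc (rk v (Suc a) b)"
        using less.prems by (intro rk_row_Suc_inj inj_on_subset[OF inj]) auto
      moreover have "Suc (rk w (Suc a) b) \<le> rk w a b"
        using 5 wi_bounds[of a] less.prems by (intro rk_row_Suc_hit[of "wi a"]) auto
      ultimately show ?thesis by linarith
    qed simp
  qed
next
  case False
  then have "{k \<in> {1..b}. a \<le> v k} = {}" using vn assms(5) by force
  then have "rk v a b = 0" by (simp only: rk_def card.empty)
  then show ?thesis by simp
qed

text \<open>Given \<open>w q < p\<close>, the condition \<open>q < wi p\<close> says that no column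
  before \<open>q\<close> hits row \<open>p\<close>.\<close>

lemma card_diagram: "card D = unhit {1..n} 0 n w"
proof -
  have eq: "D = prod.swap ` (SIGMA q:{0<..n}. {p \<in> {1..n}. w q < p \<and> p \<notin> w ` {0<..<q}})"
  proof (intro equalityI subsetI)
    fix z assume "z \<in> D"
    then obtain p q where z: "z = (p, q)" "(p, q) \<in> D" by (cases z) auto
    then have "p \<notin> w ` {0<..<q}" by (auto simp: diagram_iff)
    then show "z \<in> prod.swap ` (SIGMA q:{0<..n}. {p \<in> {1..n}. w q < p \<and> p \<notin> w ` {0<..<q}})"
      using z by (force simp: diagram_iff image_iff)
  next
    fix z assume "z \<in> prod.swap ` (SIGMA q:{0<..n}. {p \<in> {1..n}. w q < p \<and> p \<notin> w ` {0<..<q}})"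
    then obtain p q where z: "z = (p, q)" "q \<in> {0<..n}" "p \<in> {1..n}" "w q < p" "p \<notin> w ` {0<..<q}" by auto
    have "wi p \<noteq> q" using z(4) by auto
    moreover have "\<not> wi p < q"
    proof
      assume "wi p < q"
      then have "w (wi p) \<in> w ` {0<..<q}" using wi_bounds[of p] z(3) by (intro imageI) auto
      then show False using z(5) by simp
    qed
    ultimately show "z \<in> D" using z by (auto simp: diagram_iff)
  qed
  have "inj prod.swap" by (rule inj_swap)
  then show ?thesis unfolding eq unhit_def
    by (subst card_image) (auto intro: inj_on_subset)
qed

end

section \<open>Rank domination and inversions\<close>

definition swap_cols :: "nat \<Rightarrow> (nat \<Rightarrow> nat) \<Rightarrow> nat \<Rightarrow> nat" where
  "swap_cols i u = u(i := u (Suc i), Suc i := u i)"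

lemma rk_swap_cols_eq:
  assumes "1 \<le> i" "b \<noteq> i" shows "rk (swap_cols i u) a b = rk u a b"
proof -
  obtain i' where i': "i = Suc i'" using assms(1) by (cases i) auto
  have low: "rk (swap_cols i u) a b = rk u a b" if "b < i" for b
    using that by (auto simp: rk_def swap_cols_def intro!: arg_cong[of _ _ card])
  have "rk (swap_cols i u) a (Suc i) = rk u a (Suc i)"
    using low[of i'] unfolding i' rk_Suc by (auto simp: swap_cols_def)
  then have "rk (swap_cols i u) a (Suc i + d) = rk u a (Suc i + d)" for d
  proof (induction d)
    case (Suc d)
    then show ?case by (simp add: rk_Suc) (simp add: swap_cols_def)
  qed simp
  then have "rk (swap_cols i u) a b = rk u a b" if "Suc i \<le> b" for b
    using that by (metis le_add_diff_inverse)
  then show ?thesis using low assms(2) by (meson Suc_leI linorder_neqE_nat)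
qed

lemma rk_swap_cols:
  "rk (swap_cols (Suc i) u) a (Suc i) = rk u a i + (if a \<le> u (Suc (Suc i)) then 1 else 0)"
proof -
  have "rk (swap_cols (Suc i) u) a i = rk u a i" by (rule rk_swap_cols_eq) auto
  then show ?thesis by (simp add: rk_Suc swap_cols_def)
qed

lemma swap_cols_image:
  assumes "1 \<le> i" "c \<noteq> Suc i" shows "swap_cols i u ` {0<..<c} = u ` {0<..<c}"
proof (cases "c \<le> i")
  case True
  then show ?thesis by (intro image_cong) (auto simp: swap_cols_def)
next
  case False
  then have c: "Suc i < c" using assms by auto
  have s: "swap_cols i u k = u (if k = i then Suc i else if k = Suc i then i else k)" for k
    by (simp add: swap_cols_def)
  show ?thesis
  proof (intro equalityI subsetI)
    fix x assume "x \<in> swap_cols i u ` {0<..<c}"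
    then show "x \<in> u ` {0<..<c}" using c assms(1) by (auto simp: s)
  next
    fix x assume "x \<in> u ` {0<..<c}"
    then obtain k where k: "k \<in> {0<..<c}" "x = u k" by auto
    then have "x = swap_cols i u (if k = i then Suc i else if k = Suc i then i else k)"
      by (auto simp: s)
    then show "x \<in> swap_cols i u ` {0<..<c}" using k c assms(1) by (auto split: if_splits)
  qed
qed

text \<open>The two columns exchange their counts, except that row \<open>u i\<close> is now also
  counted in column \<open>i\<close>: it lies below \<open>u (Suc i)\<close> and no earlier column
  uses it.\<close>

lemma unhit_swap_cols:
  assumes "finite A" "1 \<le> i" "i < n" and desc: "u (Suc i) < u i" and "u i \<in> A"
    and new: "u i \<notin> u ` {0<..<i}"
  shows "unhit A 0 n (swap_cols i u) = Suc (unhit A 0 n u)"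
proof -
  let ?t = "\<lambda>u c. card {a \<in> A. u c < a \<and> a \<notin> u ` {0<..<c}}"
  let ?s = "swap_cols i u"
  have cols: "{0<..n} = {i, Suc i} \<union> ({0<..n} - {i, Suc i})" using assms by auto
  have sum: "unhit A 0 n u = ?t u i + ?t u (Suc i) + (\<Sum>c \<in> {0<..n} - {i, Suc i}. ?t u c)" for u
    unfolding unhit_def by (subst cols, subst sum.union_disjoint) auto
  have rest: "(\<Sum>c \<in> {0<..n} - {i, Suc i}. ?t ?s c) = (\<Sum>c \<in> {0<..n} - {i, Suc i}. ?t u c)"
  proof (rule sum.cong[OF refl])
    fix c assume "c \<in> {0<..n} - {i, Suc i}"
    then have "swap_cols i u ` {0<..<c} = u ` {0<..<c}" "swap_cols i u c = u c"
      using swap_cols_image[of i c u] assms(2) by (auto simp: swap_cols_def)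
    then show "?t ?s c = ?t u c" by simp
  qed
  have ivl: "{0<..<Suc i} = insert i {0<..<i}" using assms(2) by auto
  have si: "swap_cols i u ` {0<..<i} = u ` {0<..<i}" by (rule swap_cols_image) (use assms in auto)
  have 1: "?t ?s i = Suc (?t u (Suc i))"
  proof -
    have "{a \<in> A. ?s i < a \<and> a \<notin> ?s ` {0<..<i}} = insert (u i) {a \<in> A. u (Suc i) < a \<and> a \<notin> u ` {0<..<Suc i}}"
      unfolding si ivl using assms by (auto simp: swap_cols_def)
    then show ?thesis using assms(1) by (simp add: ivl)
  qed
  have 2: "?t ?s (Suc i) = ?t u i"
  proof -
    have "{a \<in> A. ?s (Suc i) < a \<and> a \<notin> ?s ` {0<..<Suc i}} = {a \<in> A. u i < a \<and> a \<notin> u ` {0<..<i}}"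
      unfolding ivl image_insert si using desc by (auto simp: swap_cols_def)
    then show ?thesis by simp
  qed
  show ?thesis unfolding sum rest 1 2 by simp
qed

text \<open>Induction on \<open>w\<close>: at a descent \<open>i\<close> of \<open>w\<close>, swap the columns \<open>i\<close> and \<open>i + 1\<close> of \<open>w\<close>, and also
  those of \<open>v\<close> if it has a descent there (the lifting property of the Bruhat order).\<close>

lemma unhit_le_of_rk_le:
  assumes "w permutes {1..n}"
    and "v ` {0<..n} \<subseteq> insert 0 {1..n}" "inj_on v {c \<in> {0<..n}. v c \<noteq> 0}"
    and "\<And>a b. 1 \<le> a \<Longrightarrow> b \<le> n \<Longrightarrow> rk v a b \<le> rk w a b"
  shows "unhit {1..n} 0 n w \<le> unhit {1..n} 0 n v"
  using assms
proof (induction "n * n - unhit {1..n} 0 n w" arbitrary: w v rule: less_induct)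
  case less
  note perm = less.prems(1) and vin = less.prems(2) and vinj = less.prems(3) and le = less.prems(4)
  interpret permutation n w by unfold_locales (rule perm)
  show ?case
  proof (cases "\<exists>i. 1 \<le> i \<and> i < n \<and> w (Suc i) < w i")
    case True
    then obtain i where i: "1 \<le> i" "i < n" "w (Suc i) < w i" by auto
    obtain i' where i': "i = Suc i'" using i(1) by (cases i) auto
    let ?w = "swap_cols i w"
    have unhit_w: "unhit {1..n} 0 n ?w = Suc (unhit {1..n} 0 n w)"
    proof (rule unhit_swap_cols)
      show "w i \<in> {1..n}" using w_bounds[of i] i by simp
      show "w i \<notin> w ` {0<..<i}" by (auto simp: w_eq_iff)
    qed (use i in auto)
    have perm': "?w permutes {1..n}"
    proof -
      have "?w = w \<circ> transpose i (Suc i)"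
        by (auto simp: swap_cols_def fun_eq_iff transpose_def)
      moreover have "transpose i (Suc i) permutes {1..n}" using i by (intro permutes_swap_id) auto
      ultimately show ?thesis using perm permutes_compose by fastforce
    qed
    have bound: "unhit {1..n} 0 n ?w \<le> n * n"
    proof -
      have "unhit {1..n} 0 n ?w \<le> (\<Sum>c \<in> {0<..n}. card {1..n})"
        unfolding unhit_def by (intro sum_mono card_mono) auto
      then show ?thesis by simp
    qed
    \<comment> \<open>The count grows with each swap of \<open>w\<close> and is at most
      \<open>n * n\<close>, so the induction ends at a permutation without descents.\<close>
    have dec: "n * n - unhit {1..n} 0 n ?w < n * n - unhit {1..n} 0 n w"
      using unhit_w bound by linarith
    show ?thesis
    proof (cases "v (Suc i) < v i")
      case True
      let ?v = "swap_cols i v"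
      have "v i \<in> insert 0 {1..n}" using i by (intro subsetD[OF vin] imageI) simp
      then have vi: "v i \<noteq> 0" "v i \<in> {1..n}" using True by auto
      have unhit_v: "unhit {1..n} 0 n ?v = Suc (unhit {1..n} 0 n v)"
      proof (rule unhit_swap_cols)
        show "v i \<notin> v ` {0<..<i}"
        proof
          assume "v i \<in> v ` {0<..<i}"
          then obtain k where "k \<in> {0<..<i}" "v k = v i" by auto
          moreover have "k = i"
            by (rule inj_onD[OF vinj]) (use calculation vi i in auto)
          ultimately show False by simp
        qed
      qed (use True vi i in auto)
      have "unhit {1..n} 0 n ?w \<le> unhit {1..n} 0 n ?v"
      proof (rule less.hyps[OF dec perm'])
        show "?v ` {0<..n} \<subseteq> insert 0 {1..n}"
          using vin i by (auto simp: swap_cols_def image_subset_iff)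
        show "inj_on ?v {c \<in> {0<..n}. ?v c \<noteq> 0}"
        proof (rule inj_onI)
          fix x y assume *: "x \<in> {c \<in> {0<..n}. ?v c \<noteq> 0}" "y \<in> {c \<in> {0<..n}. ?v c \<noteq> 0}" "?v x = ?v y"
          let ?t = "transpose i (Suc i)"
          have v: "?v c = v (?t c)" for c by (auto simp: swap_cols_def transpose_def)
          have "?t x \<in> {0<..n}" "?t y \<in> {0<..n}" using *(1,2) i by (auto simp: transpose_def)
          moreover have "v (?t x) \<noteq> 0" "v (?t y) \<noteq> 0"
            using *(1,2) by (simp_all only: v mem_Collect_eq simp_thms)
          ultimately have "?t x \<in> {c \<in> {0<..n}. v c \<noteq> 0}" "?t y \<in> {c \<in> {0<..n}. v c \<noteq> 0}"
            by simp_all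
          moreover have "v (?t x) = v (?t y)" using *(3) by (simp only: v)
          ultimately have "?t x = ?t y" by (rule inj_onD[OF vinj, rotated])
          then show "x = y" by (metis transpose_involutory)
        qed
        show "rk ?v a b \<le> rk ?w a b" if "1 \<le> a" "b \<le> n" for a b
        proof (cases "b = i")
          case True
          \<comment> \<open>Only ranks in column \<open>i\<close> change. For
            \<open>a > v (Suc i)\<close> the bound in column \<open>i'\<close> suffices; otherwise
            both columns \<open>i\<close> and \<open>Suc i\<close> of \<open>v\<close> are counted,
            and the bound in column \<open>Suc i\<close> gives the claim.\<close>
          have "rk v a i' \<le> rk w a i'" "rk v a (Suc i) \<le> rk w a (Suc i)"
            using le[of a i'] le[of a "Suc i"] that i i' by auto
          then show ?thesis
            using \<open>v (Suc i) < v i\<close> i(3) unfolding True i' rk_swap_cols by (auto simp: rk_Suc split: if_splits)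
        next
          case False
          then show ?thesis using rk_swap_cols_eq[OF i(1) False] le that by simp
        qed
      qed
      then show ?thesis using unhit_v unhit_w by simp
    next
      case False
      \<comment> \<open>Without a descent at \<open>i\<close>, the unchanged \<open>v\<close>
        already satisfies the smaller bounds of the swapped \<open>w\<close>.\<close>
      have "unhit {1..n} 0 n ?w \<le> unhit {1..n} 0 n v"
      proof (rule less.hyps[OF dec perm' vin vinj])
        show "rk v a b \<le> rk ?w a b" if "1 \<le> a" "b \<le> n" for a b
        proof (cases "b = i")
          case True
          have "rk v a i' \<le> rk w a i'" "rk v a (Suc i) \<le> rk w a (Suc i)"
            using le[of a i'] le[of a "Suc i"] that i i' by auto
          then show ?thesis
            using False i(3) unfolding True i' rk_swap_cols by (auto simp: rk_Suc split: if_splits)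
        next
          case False
          then show ?thesis using rk_swap_cols_eq[OF i(1) False] le that by simp
        qed
      qed
      then show ?thesis using unhit_w by simp
    qed
  next
    case False
    have asc: "w i < w (Suc i)" if "1 \<le> i" "i < n" for i
    proof -
      have "w i \<noteq> w (Suc i)" by (simp add: w_eq_iff)
      then show ?thesis using False that by (meson linorder_neqE_nat)
    qed
    have id: "w c = c" if c: "1 \<le> c" "c \<le> n" for c
    proof (rule antisym)
      have "d \<le> w d" if "1 \<le> d" "d \<le> n" for d
        using that
      proof (induction d rule: dec_induct)
        case base
        then show ?case using w_bounds[of 1] by simp
      next
        case (step d)
        then show ?case using asc[of d] by simp
      qed
      then show "c \<le> w c" using c by simp
      have "w c + (d - c) \<le> w d" if "c \<le> d" "d \<le> n" for d
        using that
      proof (induction d rule: dec_induct)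
        case (step d)
        then show ?case using asc[of d] c by simp
      qed simp
      from this[of n] show "w c \<le> c" using w_bounds[of n] c by arith
    qed
    \<comment> \<open>For the identity the ranks at \<open>(Suc k, k)\<close> vanish, so
      \<open>v\<close> has no value below the diagonal, and no row below \<open>c\<close> is used
      before column \<open>c\<close>.\<close>
    have v_le: "v k \<le> k" if k: "1 \<le> k" "k \<le> n" for k
    proof -
      have "rk w (Suc k) k = 0" unfolding rk_def using id k by auto
      then have "rk v (Suc k) k = 0" using le[of "Suc k" k] k by simp
      then have "{j \<in> {1..k}. Suc k \<le> v j} = {}" by (simp add: rk_def)
      moreover have "k \<in> {1..k}" using k by simp
      ultimately have "\<not> Suc k \<le> v k" by blast
      then show ?thesis by simp
    qed
    show ?thesis unfolding unhit_def
    proof (intro sum_mono card_mono)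
      fix c assume c: "c \<in> {0<..n}"
      have "a \<notin> v ` {0<..<c}" if "c < a" for a
      proof
        assume "a \<in> v ` {0<..<c}"
        then obtain k where "k \<in> {0<..<c}" "a = v k" by blast
        then show False using v_le[of k] that c by auto
      qed
      then show "{a \<in> {1..n}. w c < a \<and> a \<notin> w ` {0<..<c}} \<subseteq> {a \<in> {1..n}. v c < a \<and> a \<notin> v ` {0<..<c}}"
        using id[of c] v_le[of c] c by auto
    qed auto
  qed
qed

theorem (in permutation) card_diagram_le_unhit:
  assumes "pivoting {1..n} 0 n E (rk w) v"
  shows "card D \<le> unhit {1..n} 0 n v"
  unfolding card_diagram
proof (rule unhit_le_of_rk_le[OF perm])
  have ivl: "{0<..b} = {1..b}" for b :: nat by auto
  have v: "v ` {0<..n} \<subseteq> insert 0 {1..n}" "inj_on v {c \<in> {0<..n}. v c \<noteq> 0}"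
    using pivoting_image[OF assms] pivoting_inj_on[OF assms] .
  then show "v ` {0<..n} \<subseteq> insert 0 {1..n}" "inj_on v {c \<in> {0<..n}. v c \<noteq> 0}" by simp_all
  fix a b :: nat assume "1 \<le> a" "b \<le> n"
  then show "rk v a b \<le> rk w a b"
  proof (rule rk_le_of_essential[rotated 3])
    show "rk v p q \<le> rk w p q" if "(p, q) \<in> E" for p q
      using pivotingD[OF assms that] unfolding rk_def[of v] ivl .
    show "v k \<le> n" if "1 \<le> k" "k \<le> n" for k
    proof -
      have "v k \<in> insert 0 {1..n}" using v(1) that by (intro subsetD[OF v(1)] imageI) simp
      then show ?thesis by auto
    qed
    show "inj_on v {k \<in> {1..n}. v k \<noteq> 0}" using v(2) unfolding ivl .
  qed
qed

section \<open>Minors of products\<close>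

text \<open>Columns are functions of the row index, so that a single one can be replaced by a linear
  combination.\<close>

definition cminor :: "'i list \<Rightarrow> ('i \<Rightarrow> 'a::comm_ring_1) list \<Rightarrow> 'a" where
  "cminor rs fs = det (mat (length rs) (length fs) (\<lambda>(i, j). (fs ! j) (rs ! i)))"

lemma lminor_cminor: "lminor Y rs cs = cminor rs (map (\<lambda>c r. Y r c) cs)"
proof -
  have "mat (length rs) (length cs) (\<lambda>(i, j). Y (rs ! i) (cs ! j)) =
      mat (length rs) (length (map (\<lambda>c r. Y r c) cs)) (\<lambda>(i, j). (map (\<lambda>c r. Y r c) cs ! j) (rs ! i))"
    by (rule eq_matI) auto
  then show ?thesis by (simp only: lminor_def cminor_def)
qed

lemma cminor_linear:
  assumes len: "length rs = length xs + Suc (length ys)"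
  shows "cminor rs (xs @ (\<lambda>r. \<Sum>l \<in> S. u l * g l r) # ys) = (\<Sum>l \<in> S. u l * cminor rs (xs @ g l # ys))"
proof -
  let ?n = "length rs" and ?k = "length xs"
  let ?M = "\<lambda>f. mat ?n ?n (\<lambda>(i, j). ((xs @ f # ys) ! j) (rs ! i))"
  have cof: "cofactor (?M f) i ?k = cofactor (?M h) i ?k" if "i < ?n" for f h i
  proof -
    have "mat_delete (?M f) i ?k = mat_delete (?M h) i ?k"
      using len that by (intro eq_matI) (auto simp: mat_delete_def nth_append)
    then show ?thesis by (simp add: cofactor_def)
  qed
  have det: "cminor rs (xs @ f # ys) = (\<Sum>i<?n. f (rs ! i) * cofactor (?M h) i ?k)" for f h
  proof -
    have "cminor rs (xs @ f # ys) = det (?M f)" using len by (simp add: cminor_def)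
    also have "\<dots> = (\<Sum>i<?n. ?M f $$ (i, ?k) * cofactor (?M f) i ?k)"
      by (rule laplace_expansion_column) (use len in auto)
    also have "\<dots> = (\<Sum>i<?n. f (rs ! i) * cofactor (?M h) i ?k)"
      using len cof[of _ f h] by (intro sum.cong) auto
    finally show ?thesis .
  qed
  have "cminor rs (xs @ (\<lambda>r. \<Sum>l \<in> S. u l * g l r) # ys)
      = (\<Sum>i<?n. \<Sum>l \<in> S. u l * (g l (rs ! i) * cofactor (?M (\<lambda>_. 0)) i ?k))"
    unfolding det[of _ "\<lambda>_. 0"] by (simp add: sum_distrib_right mult.assoc)
  also have "\<dots> = (\<Sum>l \<in> S. \<Sum>i<?n. u l * (g l (rs ! i) * cofactor (?M (\<lambda>_. 0)) i ?k))"
    by (rule sum.swap)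
  also have "\<dots> = (\<Sum>l \<in> S. u l * cminor rs (xs @ g l # ys))"
    unfolding det[of _ "\<lambda>_. 0"] by (simp add: sum_distrib_left)
  finally show ?thesis .
qed

text \<open>The part of the Cauchy-Binet formula that is needed. The columns of the product are
  expanded one after another, with \<open>ls\<close> recording the columns of \<open>X\<close>
  chosen so far; they need not be sorted or distinct.\<close>

lemma lminor_mult_mem_span:
  assumes "length rs = length cs"
    and "\<And>ls. length ls = length cs \<Longrightarrow> set ls \<subseteq> S \<Longrightarrow> lminor X rs ls \<in> rid.span G"
  shows "lminor (\<lambda>r c. \<Sum>l \<in> S. X r l * U l c) rs cs \<in> rid.span G"
proof -
  let ?p = "\<lambda>l r. X r l" and ?m = "\<lambda>c r. \<Sum>l \<in> S. X r l * U l c"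
  have "cminor rs (map ?p ls @ map ?m ds) \<in> rid.span G"
    if "length ls + length ds = length cs" "set ls \<subseteq> S" for ls ds
    using that
  proof (induction ds arbitrary: ls)
    case Nil
    then show ?case using assms(2)[of ls] by (simp add: lminor_cminor)
  next
    case (Cons d ds)
    have "cminor rs (map ?p ls @ ?m d # map ?m ds) =
        cminor rs (map ?p ls @ (\<lambda>r. \<Sum>l \<in> S. U l d * ?p l r) # map ?m ds)"
      by (simp only: mult.commute)
    also have "\<dots> = (\<Sum>l \<in> S. U l d * cminor rs (map ?p ls @ ?p l # map ?m ds))"
      by (rule cminor_linear) (use Cons.prems(1) assms(1) in simp)
    also have "\<dots> \<in> rid.span G"
    proof (intro rid.span_sum span_mult_left)
      fix l assume "l \<in> S"
      then have "cminor rs (map ?p (ls @ [l]) @ map ?m ds) \<in> rid.span G"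
        using Cons.prems by (intro Cons.IH) auto
      then show "cminor rs (map ?p ls @ ?p l # map ?m ds) \<in> rid.span G" by simp
    qed
    finally show ?case by simp
  qed
  from this[of "[]" cs] show ?thesis by (simp add: lminor_cminor)
qed

lemma comm_ring_hom_psubst: "comm_ring_hom (psubst g)"
  by unfold_locales (auto simp: psubst_add psubst_mult)

lemma psubst_lminor: "psubst g (lminor Y rs cs) = lminor (\<lambda>a b. psubst g (Y a b)) rs cs"
proof -
  interpret comm_ring_hom "psubst g" by (rule comm_ring_hom_psubst)
  have "map_mat (psubst g) (mat (length rs) (length cs) (\<lambda>(i, j). Y (rs ! i) (cs ! j))) =
      mat (length rs) (length cs) (\<lambda>(i, j). psubst g (Y (rs ! i) (cs ! j)))"
    by (rule eq_matI) auto
  then show ?thesis by (simp add: lminor_def flip: hom_det)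
qed

lemma pvars_mult_subset: "pvars f \<subseteq> V \<Longrightarrow> pvars g \<subseteq> V \<Longrightarrow> pvars (f * g) \<subseteq> V"
  using pvars_mult[of f g] by auto

lemma pvars_diff_subset: "pvars f \<subseteq> V \<Longrightarrow> pvars g \<subseteq> V \<Longrightarrow> pvars (f - g) \<subseteq> V"
  using pvars_diff[of f g] by auto

section \<open>From generic matrices to unitriangular ones\<close>

text \<open>Doolittle's LU decomposition of a generic matrix \<open>Z\<close>. The variable \<open>(2 * j + 1, 0)\<close> is the
  inverse of the pivot \<open>lu j j\<close>.\<close>

definition Z_entry :: "nat \<Rightarrow> nat \<Rightarrow> (nat \<times> nat) cpoly" where
  "Z_entry a b = pvar (2 * a + 1, b)"

text \<open>Both factors in one function: the upper triangular one for \<open>i \<le> j\<close>, the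
  strict part of the lower unitriangular one for \<open>i > j\<close>, which \<open>lu_lower\<close>
  completes.\<close>

function lu :: "nat \<Rightarrow> nat \<Rightarrow> (nat \<times> nat) cpoly" where
  "lu i j = (if i \<le> j then 1 else pvar (2 * j + 1, 0)) *
     (Z_entry i j - (\<Sum>l \<in> {1..<min i j}. lu i l * lu l j))"
  by pat_completeness auto
termination by (relation "measure (\<lambda>(i, j). i + j)") auto

declare lu.simps [simp del]

lemma pvars_lu:
  assumes "1 \<le> j"
  shows "pvars (lu i j) \<subseteq> {(a, b). b \<noteq> 0} \<union> {(2 * l + 1, 0) | l. l < i \<and> l \<le> j}"
  using assms
proof (induction i j rule: lu.induct)
  case (1 i j)
  let ?V = "{(a, b). b \<noteq> 0} \<union> {(2 * l + 1, 0) | l. l < i \<and> l \<le> j}"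
  have "pvars (lu i l * lu l j) \<subseteq> ?V" if l: "l \<in> {1..<min i j}" for l
  proof -
    have "pvars (lu i l) \<subseteq> ?V" using 1(1)[OF l] l by fastforce
    moreover have "pvars (lu l j) \<subseteq> ?V" using 1(2)[OF l] 1(3) l by fastforce
    ultimately show ?thesis by (intro pvars_mult_subset) auto
  qed
  then have "pvars (\<Sum>l \<in> {1..<min i j}. lu i l * lu l j) \<subseteq> ?V"
    by (intro subset_trans[OF pvars_sum] UN_least)
  moreover have "pvars (Z_entry i j) \<subseteq> ?V" using 1(3) by (simp add: Z_entry_def)
  ultimately have d: "pvars (Z_entry i j - (\<Sum>l \<in> {1..<min i j}. lu i l * lu l j)) \<subseteq> ?V"
    by (intro pvars_diff_subset)
  have "pvars (if i \<le> j then 1 else pvar (2 * j + 1, 0)) \<subseteq> ?V" by auto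
  then show ?case unfolding lu.simps[of i j] using d by (intro pvars_mult_subset)
qed

definition lu_lower :: "nat \<Rightarrow> nat \<Rightarrow> (nat \<times> nat) cpoly" where
  "lu_lower a b = (if b < a then lu a b else if a = b then 1 else 0)"

definition lu_inverses :: "nat \<Rightarrow> (nat \<times> nat) cpoly set" where
  "lu_inverses m = (\<lambda>j. pvar (2 * j + 1, 0) * lu j j - 1) ` {1..m}"

text \<open>On and above the diagonal the recursion makes this an equality. Below it the difference
  is a multiple of \<open>pvar (2 * b + 1, 0) * lu b b - 1\<close>.\<close>

lemma lu_decomposition:
  assumes "1 \<le> a" "1 \<le> b" "b \<le> m"
  shows "cong_mod (Z_entry a b) (\<Sum>l \<in> {1..b}. lu_lower a l * lu l b) (lu_inverses m)"
proof (cases "a \<le> b")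
  case True
  have "(\<Sum>l \<in> {1..b}. lu_lower a l * lu l b) = (\<Sum>l \<in> insert a {1..<a}. lu_lower a l * lu l b)"
    using True assms by (intro sum.mono_neutral_right) (auto simp: lu_lower_def)
  also have "\<dots> = lu a b + (\<Sum>l \<in> {1..<a}. lu a l * lu l b)" by (simp add: lu_lower_def)
  also have "\<dots> = Z_entry a b" using True by (subst lu.simps) (simp add: min_def)
  finally show ?thesis by simp
next
  case False
  let ?d = "Z_entry a b - (\<Sum>l \<in> {1..<b}. lu a l * lu l b)"
  have "{1..b} = insert b {1..<b}" using assms by auto
  then have "(\<Sum>l \<in> {1..b}. lu_lower a l * lu l b) = lu a b * lu b b + (\<Sum>l \<in> {1..<b}. lu a l * lu l b)"
    using False by (simp add: lu_lower_def)
  also have "lu a b = pvar (2 * b + 1, 0) * ?d" using False by (subst lu.simps) (simp add: min_def)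
  finally have "Z_entry a b - (\<Sum>l \<in> {1..b}. lu_lower a l * lu l b)
      = (- ?d) * (pvar (2 * b + 1, 0) * lu b b - 1)"
    by (simp add: algebra_simps)
  also have "\<dots> \<in> rid.span (lu_inverses m)"
    using assms by (intro span_mult_left rid.span_base) (auto simp: lu_inverses_def)
  finally show ?thesis by (simp only: cong_mod_def)
qed

definition rank_minors :: "nat \<Rightarrow> (nat \<times> nat) set \<Rightarrow> (nat \<Rightarrow> nat \<Rightarrow> nat) \<Rightarrow> (nat \<Rightarrow> nat \<Rightarrow> 'a::comm_ring_1) \<Rightarrow> 'a set" where
  "rank_minors n P \<rho> Y = {lminor Y rs cs | rs cs. \<exists>(a, b) \<in> P. set rs \<subseteq> {a..n} \<and> set cs \<subseteq> {1..b} \<and>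
     length rs = \<rho> a b + 1 \<and> length cs = \<rho> a b + 1}"

lemma rank_minorsI:
  "(a, b) \<in> P \<Longrightarrow> set rs \<subseteq> {a..n} \<Longrightarrow> set cs \<subseteq> {1..b} \<Longrightarrow> length rs = \<rho> a b + 1 \<Longrightarrow> length cs = \<rho> a b + 1
   \<Longrightarrow> lminor Y rs cs \<in> rank_minors n P \<rho> Y"
  unfolding rank_minors_def by blast

lemma finite_rank_minors:
  assumes "finite P" shows "finite (rank_minors n P \<rho> Y)"
proof -
  have "rank_minors n P \<rho> Y \<subseteq> (\<Union>(a, b) \<in> P. case_prod (lminor Y) `
      ({rs. set rs \<subseteq> {a..n} \<and> length rs = \<rho> a b + 1} \<times> {cs. set cs \<subseteq> {1..b} \<and> length cs = \<rho> a b + 1}))"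
    unfolding rank_minors_def by fastforce
  moreover have "finite (\<Union>(a, b) \<in> P. case_prod (lminor Y) `
      ({rs. set rs \<subseteq> {a..n} \<and> length rs = \<rho> a b + 1} \<times> {cs. set cs \<subseteq> {1..b} \<and> length cs = \<rho> a b + 1}))"
    using assms by (intro finite_UN_I) (auto intro!: finite_imageI finite_cartesian_product finite_lists_length_eq)
  ultimately show ?thesis by (rule finite_subset)
qed

lemma pvars_det: "A \<in> carrier_mat k k \<Longrightarrow> (\<And>i j. i < k \<Longrightarrow> j < k \<Longrightarrow> pvars (A $$ (i, j)) \<subseteq> V) \<Longrightarrow> pvars (det A) \<subseteq> V"
proof -
  assume A: "A \<in> carrier_mat k k" and V: "\<And>i j. i < k \<Longrightarrow> j < k \<Longrightarrow> pvars (A $$ (i, j)) \<subseteq> V"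
  have "pvars (signof p * (\<Prod>i = 0..<k. A $$ (i, p i))) \<subseteq> V" if "p permutes {0..<k}" for p
  proof -
    have "pvars (\<Prod>i = 0..<k. A $$ (i, p i)) \<subseteq> V"
    proof (intro subset_trans[OF pvars_prod] UN_least V)
      fix i assume "i \<in> {0..<k}"
      then show "p i < k" using permutes_in_image[OF that, of i] by simp
    qed simp
    moreover have "pvars (signof p :: 'a cpoly) = {}" by (simp add: sign_def)
    ultimately show ?thesis by (intro pvars_mult_subset) auto
  qed
  then show ?thesis unfolding det_def'[OF A]
    by (intro subset_trans[OF pvars_sum] UN_least) auto
qed

lemma pvars_lminor:
  assumes "length rs = length cs" "\<And>r c. r \<in> set rs \<Longrightarrow> c \<in> set cs \<Longrightarrow> pvars (Y r c) \<subseteq> V"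
  shows "pvars (lminor Y rs cs) \<subseteq> V"
  unfolding lminor_def by (rule pvars_det[where k = "length cs"]) (use assms in auto)

context permutation
begin

lemma finite_essential: "finite E"
  by (rule finite_subset[OF _ finite_diagram]) (auto simp: essential_set_def)

lemma essential_bounds: "(p, q) \<in> E \<Longrightarrow> 1 \<le> p \<and> p \<le> n \<and> 1 \<le> q \<and> q \<le> n"
  by (auto simp: essential_set_def diagram_def)

lemma grade_generic: "grade_ge (card D) {} (rank_minors n E (rk w) Z_entry)"
proof (rule grade_ge_rank_conditions[where A = "{1..n}" and j = 0 and n = n and P = E and \<rho> = "rk w"
      and s = "\<lambda>_ _. 0" and \<phi> = "\<lambda>a b. (2 * a + 1, b)"])
  fix a b rs cs
  assume "(a, b) \<in> E" "set rs \<subseteq> {x \<in> {1..n}. a \<le> x}" "set cs \<subseteq> {0<..b}"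
    "length rs = rk w a b + 1" "length cs = rk w a b + 1"
  then have "lminor Z_entry rs cs \<in> rank_minors n E (rk w) Z_entry"
    by (intro rank_minorsI) auto
  then show "lminor (\<lambda>a b. pvar (2 * a + 1, b) + 0) rs cs \<in> rid.span ({} \<union> rank_minors n E (rk w) Z_entry)"
    by (simp add: Z_entry_def[abs_def] rid.span_base)
qed (use finite_rank_minors[OF finite_essential] essential_bounds card_diagram_le_unhit in
    \<open>auto simp: inj_on_def\<close>)

lemma grade_generic_localized: "grade_ge (card D) (lu_inverses m) (rank_minors n E (rk w) Z_entry)"
proof (induction m)
  case 0
  then show ?case using grade_generic by (simp add: lu_inverses_def)
next
  case (Suc m)
  let ?t = "(2 * Suc m + 1, 0)"
  have "?t \<notin> pvars y" if y: "y \<in> insert (lu (Suc m) (Suc m)) (lu_inverses m \<union> rank_minors n E (rk w) Z_entry)" for y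
  proof -
    have lu: "?t \<notin> pvars (lu j j)" if "1 \<le> j" "j \<le> Suc m" for j
      using pvars_lu[of j j] that by auto
    consider "y = lu (Suc m) (Suc m)" | j where "j \<in> {1..m}" "y = pvar (2 * j + 1, 0) * lu j j - 1"
      | "y \<in> rank_minors n E (rk w) Z_entry"
      using y by (auto simp: lu_inverses_def)
    then show ?thesis
    proof cases
      case 2
      then show ?thesis using lu[of j] pvars_diff[of "pvar (2 * j + 1, 0) * lu j j" 1]
        pvars_mult[of "pvar (2 * j + 1, 0)" "lu j j"] by auto
    next
      case 3
      then obtain rs cs a b where "y = lminor Z_entry rs cs" "set cs \<subseteq> {1..b}" "length rs = length cs"
        unfolding rank_minors_def by auto
      moreover have "pvars (lminor Z_entry rs cs) \<subseteq> {(a, b). b \<noteq> 0}"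
        by (rule pvars_lminor) (use calculation in \<open>auto simp: Z_entry_def\<close>)
      ultimately have "pvars y \<subseteq> {(a, b). b \<noteq> 0}" by simp
      then show ?thesis by auto
    qed (use lu in simp)
  qed
  then have "grade_ge (card D) (insert (pvar ?t * lu (Suc m) (Suc m) - 1) (lu_inverses m))
      (rank_minors n E (rk w) Z_entry)"
    using finite_rank_minors[OF finite_essential] Suc.IH
    by (intro grade_ge_localize) (auto simp: lu_inverses_def)
  moreover have "{1..Suc m} = insert (Suc m) {1..m}" by auto
  ultimately show ?case by (simp add: lu_inverses_def)
qed

text \<open>\<open>?\<sigma>\<close> sends \<open>M\<close> to the lower factor of the generic
  matrix; \<open>?\<tau>\<close> specializes the generic matrix to \<open>M\<close> and the inverse
  pivots to 1, which turns the lower factor back into \<open>M\<close>. Odd first indices belong to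
  the generic matrix and its pivots; even ones receive the variables that do not occur in
  \<open>M\<close>.\<close>

theorem grade_unitriangular: "grade_ge (card D) {} (rank_minors n E (rk w) M_entry)"
proof -
  let ?\<sigma> = "\<lambda>(a, b). if 1 \<le> b \<and> b < a \<and> a \<le> n then lu a b else pvar (2 * a, b)"
  let ?\<tau> = "\<lambda>(x, b). if even x then pvar (x div 2, b) else if b = 0 then 1 else M_entry (x div 2) b"
  let ?B = "rank_minors n E (rk w) M_entry" and ?G = "lu_inverses n"
  have \<tau>_lu: "psubst ?\<tau> (lu i j) = M_entry i j" if "1 \<le> i" "1 \<le> j" for i j
    using that
  proof (induction i j rule: lu.induct)
    case (1 i j)
    have "psubst ?\<tau> (lu i l * lu l j) = 0" if l: "l \<in> {1..<min i j}" for l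
      using 1(2)[OF l] l 1(3,4) by (simp add: psubst_mult M_entry_def)
    then have "(\<Sum>l \<in> {1..<min i j}. psubst ?\<tau> (lu i l * lu l j)) = 0" by (rule sum.neutral[OF ballI])
    then show ?case
      using 1(3,4) by (subst lu.simps) (simp add: psubst_mult psubst_diff psubst_sum Z_entry_def)
  qed
  have \<sigma>_M: "psubst ?\<sigma> (M_entry a b) = lu_lower a b" if "1 \<le> b" "a \<le> n" for a b
    using that by (simp add: M_entry_def lu_lower_def)
  show ?thesis
  proof (rule grade_ge_descent[where G = ?G and \<sigma> = ?\<sigma> and \<tau> = ?\<tau>])
    show "grade_ge (card D) ?G (psubst ?\<sigma> ` ?B)"
    proof (rule grade_ge_mono[OF grade_generic_localized], rule subsetI)
      let ?S = "?G \<union> psubst ?\<sigma> ` ?B"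
      fix y assume "y \<in> rank_minors n E (rk w) Z_entry"
      then obtain rs cs a b where y: "y = lminor Z_entry rs cs" "(a, b) \<in> E" "set rs \<subseteq> {a..n}" "set cs \<subseteq> {1..b}"
        "length rs = rk w a b + 1" "length cs = rk w a b + 1"
        unfolding rank_minors_def by auto
      have ab: "1 \<le> a" "b \<le> n" using essential_bounds[OF y(2)] by auto
      \<comment> \<open>The upper factor multiplies from the right, so minors of the generic matrix
        are combinations of minors of the lower factor with the same rows. Triangularity keeps the
        columns within \<open>{1..b}\<close>.\<close>
      let ?U = "\<lambda>l c. if l \<le> c then lu l c else 0"
      have "cong_mod (lminor Z_entry rs cs) (lminor (\<lambda>r c. \<Sum>l \<in> {1..b}. lu_lower r l * ?U l c) rs cs) ?S"
      proof (rule lminor_cong_mod)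
        fix r c assume "r \<in> set rs" "c \<in> set cs"
        then have rc: "1 \<le> r" "1 \<le> c" "c \<le> b" using y(3,4) ab by auto
        have "(\<Sum>l \<in> {1..b}. lu_lower r l * ?U l c) = (\<Sum>l \<in> {1..c}. lu_lower r l * lu l c)"
          using rc by (intro sum.mono_neutral_cong_right) auto
        moreover have "cong_mod (Z_entry r c) (\<Sum>l \<in> {1..c}. lu_lower r l * lu l c) ?G"
          using rc ab by (intro lu_decomposition) auto
        ultimately show "cong_mod (Z_entry r c) (\<Sum>l \<in> {1..b}. lu_lower r l * ?U l c) ?S"
          using cong_mod_mono[OF _ rid.span_mono[of ?G ?S]] by simp
      qed (use y in simp)
      moreover have "lminor (\<lambda>r c. \<Sum>l \<in> {1..b}. lu_lower r l * ?U l c) rs cs \<in> rid.span ?S"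
      proof (rule lminor_mult_mem_span)
        fix ls assume ls: "length ls = length cs" "set ls \<subseteq> {1..b}"
        have "psubst ?\<sigma> (lminor M_entry rs ls) = lminor lu_lower rs ls"
        proof -
          have "mat (length rs) (length ls) (\<lambda>(i, j). psubst ?\<sigma> (M_entry (rs ! i) (ls ! j))) =
              mat (length rs) (length ls) (\<lambda>(i, j). lu_lower (rs ! i) (ls ! j))"
          proof (rule eq_matI)
            fix i j assume ij: "i < dim_row (mat (length rs) (length ls) (\<lambda>(i, j). lu_lower (rs ! i) (ls ! j)))"
              "j < dim_col (mat (length rs) (length ls) (\<lambda>(i, j). lu_lower (rs ! i) (ls ! j)))"
            then have "rs ! i \<in> set rs" "ls ! j \<in> set ls" by auto
            then have "1 \<le> ls ! j" "rs ! i \<le> n" using ls(2) y(3) by auto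
            then have "psubst ?\<sigma> (M_entry (rs ! i) (ls ! j)) = lu_lower (rs ! i) (ls ! j)" by (rule \<sigma>_M)
            then show "mat (length rs) (length ls) (\<lambda>(i, j). psubst ?\<sigma> (M_entry (rs ! i) (ls ! j))) $$ (i, j) =
              mat (length rs) (length ls) (\<lambda>(i, j). lu_lower (rs ! i) (ls ! j)) $$ (i, j)"
              using ij by simp
          qed auto
          then show ?thesis by (subst psubst_lminor) (simp only: lminor_def)
        qed
        moreover have "lminor M_entry rs ls \<in> ?B"
          using y ls by (intro rank_minorsI[of a b]) auto
        ultimately have "lminor lu_lower rs ls \<in> psubst ?\<sigma> ` ?B" by force
        then show "lminor lu_lower rs ls \<in> rid.span ?S" by (intro rid.span_base) simp
      qed (use y in simp)
      ultimately show "y \<in> rid.span ?S" using cong_mod_mem y(1) by blast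
    qed
    show "psubst ?\<tau> (case v of (a, b) \<Rightarrow> if 1 \<le> b \<and> b < a \<and> a \<le> n then lu a b else pvar (2 * a, b)) = pvar v" for v
      using \<tau>_lu by (cases v) (auto simp: M_entry_def)
    show "psubst ?\<tau> g \<in> rid.span {}" if "g \<in> ?G" for g
      using that \<tau>_lu by (auto simp: lu_inverses_def psubst_diff psubst_mult M_entry_def)
    \<comment> \<open>The variables \<open>(0, b)\<close> do not occur in \<open>M\<close> and are
      mapped to themselves.\<close>
    show "\<exists>u u'. ?\<sigma> u = pvar u' \<and> u \<notin> U \<and> u' \<notin> U'" if "finite U" "finite U'" for U U'
    proof -
      have "finite (snd ` (U \<union> U'))" using that by simp
      then obtain b where "b \<notin> snd ` (U \<union> U')"
        using ex_new_if_finite[OF infinite_UNIV_nat] by blast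
      then have "?\<sigma> (0, b) = pvar (0, b) \<and> (0, b) \<notin> U \<and> (0, b) \<notin> U'" by force
      then show ?thesis by blast
    qed
  qed (use finite_rank_minors[OF finite_essential] in \<open>auto simp: lu_inverses_def\<close>)
qed

end

section \<open>Combinatorics of inclusion conditions and the entries of the inverse matrix\<close>

section \<open>Permutations defined by inclusions\<close>

text \<open>For positive \<open>x\<close>, \<open>pmax u y < x\<close> means that the first
  \<open>y\<close> columns have no value in row \<open>x\<close> or below. For \<open>w\<close> this
  describes entries of \<open>M\<close> that lie in the ideal, for \<open>wi\<close> entries of the
  inverse matrix.\<close>

definition pmax :: "(nat \<Rightarrow> nat) \<Rightarrow> nat \<Rightarrow> nat" where
  "pmax u y = Max (insert 0 (u ` {1..y}))"

lemma pmax_ge: "1 \<le> k \<Longrightarrow> k \<le> y \<Longrightarrow> u k \<le> pmax u y"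
  unfolding pmax_def by (intro Max_ge) auto

lemma pmax_less_iff: "0 < x \<Longrightarrow> pmax u y < x \<longleftrightarrow> (\<forall>k. 1 \<le> k \<longrightarrow> k \<le> y \<longrightarrow> u k < x)"
  unfolding pmax_def by (subst Max_less_iff) auto

lemma pmax_mono: "y \<le> y' \<Longrightarrow> pmax u y \<le> pmax u y'"
  unfolding pmax_def by (intro Max_mono) auto

lemma pmax_attained:
  assumes "0 < pmax u y" obtains k where "1 \<le> k" "k \<le> y" "u k = pmax u y"
proof -
  have "pmax u y \<in> insert 0 (u ` {1..y})" unfolding pmax_def by (intro Max_in) auto
  then show ?thesis using assms that by auto
qed

lemma pmax_ge_self:
  assumes "inj u" "\<And>k. 1 \<le> k \<Longrightarrow> k \<le> y \<Longrightarrow> 1 \<le> u k" shows "y \<le> pmax u y"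
proof -
  have "u ` {1..y} \<subseteq> {1..pmax u y}" using assms(2) pmax_ge by fastforce
  then have "card (u ` {1..y}) \<le> card {1..pmax u y}" by (rule card_mono[rotated]) simp
  moreover have "card (u ` {1..y}) = y"
    using card_image[of u "{1..y}"] inj_on_subset[OF assms(1)] by simp
  ultimately show ?thesis by simp
qed

context permutation
begin

lemma inj_w: "inj w" and inj_wi: "inj wi"
  using permutes_inj[OF perm] permutes_inj[OF wi_perm] by auto

lemma w_pos: "1 \<le> k \<Longrightarrow> 1 \<le> w k"
  using w_in[of k] permutes_not_in[OF perm, of k] by (cases "k \<le> n") auto

lemma wi_pos: "1 \<le> k \<Longrightarrow> 1 \<le> wi k"
  using wi_in[of k] permutes_not_in[OF wi_perm, of k] by (cases "k \<le> n") auto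

lemma pmax_w_ge: "y \<le> pmax w y" and pmax_wi_ge: "y \<le> pmax wi y"
  using pmax_ge_self[OF inj_w w_pos] pmax_ge_self[OF inj_wi wi_pos] by blast+

lemma rk_rows: "b \<le> n \<Longrightarrow> 1 \<le> a \<Longrightarrow> rk w a b = card {x \<in> {a..n}. wi x \<le> b}"
proof -
  assume b: "b \<le> n" and a: "1 \<le> a"
  have "{x \<in> {a..n}. wi x \<le> b} = w ` {k \<in> {1..b}. a \<le> w k}"
  proof (intro equalityI subsetI)
    fix x assume x: "x \<in> {x \<in> {a..n}. wi x \<le> b}"
    then have "x = w (wi x)" "1 \<le> wi x" using a wi_bounds[of x] by auto
    then show "x \<in> w ` {k \<in> {1..b}. a \<le> w k}" using x by (intro image_eqI[of _ _ "wi x"]) auto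
  qed (use b w_bounds in auto)
  then have "card {x \<in> {a..n}. wi x \<le> b} = card (w ` {k \<in> {1..b}. a \<le> w k})" by (rule arg_cong)
  also have "\<dots> = card {k \<in> {1..b}. a \<le> w k}" by (intro card_image inj_on_subset[OF inj_w]) simp
  finally show ?thesis by (simp only: rk_def)
qed

lemma rk_eq_0_iff: "rk w p q = 0 \<longleftrightarrow> (\<forall>k. 1 \<le> k \<longrightarrow> k \<le> q \<longrightarrow> w k < p)"
proof -
  have "rk w p q = 0 \<longleftrightarrow> {k \<in> {1..q}. p \<le> w k} = {}" by (simp add: rk_def)
  also have "\<dots> \<longleftrightarrow> (\<forall>k. 1 \<le> k \<longrightarrow> k \<le> q \<longrightarrow> w k < p)" unfolding not_le[symmetric] by force
  finally show ?thesis .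
qed

lemma rk_0_iff_pmax: "0 < p \<Longrightarrow> rk w p q = 0 \<longleftrightarrow> pmax w q < p"
  by (simp add: rk_eq_0_iff pmax_less_iff)

lemma rk_less_col:
  assumes "(x, y) \<in> D" shows "rk w x y < y" and "x + rk w x y \<le> n"
proof -
  have xy: "1 \<le> x" "x \<le> n" "1 \<le> y" "y \<le> n" "w y < x" "y < wi x" using assms by (auto simp: diagram_iff)
  have "{k \<in> {1..y}. x \<le> w k} \<subseteq> {1..<y}" using xy(5) by (auto simp: le_less)
  then have "rk w x y \<le> card {1..<y}" unfolding rk_def by (intro card_mono) auto
  then show "rk w x y < y" using xy by simp
  have "{z \<in> {x..n}. wi z \<le> y} \<subseteq> {x<..n}" using xy(6) by (auto simp: le_less)
  then have "rk w x y \<le> card {x<..n}" unfolding rk_rows[OF xy(4,1)] by (intro card_mono) auto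
  then show "x + rk w x y \<le> n" using xy by simp
qed

end

locale inclusion_permutation = permutation +
  assumes inclusions: "defined_by_inclusions n w"
begin

text \<open>A positive rank excludes the value \<open>q\<close> of the minimum, so
  \<open>q - r = p - 1\<close>.\<close>

lemma rk_essential:
  assumes "(p, q) \<in> E" "0 < rk w p q" shows "rk w p q + p = q + 1"
proof -
  have "int q - int (rk w p q) = min (int p - 1) (int q)"
    using inclusions assms by (auto simp: defined_by_inclusions_def)
  then show ?thesis using assms(2) by (auto simp: min_def split: if_splits)
qed

text \<open>Of the first \<open>q\<close> columns, \<open>q - r = p - 1\<close> have their value
  above row \<open>p\<close>; by injectivity these values fill all rows above
  \<open>p\<close>.\<close>

lemma rows_above_essential:
  assumes "(p, q) \<in> E" "0 < rk w p q" shows "pmax wi (p - 1) \<le> q"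
proof -
  have b: "1 \<le> p" "p \<le> n" "1 \<le> q" "q \<le> n" using essential_bounds[OF assms(1)] by auto
  let ?A = "{k \<in> {1..q}. w k < p}"
  have "{1..q} = {k \<in> {1..q}. p \<le> w k} \<union> ?A" by auto
  then have "card {1..q} = card ({k \<in> {1..q}. p \<le> w k} \<union> ?A)" by (rule arg_cong)
  also have "\<dots> = card {k \<in> {1..q}. p \<le> w k} + card ?A" by (rule card_Un_disjoint) auto
  finally have "q = rk w p q + card ?A" by (simp add: rk_def)
  then have "card ?A = p - 1" using rk_essential[OF assms] by simp
  moreover have "card (w ` ?A) = card ?A" by (intro card_image inj_on_subset[OF inj_w]) simp
  ultimately have "card (w ` ?A) = card {1..p - 1}" by simp
  moreover have "w ` ?A \<subseteq> {1..p - 1}"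
  proof (rule image_subsetI)
    fix k assume "k \<in> ?A"
    then show "w k \<in> {1..p - 1}" using w_pos[of k] by auto
  qed
  ultimately have eq: "w ` ?A = {1..p - 1}" by (intro card_subset_eq) auto
  have "wi k \<le> q" if k: "1 \<le> k" "k \<le> p - 1" for k
  proof -
    have "k \<in> w ` ?A" unfolding eq using k by simp
    then show ?thesis by auto
  qed
  then show ?thesis using pmax_less_iff[of "Suc q" wi "p - 1"] by (simp add: less_Suc_eq_le)
qed

lemma essential_posI: "(p, q) \<in> E \<Longrightarrow> 0 < rk w p q \<Longrightarrow> (p, q) \<in> essential_pos n w"
  by (simp add: essential_pos_def)

text \<open>Take \<open>?q = pmax wi y\<close> and the longest initial segment of rows
  \<open>1\<close> to \<open>s\<close> that \<open>wi\<close> still maps into the first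
  \<open>?q\<close> columns; the corner is \<open>(Suc s, ?q)\<close>. Rank 0 there would bound
  \<open>pmax w ?q\<close> by \<open>s\<close>, and \<open>s \<le> ?q < x\<close> contradicts the
  last assumption.\<close>

lemma essential_box:
  assumes "1 \<le> y" "x \<le> n" "pmax wi y < x" "x \<le> pmax w (pmax wi y)"
  obtains p q where "(p, q) \<in> E" "0 < rk w p q" "y < p" "q < x"
proof -
  let ?q = "pmax wi y"
  let ?S = "{s \<in> {y..n}. pmax wi s \<le> ?q}"
  have yq: "y \<le> ?q" by (rule pmax_wi_ge)
  then have "y \<in> ?S" using assms by simp
  then have "?S \<noteq> {}" by blast
  define s where "s = Max ?S"
  have s: "y \<le> s" "s \<le> n" "pmax wi s \<le> ?q"
    using Max_in[OF _ \<open>?S \<noteq> {}\<close>] unfolding s_def by auto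
  have smax: "s' \<le> s" if "s' \<in> ?S" for s' unfolding s_def using that by (intro Max_ge) auto
  have "n \<le> pmax wi n" by (rule pmax_wi_ge)
  then have "s \<noteq> n" using s assms by auto
  then have sn: "s < n" using s by simp
  obtain k where k: "1 \<le> k" "k \<le> y" "wi k = ?q" using pmax_attained[of wi y] yq assms(1) by auto
  then have wq: "w ?q = k" using w_wi[of k] by simp
  have "\<not> pmax wi (Suc s) \<le> ?q" using smax[of "Suc s"] s sn by auto
  then have "\<exists>j. 1 \<le> j \<and> j \<le> Suc s \<and> ?q < wi j"
    using pmax_less_iff[of "Suc ?q" wi "Suc s"] by (auto simp: less_Suc_eq_le not_le)
  then obtain j where j: "1 \<le> j" "j \<le> Suc s" "?q < wi j" by auto
  have above: "wi i \<le> ?q" if "1 \<le> i" "i \<le> s" for i using pmax_ge[OF that, of wi] s(3) by simp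
  have "j = Suc s" using j above[of j] by (cases "j \<le> s") auto
  then have "(Suc s, ?q) \<in> D" using j sn wq k s yq assms by (auto simp: diagram_iff)
  moreover have "(Suc s, Suc ?q) \<notin> D"
  proof
    assume d: "(Suc s, Suc ?q) \<in> D"
    then have "w (Suc ?q) \<le> s" "1 \<le> w (Suc ?q)" using w_pos by (auto simp: diagram_iff)
    then show False using above[of "w (Suc ?q)"] by simp
  qed
  moreover have "(s, ?q) \<notin> D" using above[of s] by (auto simp: diagram_iff)
  ultimately have e: "(Suc s, ?q) \<in> E" by (simp add: essential_set_def)
  have "0 < rk w (Suc s) ?q"
  proof (rule ccontr)
    assume "\<not> 0 < rk w (Suc s) ?q"
    then have "pmax w ?q < Suc s" using rk_0_iff_pmax[of "Suc s" ?q] by simp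
    moreover have "s \<le> pmax wi s" by (rule pmax_wi_ge)
    ultimately show False using s(3) assms by simp
  qed
  then show ?thesis using that e s assms by (meson le_imp_less_Suc)
qed

text \<open>The diagonal shift that relates the generators \<open>f\<close> to the entries of \<open>M\<inverse>\<close>.\<close>

lemma shifted_position_in_diagram:
  assumes E: "(p, q) \<in> E" and r: "0 < rk w p q" and box: "1 \<le> y" "y < p" "q < x" "x \<le> n"
    and min: "\<And>p' q'. (p', q') \<in> E \<Longrightarrow> 0 < rk w p' q' \<Longrightarrow> rk w p' q' < rk w p q \<Longrightarrow> \<not> (y < p' \<and> q' < x)"
    and VW: "x \<le> pmax wi (pmax w y)" and WV: "x \<le> pmax w (pmax wi y)"
  shows "(x - rk w p q, y + rk w p q) \<in> D" "rk w (x - rk w p q) (y + rk w p q) = rk w p q"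
    "p \<le> x - rk w p q" "y + rk w p q \<le> q"
proof -
  define r where "r = rk w p q"
  define X where "X = x - r"
  define Y where "Y = y + r"
  have rpq: "r + p = q + 1" using rk_essential[OF E] assms(2) by (simp add: r_def)
  have Xx: "X + r = x" and pX: "p \<le> X" and Yq: "Y \<le> q" using rpq box by (auto simp: X_def Y_def)
  have D: "1 \<le> p" "p \<le> n" "1 \<le> q" "q \<le> n" "w q < p" "q < wi p"
    using E by (auto simp: essential_set_def diagram_iff)
  have Vq: "pmax wi (p - 1) \<le> q" by (rule rows_above_essential[OF E assms(2)])
  have above: "wi i \<le> q" if "1 \<le> i" "i < p" for i
  proof -
    have "i \<le> p - 1" using that by simp
    then show ?thesis using pmax_ge[of i "p - 1" wi] that Vq by simp
  qed
  \<comment> \<open>Otherwise let \<open>t\<close> to \<open>u - 1\<close> be the first block of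
    rows from \<open>p\<close> on that are hit by the first \<open>q\<close> columns. Then
    \<open>(u, q)\<close> lies in the diagram with smaller rank. Rank 0 contradicts
    \<open>WV\<close>; positive rank leads to an essential position that contradicts
    \<open>min\<close>.\<close>
  have A: "q < wi t" if "p \<le> t" "t \<le> X" for t
  proof (rule ccontr)
    assume "\<not> q < wi t"
    then have ex: "\<exists>t. p \<le> t \<and> t \<le> X \<and> wi t \<le> q" using that by auto
    define t where "t = (LEAST t. p \<le> t \<and> t \<le> X \<and> wi t \<le> q)"
    have t: "p \<le> t" "t \<le> X" "wi t \<le> q" using LeastI_ex[OF ex] by (auto simp: t_def)
    have t_min: "q < wi s" if "p \<le> s" "s < t" for s
      using not_less_Least[of s "\<lambda>t. p \<le> t \<and> t \<le> X \<and> wi t \<le> q"] that t by (auto simp: t_def)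
    have "t \<le> i" if "p \<le> i" "wi i \<le> q" for i
      using t_min[of i] that by (cases "i < t") auto
    then have rows: "{i \<in> {p..n}. wi i \<le> q} = {i \<in> {t..n}. wi i \<le> q}" using t by auto
    \<comment> \<open>Otherwise all rows from \<open>t\<close> down are hit and
      \<open>r = Suc n - t\<close>, whereas \<open>t \<le> X = x - r \<le> n - r\<close>.\<close>
    have "\<exists>u. t < u \<and> u \<le> n \<and> q < wi u"
    proof (rule ccontr)
      assume none: "\<nexists>u. t < u \<and> u \<le> n \<and> q < wi u"
      have "wi i \<le> q" if "t \<le> i" "i \<le> n" for i
        using none t(3) that by (cases "i = t") (auto simp: not_less)
      then have "{i \<in> {t..n}. wi i \<le> q} = {t..n}" by auto
      then have "r = Suc n - t" using rk_rows[OF D(4,1)] rows by (simp add: r_def)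
      then show False using t Xx box by simp
    qed
    define u where "u = (LEAST u. t < u \<and> u \<le> n \<and> q < wi u)"
    have u: "t < u" "u \<le> n" "q < wi u"
      using LeastI_ex[OF \<open>\<exists>u. t < u \<and> u \<le> n \<and> q < wi u\<close>] by (auto simp: u_def)
    have u_min: "wi s \<le> q" if "t < s" "s < u" for s
      using not_less_Least[of s "\<lambda>u. t < u \<and> u \<le> n \<and> q < wi u"] that u by (auto simp: u_def)
    have uD: "(u, q) \<in> D" using u t D by (auto simp: diagram_iff)
    have "wi i \<le> q" if "t \<le> i" "i < u" for i
      using u_min[of i] t(3) that by (cases "i = t") auto
    then have "{i \<in> {t..n}. wi i \<le> q} = {t..<u} \<union> {i \<in> {u..n}. wi i \<le> q}"
      using t u by auto
    moreover have "card ({t..<u} \<union> {i \<in> {u..n}. wi i \<le> q}) = card {t..<u} + card {i \<in> {u..n}. wi i \<le> q}"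
      by (rule card_Un_disjoint) auto
    ultimately have ru: "r = (u - t) + rk w u q"
      using rk_rows[OF D(4,1)] rk_rows[OF D(4), of u] rows u D by (simp add: r_def)
    show False
    proof (cases "rk w u q = 0")
      case True
      then have "pmax w q < u" using rk_0_iff_pmax[of u q] u by simp
      moreover have "y \<le> p - 1" using box by simp
      then have "pmax wi y \<le> q" using pmax_mono[of y "p - 1" wi] Vq by simp
      ultimately have "pmax w (pmax wi y) < u" using pmax_mono[of "pmax wi y" q w] by simp
      then show False using WV ru True t Xx u by simp
    next
      case False
      obtain p' q' where e: "(p', q') \<in> E" "p' \<le> u" "q \<le> q'" "rk w p' q' = rk w u q"
        using uD by (rule diagram_essential)
      have pq': "rk w p' q' + p' = q' + 1" using rk_essential[OF e(1)] e(4) False by simp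
      have "q' < x" using pq' e ru u t Xx by simp
      \<comment> \<open>For \<open>p' \<le> y < p\<close> row \<open>p'\<close> is hit by the first
        \<open>q\<close> columns, which makes the rank at \<open>(p', q')\<close> exceed the one at
        \<open>(u, q)\<close>.\<close>
      moreover have "y < p'"
      proof (rule ccontr)
        assume "\<not> y < p'"
        then have "p' < p" using box by simp
        moreover have "1 \<le> p'" using essential_bounds[OF e(1)] by simp
        ultimately have "Suc (rk w (Suc p') q) \<le> rk w p' q"
          using above[of p'] wi_pos[of p'] by (intro rk_row_Suc_hit[of "wi p'"]) auto
        moreover have "rk w u q \<le> rk w (Suc p') q"
          using \<open>p' < p\<close> t u by (intro rk_antimono_row) simp
        ultimately show False using rk_mono_col[OF e(3), of w p'] e(4) by simp
      qed
      moreover have "rk w p' q' < rk w p q" using e(4) ru u unfolding r_def by linarith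
      moreover have "0 < rk w p' q'" using e(4) False by simp
      ultimately show False using min[OF e(1)] by blast
    qed
  qed
  \<comment> \<open>The mirror image for columns: \<open>v + 1\<close> to \<open>k\<close> is the
    last block of columns up to \<open>q\<close> with values in row \<open>p\<close> or below, and
    \<open>(p, v)\<close> lies in the diagram. Here rank 0 contradicts \<open>VW\<close>.\<close>
  have B: "w k < p" if "Y \<le> k" "k \<le> q" for k
  proof (rule ccontr)
    assume "\<not> w k < p"
    let ?S = "{k \<in> {Y..q}. p \<le> w k}"
    have "?S \<noteq> {}" using that \<open>\<not> w k < p\<close> by force
    define k where "k = Max ?S"
    have k: "Y \<le> k" "k \<le> q" "p \<le> w k" using Max_in[OF _ \<open>?S \<noteq> {}\<close>] unfolding k_def by auto
    have k_max: "w s < p" if "k < s" "s \<le> q" for s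
    proof (rule ccontr)
      assume "\<not> w s < p"
      then have "s \<le> k" unfolding k_def using that k by (intro Max_ge) auto
      then show False using that by simp
    qed
    have "i \<le> k" if "i \<le> q" "p \<le> w i" for i
      using k_max[of i] that by (cases "k < i") auto
    then have cols: "{i \<in> {1..q}. p \<le> w i} = {i \<in> {1..k}. p \<le> w i}"
      using k by auto
    let ?T = "{v \<in> {1..<k}. w v < p}"
    have "?T \<noteq> {}"
    proof
      assume "?T = {}"
      have "p \<le> w i" if "1 \<le> i" "i \<le> k" for i
      proof (cases "i = k")
        case False
        then have "i \<in> {1..<k}" using that by auto
        then show ?thesis using \<open>?T = {}\<close> by (metis (mono_tags, lifting) empty_iff mem_Collect_eq not_le)
      qed (use k in simp)
      then have "{i \<in> {1..k}. p \<le> w i} = {1..k}" by auto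
      then have "r = k" using cols by (simp add: r_def rk_def)
      then show False using k box by (simp add: Y_def)
    qed
    define v where "v = Max ?T"
    have v: "1 \<le> v" "v < k" "w v < p" using Max_in[OF _ \<open>?T \<noteq> {}\<close>] unfolding v_def by auto
    have v_max: "p \<le> w s" if "v < s" "s \<le> k" for s
    proof (rule ccontr)
      assume "\<not> p \<le> w s"
      then have "s \<noteq> k" "w s < p" using k by auto
      then have "s \<le> v" unfolding v_def using that v by (intro Max_ge) auto
      then show False using that by simp
    qed
    have vD: "(p, v) \<in> D" using v k D by (auto simp: diagram_iff)
    have "{i \<in> {1..k}. p \<le> w i} = {v<..k} \<union> {i \<in> {1..v}. p \<le> w i}"
      using v v_max by auto
    moreover have "card ({v<..k} \<union> {i \<in> {1..v}. p \<le> w i}) = card {v<..k} + card {i \<in> {1..v}. p \<le> w i}"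
      by (rule card_Un_disjoint) auto
    ultimately have rv: "r = (k - v) + rk w p v" using cols by (simp add: r_def rk_def)
    show False
    proof (cases "rk w p v = 0")
      case True
      then have "pmax w v < p" using rk_0_iff_pmax[of p v] D by simp
      moreover have "y \<le> v" using rv True k by (simp add: Y_def)
      ultimately have "pmax w y \<le> p - 1" using pmax_mono[of y v w] by simp
      then have "pmax wi (pmax w y) \<le> q" using pmax_mono[of "pmax w y" "p - 1" wi] Vq by simp
      then show False using VW box by simp
    next
      case False
      obtain p' q' where e: "(p', q') \<in> E" "p' \<le> p" "v \<le> q'" "rk w p' q' = rk w p v"
        using vD by (rule diagram_essential)
      have pq': "rk w p' q' + p' = q' + 1" using rk_essential[OF e(1)] e(4) False by simp
      have "y < p'" using pq' e rv v k by (simp add: Y_def)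
      moreover have "q' < x"
      proof (rule ccontr)
        assume "\<not> q' < x"
        then have "k \<le> q'" using k box by simp
        then have "rk w p k \<le> rk w p' q'" using e by (intro rk_mono) auto
        moreover have "rk w p v < rk w p k"
        proof -
          obtain k' where k': "k = Suc k'" using v by (cases k) auto
          then have "rk w p v \<le> rk w p k'" using v by (intro rk_mono_col) simp
          then show ?thesis using k by (simp add: k' rk_Suc)
        qed
        ultimately show False using e(4) by simp
      qed
      moreover have "rk w p' q' < rk w p q" using e(4) rv v unfolding r_def by linarith
      moreover have "0 < rk w p' q'" using e(4) False by simp
      ultimately show False using min[OF e(1)] by blast
    qed
  qed
  have "(X, Y) \<in> D"
    using A[of X] B[of Y] pX Yq Xx box D by (auto simp: diagram_iff Y_def)
  \<comment> \<open>By \<open>A\<close> and \<open>B\<close>, all \<open>r\<close> dots counted at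
    \<open>(p, q)\<close> lie weakly SW of \<open>(X, Y)\<close>.\<close>
  moreover have "rk w X Y = r"
  proof -
    have "{k \<in> {1..q}. p \<le> w k} = {k \<in> {1..Y}. X \<le> w k}"
    proof (intro equalityI subsetI)
      fix k assume "k \<in> {k \<in> {1..q}. p \<le> w k}"
      then have k: "1 \<le> k" "k \<le> q" "p \<le> w k" by auto
      have "k \<le> Y" using B[of k] k by (metis linorder_not_le nat_le_linear)
      moreover have "X \<le> w k" using A[of "w k"] k by (metis linorder_not_le nat_le_linear wi_w)
      ultimately show "k \<in> {k \<in> {1..Y}. X \<le> w k}" using k by auto
    qed (use pX Yq in auto)
    then show ?thesis by (simp add: r_def rk_def)
  qed
  ultimately show "(x - rk w p q, y + rk w p q) \<in> D" "rk w (x - rk w p q) (y + rk w p q) = rk w p q"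
    "p \<le> x - rk w p q" "y + rk w p q \<le> q"
    using pX Yq by (auto simp: X_def Y_def r_def)
qed

end

section \<open>The inverse of the unitriangular matrix\<close>

text \<open>Forward substitution for \<open>M N = I\<close>. The recursion of
  \<open>M_inv_left\<close> solves \<open>N M = I\<close>; by associativity both solutions agree,
  which gives both identities for one matrix.\<close>

function M_inv :: "nat \<Rightarrow> nat \<Rightarrow> (nat \<times> nat) cpoly" where
  "M_inv x y = (if x = y then 1 else if x < y then 0 else - (\<Sum>a \<in> {y..<x}. M_entry x a * M_inv a y))"
  by pat_completeness auto
termination by (relation "measure fst") auto

function M_inv_left :: "nat \<Rightarrow> nat \<Rightarrow> (nat \<times> nat) cpoly" where
  "M_inv_left x y = (if x = y then 1 else if x < y then 0 else - (\<Sum>a \<in> {y<..x}. M_inv_left x a * M_entry a y))"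
  by pat_completeness auto
termination by (relation "measure (\<lambda>(x, y). x - y)") auto

declare M_inv.simps [simp del] M_inv_left.simps [simp del]

lemma M_inv_upper [simp]: "x < y \<Longrightarrow> M_inv x y = 0"
  and M_inv_left_upper [simp]: "x < y \<Longrightarrow> M_inv_left x y = 0"
  by (auto simp: M_inv.simps M_inv_left.simps)

lemma M_entry_diag [simp]: "M_entry x x = 1" and M_entry_upper [simp]: "x < y \<Longrightarrow> M_entry x y = 0"
  by (auto simp: M_entry_def)

lemma M_mult_M_inv:
  assumes "1 \<le> x" "x \<le> n" "1 \<le> y" "y \<le> n"
  shows "(\<Sum>a \<in> {1..n}. M_entry x a * M_inv a y) = (if x = y then 1 else 0)"
proof -
  have "(\<Sum>a \<in> {1..n}. M_entry x a * M_inv a y) = (\<Sum>a \<in> {y..x}. M_entry x a * M_inv a y)"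
    using assms by (intro sum.mono_neutral_right) auto
  also have "\<dots> = (if x = y then 1 else 0)"
  proof (cases "y \<le> x")
    case True
    then have "{y..x} = insert x {y..<x}" by auto
    then show ?thesis using True by (auto simp: M_inv.simps[of x y])
  qed auto
  finally show ?thesis .
qed

lemma M_inv_left_mult_M:
  assumes "1 \<le> x" "x \<le> n" "1 \<le> y" "y \<le> n"
  shows "(\<Sum>a \<in> {1..n}. M_inv_left x a * M_entry a y) = (if x = y then 1 else 0)"
proof -
  have "(\<Sum>a \<in> {1..n}. M_inv_left x a * M_entry a y) = (\<Sum>a \<in> {y..x}. M_inv_left x a * M_entry a y)"
    using assms by (intro sum.mono_neutral_right) auto
  also have "\<dots> = (if x = y then 1 else 0)"
  proof (cases "y \<le> x")
    case True
    then have "{y..x} = insert y {y<..x}" by auto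
    then show ?thesis using True by (auto simp: M_inv_left.simps[of x y])
  qed auto
  finally show ?thesis .
qed

lemma sum_delta_right: "1 \<le> y \<Longrightarrow> y \<le> n \<Longrightarrow>
  (\<Sum>a \<in> {1..n::nat}. f a * (if a = y then 1 else 0)) = (f y :: 'a::comm_ring_1)"
  by (simp add: if_distrib[of "\<lambda>z. _ * z"] cong: if_cong)

lemma sum_delta_left: "1 \<le> x \<Longrightarrow> x \<le> n \<Longrightarrow>
  (\<Sum>a \<in> {1..n::nat}. (if x = a then 1 else 0) * f a) = (f x :: 'a::comm_ring_1)"
  by (simp add: if_distrib[of "\<lambda>z. z * _"] cong: if_cong)

lemma M_inv_left_eq:
  assumes "1 \<le> x" "x \<le> n" "1 \<le> y" "y \<le> n" shows "M_inv_left x y = M_inv x y"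
proof -
  let ?I = "{1..n}"
  have "(\<Sum>a \<in> ?I. M_inv_left x a * (\<Sum>b \<in> ?I. M_entry a b * M_inv b y))
      = (\<Sum>a \<in> ?I. M_inv_left x a * (if a = y then 1 else 0))"
    by (rule sum.cong[OF refl], subst M_mult_M_inv) (use assms in auto)
  then have "M_inv_left x y = (\<Sum>a \<in> ?I. M_inv_left x a * (\<Sum>b \<in> ?I. M_entry a b * M_inv b y))"
    using sum_delta_right[OF assms(3,4), of "M_inv_left x"] by simp
  also have "\<dots> = (\<Sum>a \<in> ?I. \<Sum>b \<in> ?I. M_inv_left x a * M_entry a b * M_inv b y)"
    by (simp only: sum_distrib_left mult.assoc)
  also have "\<dots> = (\<Sum>b \<in> ?I. \<Sum>a \<in> ?I. M_inv_left x a * M_entry a b * M_inv b y)"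
    by (rule sum.swap)
  also have "\<dots> = (\<Sum>b \<in> ?I. (\<Sum>a \<in> ?I. M_inv_left x a * M_entry a b) * M_inv b y)"
    by (simp only: sum_distrib_right)
  also have "\<dots> = (\<Sum>b \<in> ?I. (if x = b then 1 else 0) * M_inv b y)"
    by (rule sum.cong[OF refl], subst M_inv_left_mult_M) (use assms in auto)
  also have "\<dots> = M_inv x y" by (rule sum_delta_left[OF assms(1,2)])
  finally show ?thesis .
qed

lemma M_inv_mult_M:
  assumes "1 \<le> x" "x \<le> n" "1 \<le> y" "y \<le> n"
  shows "(\<Sum>a \<in> {1..n}. M_inv x a * M_entry a y) = (if x = y then 1 else 0)"
proof -
  have "(\<Sum>a \<in> {1..n}. M_inv x a * M_entry a y) = (\<Sum>a \<in> {1..n}. M_inv_left x a * M_entry a y)"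
    using assms by (intro sum.cong) (auto simp: M_inv_left_eq)
  then show ?thesis using M_inv_left_mult_M[OF assms] by simp
qed

lemma span_eq_cancel: "s \<in> rid.span S \<Longrightarrow> s = a + b \<Longrightarrow> b \<in> rid.span S \<Longrightarrow> a \<in> rid.span S"
  using span_add_cancel_right by blast

section \<open>The generators\<close>

lemma cminor_identical:
  assumes "i < j" "j < length fs" "fs ! i = fs ! j" "length rs = length fs"
  shows "cminor rs fs = 0"
  unfolding cminor_def
  by (rule det_identical_columns[of _ "length fs" i j]) (use assms in \<open>auto intro!: eq_vecI\<close>)

lemma lminor_not_distinct:
  assumes "\<not> distinct cs" "length rs = length cs"
  shows "lminor Y rs cs = 0"
proof -
  obtain i j where "i < j" "j < length cs" "cs ! i = cs ! j"
    using assms(1) by (metis distinct_conv_nth linorder_neqE_nat)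
  then show ?thesis unfolding lminor_cminor using assms(2) by (intro cminor_identical[of i j]) auto
qed

text \<open>A column operation clears the first column above the last row; the remaining block is
  unitriangular.\<close>

lemma lminor_clear_column:
  assumes y: "y < p" and pq: "p \<le> q"
    and clear: "\<And>z. p \<le> z \<Longrightarrow> z \<le> q \<Longrightarrow> M_entry z y + (\<Sum>a \<in> {p..q}. M_entry z a * K a) = 0"
  shows "lminor M_entry ([p..<Suc q] @ [x]) (y # [p..<Suc q]) =
    (- 1) ^ (Suc q - p) * (M_entry x y + (\<Sum>a \<in> {p..q}. M_entry x a * K a))"
proof -
  let ?e = "\<lambda>z. M_entry z y + (\<Sum>a \<in> {p..q}. M_entry z a * K a)"
  let ?rs = "[p..<Suc q] @ [x]" and ?fs = "map (\<lambda>c r. M_entry r c) [p..<Suc q]"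
  \<comment> \<open>Column \<open>y\<close> equals the cleared column \<open>?e\<close> minus a
    combination of the columns \<open>p\<close> to \<open>q\<close>. Those occur in the minor
    already, so only \<open>?e\<close> contributes.\<close>
  let ?u = "\<lambda>a. if a = y then 1 else - K a" and ?g = "\<lambda>a. if a = y then ?e else (\<lambda>r. M_entry r a)"
  let ?r = "Suc q - p"
  have "(\<lambda>r. M_entry r y) = (\<lambda>r. \<Sum>a \<in> insert y {p..q}. ?u a * ?g a r)"
  proof
    fix r
    have "(\<Sum>a \<in> insert y {p..q}. ?u a * ?g a r) = ?e r + (\<Sum>a \<in> {p..q}. - K a * M_entry r a)"
      using y by (simp cong: sum.cong_simp)
    also have "(\<Sum>a \<in> {p..q}. - K a * M_entry r a) = - (\<Sum>a \<in> {p..q}. M_entry r a * K a)"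
      by (simp add: sum_negf mult.commute)
    finally show "M_entry r y = (\<Sum>a \<in> insert y {p..q}. ?u a * ?g a r)" by simp
  qed
  then have "lminor M_entry ?rs (y # [p..<Suc q]) =
      cminor ?rs ([] @ (\<lambda>r. \<Sum>a \<in> insert y {p..q}. ?u a * ?g a r) # ?fs)"
    by (simp add: lminor_cminor del: upt_Suc)
  also have "\<dots> = (\<Sum>a \<in> insert y {p..q}. ?u a * cminor ?rs ([] @ ?g a # ?fs))"
    by (rule cminor_linear) simp
  also have "\<dots> = (\<Sum>a \<in> {y}. ?u a * cminor ?rs ([] @ ?g a # ?fs))"
  proof (rule sum.mono_neutral_right)
    show "\<forall>a \<in> insert y {p..q} - {y}. ?u a * cminor ?rs ([] @ ?g a # ?fs) = 0"
    proof
      fix a assume a: "a \<in> insert y {p..q} - {y}"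
      have "cminor ?rs (?g a # ?fs) = 0"
      proof (rule cminor_identical[of 0 "Suc (a - p)"])
        show "(?g a # ?fs) ! 0 = (?g a # ?fs) ! Suc (a - p)"
          using a by (auto simp del: upt_Suc)
      qed (use a in auto)
      then show "?u a * cminor ?rs ([] @ ?g a # ?fs) = 0" by simp
    qed
  qed auto
  also have "\<dots> = cminor ?rs (?e # ?fs)" by simp
  also have "\<dots> = (- 1) ^ ?r * ?e x"
  proof -
    let ?A = "mat (Suc ?r) (Suc ?r) (\<lambda>(i, j). ((?e # ?fs) ! j) (?rs ! i))"
    have "cminor ?rs (?e # ?fs) = det ?A" using pq by (simp add: cminor_def Suc_diff_le)
    also have "\<dots> = (\<Sum>i<Suc ?r. ?A $$ (i, 0) * cofactor ?A i 0)"
      by (rule laplace_expansion_column) auto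
    also have "\<dots> = ?A $$ (?r, 0) * cofactor ?A ?r 0"
    proof -
      have "?A $$ (i, 0) = 0" if "i < ?r" for i
        using that clear[of "p + i"] by (simp add: nth_append del: upt_Suc)
      then show ?thesis by simp
    qed
    also have "?A $$ (?r, 0) = ?e x" using pq by (simp add: nth_append del: upt_Suc)
    also have "cofactor ?A ?r 0 = (- 1) ^ ?r"
    proof -
      have "mat_delete ?A ?r 0 = mat ?r ?r (\<lambda>(i, j). M_entry (p + i) (p + j))"
        by (rule eq_matI) (auto simp: mat_delete_def nth_append simp del: upt_Suc)
      moreover have "det (mat ?r ?r (\<lambda>(i, j). M_entry (p + i) (p + j))) = 1"
      proof -
        let ?U = "mat ?r ?r (\<lambda>(i, j). M_entry (p + i) (p + j))"
        have "det ?U = prod_list (diag_mat ?U)"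
          by (rule det_lower_triangular[where n = ?r]) auto
        also have "diag_mat ?U = replicate ?r 1"
          by (rule nth_equalityI) (auto simp: diag_mat_def)
        finally show ?thesis by simp
      qed
      ultimately show ?thesis by (simp add: cofactor_def)
    qed
    finally show ?thesis by (simp only: mult.commute)
  qed
  finally show ?thesis .
qed

lemma M_minor_lminor: "card A = card B \<Longrightarrow> M_minor A B = lminor M_entry (sorted_list_of_set A) (sorted_list_of_set B)"
  by (simp add: M_minor_def lminor_def)

lemma sorted_list_of_set_eqI: "sorted xs \<Longrightarrow> distinct xs \<Longrightarrow> set xs = A \<Longrightarrow> sorted_list_of_set A = xs"
  using sorted_list_of_set.idem_if_sorted_distinct by metis

locale ordered_inclusion_permutation = inclusion_permutation +
  fixes es
  assumes order: "admissible_order n w es"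
begin

abbreviation "f \<equiv> f_gen n w es"
abbreviation "SJ \<equiv> rid.span (f ` D)"

lemma f_rank_0:
  assumes "rk w x y = 0" shows "f (x, y) = M_entry x y"
  using assms by (simp add: f_gen_def M_minor_lminor lminor_single)

lemma es_set: "set es = essential_pos n w" and es_sorted: "i \<le> j \<Longrightarrow> j < length es \<Longrightarrow>
    rk w (fst (es ! i)) (snd (es ! i)) \<le> rk w (fst (es ! j)) (snd (es ! j))"
  using order sorted_nth_mono[of "map (\<lambda>(p, q). rk w p q) es" i j]
  by (auto simp: admissible_order_def case_prod_unfold)

lemma es_nth:
  assumes "m < length es" "es ! m = (p, q)" shows "(p, q) \<in> E" "0 < rk w p q"
  using assms nth_mem[of m es] es_set by (auto simp: essential_pos_def)

lemma es_index:
  assumes "(p, q) \<in> E" "0 < rk w p q" obtains m where "m < length es" "es ! m = (p, q)"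
  using essential_posI[OF assms] es_set by (metis in_set_conv_nth)

lemma f_region:
  assumes m: "m < length es" "es ! m = (p, q)" and reg: "(x, y) \<in> region n w es m" and eq: "rk w x y = rk w p q"
  shows "f (x, y) = M_minor ({p..p + rk w p q - 1} \<union> {x + rk w p q}) ({y - rk w p q} \<union> {q - rk w p q + 1..q})"
proof -
  have uniq: "m' = m" if "m' < length es" "(x, y) \<in> region n w es m'" for m'
  proof (rule ccontr)
    assume "m' \<noteq> m"
    then show False using that reg by (cases m' m rule: linorder_cases) (auto simp: region_def)
  qed
  have "(THE m. m < length es \<and> (x, y) \<in> region n w es m) = m"
  proof (rule the_equality)
    show "m' = m" if "m' < length es \<and> (x, y) \<in> region n w es m'" for m'
      using that uniq by blast
  qed (use m(1) reg in simp)
  then show ?thesis using es_nth[OF m] eq by (simp add: f_gen_def m(2) Let_def)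
qed

text \<open>The first listed essential position with \<open>(x, y)\<close> weakly SW of it has at
  most the rank of the one from \<open>diagram_essential\<close>, because the list is sorted by
  rank. That rank is \<open>rk w x y\<close>, and monotonicity gives the opposite
  inequality.\<close>

lemma diagram_region:
  assumes "(x, y) \<in> D" "0 < rk w x y"
  obtains m p q where "m < length es" "es ! m = (p, q)" "(x, y) \<in> region n w es m" "rk w x y = rk w p q"
    "p \<le> x" "y \<le> q"
proof -
  obtain p0 q0 where e0: "(p0, q0) \<in> E" "p0 \<le> x" "y \<le> q0" "rk w p0 q0 = rk w x y"
    using assms(1) by (rule diagram_essential)
  obtain m0 where m0: "m0 < length es" "es ! m0 = (p0, q0)"
    using es_index[OF e0(1)] e0(4) assms(2) by auto
  have ex: "\<exists>m. m < length es \<and> weakly_SW (x, y) (es ! m)"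
    using m0 e0 by (intro exI[of _ m0]) (simp add: weakly_SW_def)
  define m where "m = (LEAST m. m < length es \<and> weakly_SW (x, y) (es ! m))"
  have m: "m < length es" "weakly_SW (x, y) (es ! m)" using LeastI_ex[OF ex] by (auto simp: m_def)
  have least: "\<not> weakly_SW (x, y) (es ! m')" if "m' < m" for m'
    using not_less_Least[of m' "\<lambda>m. m < length es \<and> weakly_SW (x, y) (es ! m)"] that m by (auto simp: m_def)
  obtain p q where pq: "es ! m = (p, q)" by fastforce
  have sw: "p \<le> x" "y \<le> q" using m(2) pq by (auto simp: weakly_SW_def)
  have "m \<le> m0" unfolding m_def using m0 e0 by (intro Least_le) (simp add: weakly_SW_def)
  then have "rk w p q \<le> rk w x y" using es_sorted[of m m0] m0 e0 pq by simp
  moreover have "rk w x y \<le> rk w p q" using sw by (rule rk_mono)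
  moreover have "(x, y) \<in> region n w es m"
    using m(2) least assms by (auto simp: region_def diagram_pos_def)
  ultimately show ?thesis using that m(1) pq sw by auto
qed

text \<open>Every generator is one of the minors that define the rank ideals, which places
  \<open>J_ideal\<close> inside \<open>I_ideal\<close>.\<close>

lemma f_cases:
  assumes "(x, y) \<in> D"
  obtains A B p q where "(p, q) \<in> E" "f (x, y) = M_minor A B" "A \<subseteq> {p..n}" "B \<subseteq> {1..q}"
    "card A = rk w p q + 1" "card B = rk w p q + 1"
proof (cases "rk w x y = 0")
  case True
  obtain p q where e: "(p, q) \<in> E" "p \<le> x" "y \<le> q" "rk w p q = rk w x y"
    using assms by (rule diagram_essential)
  have "f (x, y) = M_minor {x} {y}" using True by (simp add: f_gen_def)
  then show ?thesis using that[of p q "{x}" "{y}"] e True assms by (auto simp: diagram_iff)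
next
  case False
  then obtain m p q where m: "m < length es" "es ! m = (p, q)" "(x, y) \<in> region n w es m"
    "rk w x y = rk w p q" "p \<le> x" "y \<le> q"
    using diagram_region[OF assms] by auto
  let ?r = "rk w p q"
  let ?A = "{p..p + ?r - 1} \<union> {x + ?r}" and ?B = "{y - ?r} \<union> {q - ?r + 1..q}"
  have e: "(p, q) \<in> E" "0 < ?r" by (rule es_nth[OF m(1,2)])+
  have r: "?r < y" "x + ?r \<le> n" using rk_less_col[OF assms] m(4) by auto
  have b: "1 \<le> p" "q \<le> n" using essential_bounds[OF e(1)] by auto
  have "card ?A = ?r + 1"
  proof -
    have "x + ?r \<notin> {p..p + ?r - 1}" using m e by auto
    then show ?thesis using e by simp
  qed
  moreover have "card ?B = ?r + 1"
  proof -
    have "y - ?r \<notin> {q - ?r + 1..q}" using m r by auto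
    then show ?thesis using m r by simp
  qed
  moreover have "?A \<subseteq> {p..n}" "?B \<subseteq> {1..q}" using m r e b by auto
  ultimately show ?thesis using that[OF e(1) f_region[OF m(1-4)]] by blast
qed

text \<open>Such a position lies in the diagram with rank 0, and the generator there is the entry
  itself.\<close>

lemma M_entry_mem:
  assumes "1 \<le> y" "x \<le> n" "pmax w y < x" shows "M_entry x y \<in> SJ"
proof -
  have "y \<le> pmax w y" by (rule pmax_w_ge)
  then have yx: "y < x" using assms by simp
  have "w y < x" using pmax_ge[of y y w] assms by simp
  moreover have "\<not> wi x \<le> y"
    using pmax_ge[of "wi x" y w] wi_pos[of x] assms yx by auto
  ultimately have "(x, y) \<in> D" using assms yx by (auto simp: diagram_iff)
  moreover have "rk w x y = 0" using rk_0_iff_pmax[of x y] assms by simp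
  ultimately show ?thesis using f_rank_0[of x y] by (intro rid.span_base image_eqI[of _ f "(x, y)"]) simp_all
qed

text \<open>Let \<open>K a\<close> be the sum of \<open>M_inv a b * M_entry b y\<close> over
  \<open>b < p\<close>. By \<open>M N = I\<close>, adding the \<open>K\<close>-multiples of the
  columns \<open>p\<close> to \<open>q\<close> clears column \<open>y\<close> in rows
  \<open>p\<close> to \<open>q\<close>. In row \<open>x\<close> it leaves, up to sign,
  \<open>K x\<close> plus multiples of \<open>K a\<close> with \<open>q < a < x\<close>, and
  \<open>K x\<close> is \<open>M_inv x y\<close> plus multiples of entries covered by
  \<open>IH\<close>.\<close>

lemma M_inv_mem_of_f:
  assumes E: "(p, q) \<in> E" "0 < rk w p q" and box: "1 \<le> y" "y < p" "q < x" "x \<le> n"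
    and f: "lminor M_entry ([p..<Suc q] @ [x]) (y # [p..<Suc q]) \<in> SJ"
    and IH: "\<And>a b. q < a \<Longrightarrow> a \<le> x \<Longrightarrow> y \<le> b \<Longrightarrow> b < p \<Longrightarrow> (a, b) \<noteq> (x, y) \<Longrightarrow> M_inv a b \<in> SJ"
  shows "M_inv x y \<in> SJ"
proof -
  have b: "1 \<le> p" "p \<le> n" "1 \<le> q" "q \<le> n" using essential_bounds[OF E(1)] by auto
  have pq: "p \<le> q" using rk_essential[OF E] E(2) by simp
  define K where "K a = (\<Sum>b \<in> {1..p - 1}. M_inv a b * M_entry b y)" for a
  have K_low: "K a = (if a = y then 1 else 0)" if a: "1 \<le> a" "a < p" for a
  proof -
    have "K a = (\<Sum>b \<in> {1..n}. M_inv a b * M_entry b y)"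
      unfolding K_def using a b by (intro sum.mono_neutral_left) auto
    then show ?thesis using M_inv_mult_M[of a n y] a b box by auto
  qed
  have MK: "M_entry z y + (\<Sum>a \<in> {p..q}. M_entry z a * K a) = - (\<Sum>a \<in> {q<..n}. M_entry z a * K a)"
    if z: "p \<le> z" "z \<le> n" for z
  proof -
    have "(\<Sum>a \<in> {1..n}. M_entry z a * K a) = (\<Sum>a \<in> {1..n}. \<Sum>b \<in> {1..p - 1}. M_entry z a * M_inv a b * M_entry b y)"
      by (simp only: K_def sum_distrib_left mult.assoc)
    also have "\<dots> = (\<Sum>b \<in> {1..p - 1}. \<Sum>a \<in> {1..n}. M_entry z a * M_inv a b * M_entry b y)"
      by (rule sum.swap)
    also have "\<dots> = (\<Sum>b \<in> {1..p - 1}. (\<Sum>a \<in> {1..n}. M_entry z a * M_inv a b) * M_entry b y)"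
      by (simp only: sum_distrib_right)
    also have "\<dots> = 0"
    proof (intro sum.neutral ballI)
      fix c assume "c \<in> {1..p - 1}"
      then have "(\<Sum>a \<in> {1..n}. M_entry z a * M_inv a c) = 0"
        using M_mult_M_inv[of z n c] z b by auto
      then show "(\<Sum>a \<in> {1..n}. M_entry z a * M_inv a c) * M_entry c y = 0" by simp
    qed
    finally have "(\<Sum>a \<in> {1..n}. M_entry z a * K a) = 0" .
    moreover have "{1..n} = {1..<p} \<union> ({p..q} \<union> {q<..n})" using b pq by auto
    moreover have "(\<Sum>a \<in> {1..<p} \<union> ({p..q} \<union> {q<..n}). M_entry z a * K a) =
        (\<Sum>a \<in> {1..<p}. M_entry z a * K a) + ((\<Sum>a \<in> {p..q}. M_entry z a * K a) + (\<Sum>a \<in> {q<..n}. M_entry z a * K a))"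
      using pq by (subst sum.union_disjoint; (subst sum.union_disjoint)?) auto
    moreover have "(\<Sum>a \<in> {1..<p}. M_entry z a * K a) = M_entry z y"
    proof -
      have "(\<Sum>a \<in> {1..<p}. M_entry z a * K a) = (\<Sum>a \<in> {1..<p}. if a = y then M_entry z y else 0)"
        by (rule sum.cong) (auto simp: K_low)
      then show ?thesis using box by simp
    qed
    ultimately have "M_entry z y + ((\<Sum>a \<in> {p..q}. M_entry z a * K a) + (\<Sum>a \<in> {q<..n}. M_entry z a * K a)) = 0"
      by simp
    then show ?thesis by (simp add: eq_neg_iff_add_eq_0 add.assoc)
  qed
  let ?e = "M_entry x y + (\<Sum>a \<in> {p..q}. M_entry x a * K a)"
  have "lminor M_entry ([p..<Suc q] @ [x]) (y # [p..<Suc q]) = (- 1) ^ (Suc q - p) * ?e"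
  proof (rule lminor_clear_column[OF box(2) pq])
    fix z assume z: "p \<le> z" "z \<le> q"
    then have "M_entry z y + (\<Sum>a \<in> {p..q}. M_entry z a * K a) = - (\<Sum>a \<in> {q<..n}. M_entry z a * K a)"
      using b by (intro MK) auto
    also have "(\<Sum>a \<in> {q<..n}. M_entry z a * K a) = 0" using z by (intro sum.neutral) auto
    finally show "M_entry z y + (\<Sum>a \<in> {p..q}. M_entry z a * K a) = 0" by simp
  qed
  then have "(- 1) ^ (Suc q - p) * ?e \<in> SJ" using f by simp
  then have "(- 1) ^ (Suc q - p) * ((- 1) ^ (Suc q - p) * ?e) \<in> SJ" by (rule span_mult_left)
  then have "?e \<in> SJ" by (simp only: mult.assoc[symmetric] left_minus_one_mult_self mult_1 power_mult_distrib[symmetric]) simp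
  moreover have "?e = - (\<Sum>a \<in> {q<..n}. M_entry x a * K a)" using box pq by (intro MK) auto
  ultimately have sum: "(\<Sum>a \<in> {q<..n}. M_entry x a * K a) \<in> SJ" using rid.span_neg by fastforce
  have K_IH: "K a \<in> SJ" if a: "q < a" "a < x" for a
    unfolding K_def
  proof (intro rid.span_sum)
    fix c assume c: "c \<in> {1..p - 1}"
    show "M_inv a c * M_entry c y \<in> SJ"
    proof (cases "c < y")
      case False
      then show ?thesis using a c b by (intro span_mult_right IH) auto
    qed (simp add: rid.span_zero)
  qed
  have split: "{q<..n} = insert x ({q<..<x} \<union> {x<..n})" using box by auto
  have "(\<Sum>a \<in> {q<..n}. M_entry x a * K a) = K x + (\<Sum>a \<in> {q<..<x} \<union> {x<..n}. M_entry x a * K a)"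
    unfolding split by simp
  moreover have "(\<Sum>a \<in> {q<..<x} \<union> {x<..n}. M_entry x a * K a) \<in> SJ"
  proof (rule rid.span_sum)
    fix a assume "a \<in> {q<..<x} \<union> {x<..n}"
    then show "M_entry x a * K a \<in> SJ"
      using K_IH[of a] by (cases "a < x") (auto intro: span_mult_left rid.span_zero)
  qed
  ultimately have "K x \<in> SJ" by (rule span_eq_cancel[OF sum])
  moreover have "{1..p - 1} = insert y ({1..<y} \<union> {y<..p - 1})" using box by auto
  then have "K x = M_inv x y + (\<Sum>c \<in> {1..<y} \<union> {y<..p - 1}. M_inv x c * M_entry c y)"
    unfolding K_def by simp
  moreover have "(\<Sum>c \<in> {1..<y} \<union> {y<..p - 1}. M_inv x c * M_entry c y) \<in> SJ"
  proof (rule rid.span_sum)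
    fix c assume "c \<in> {1..<y} \<union> {y<..p - 1}"
    then show "M_inv x c * M_entry c y \<in> SJ"
      using IH[of x c] box by (cases "c < y") (auto intro: span_mult_right rid.span_zero)
  qed
  ultimately show ?thesis by (rule span_eq_cancel)
qed

text \<open>In the first two cases the entry is a combination of others by \<open>N M = I\<close> or \<open>M N = I\<close>.\<close>

theorem M_inv_mem:
  assumes "1 \<le> y" "x \<le> n" "pmax wi y < x" shows "M_inv x y \<in> SJ"
  using assms
proof (induction "x - y" arbitrary: x y rule: less_induct)
  case less
  note IH = less.hyps
  have yx: "y < x" using pmax_wi_ge[of y] less.prems by simp
  have x1: "1 \<le> x" "y \<le> n" using yx less.prems by auto
  \<comment> \<open>\<open>pmax wi (pmax w y) < x\<close> makes all other terms of
    \<open>N M = I\<close> known, \<open>pmax w (pmax wi y) < x\<close> those of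
    \<open>M N = I\<close>. Where both fail, a generator of positive rank has to be used.\<close>
  consider (1) "pmax w y < x" "pmax wi (pmax w y) < x" | (2) "pmax w (pmax wi y) < x"
    | (3) "x \<le> pmax wi (pmax w y)" "x \<le> pmax w (pmax wi y)"
    using pmax_wi_ge[of "pmax w y"] by linarith
  then show ?case
  proof cases
    case 1
    have "(\<Sum>a \<in> {1..n}. M_inv x a * M_entry a y) \<in> SJ"
      using M_inv_mult_M[of x n y] x1 less.prems yx by (simp add: rid.span_zero)
    moreover have "(\<Sum>a \<in> {1..n}. M_inv x a * M_entry a y) = M_inv x y + (\<Sum>a \<in> {1..n} - {y}. M_inv x a * M_entry a y)"
      using x1 less.prems by (subst sum.remove[of _ y]) auto
    moreover have "(\<Sum>a \<in> {1..n} - {y}. M_inv x a * M_entry a y) \<in> SJ"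
    proof (rule rid.span_sum)
      fix a assume a: "a \<in> {1..n} - {y}"
      consider "a < y" | "y < a" "a \<le> pmax w y" | "pmax w y < a" using a by force
      then show "M_inv x a * M_entry a y \<in> SJ"
      proof cases
        case 2
        then have "pmax wi a < x" using pmax_mono[of a "pmax w y" wi] 1 by simp
        then have "M_inv x a \<in> SJ" using 2 1 a less.prems by (intro IH) auto
        then show ?thesis by (rule span_mult_right)
      next
        case 3
        then have "M_entry a y \<in> SJ" using a less.prems by (intro M_entry_mem) auto
        then show ?thesis by (rule span_mult_left)
      qed (simp add: rid.span_zero)
    qed
    ultimately show ?thesis by (rule span_eq_cancel)
  next
    case 2
    have "(\<Sum>a \<in> {1..n}. M_entry x a * M_inv a y) \<in> SJ"
      using M_mult_M_inv[of x n y] x1 less.prems yx by (simp add: rid.span_zero)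
    moreover have "(\<Sum>a \<in> {1..n}. M_entry x a * M_inv a y) = M_inv x y + (\<Sum>a \<in> {1..n} - {x}. M_entry x a * M_inv a y)"
      using x1 less.prems by (subst sum.remove[of _ x]) auto
    moreover have "(\<Sum>a \<in> {1..n} - {x}. M_entry x a * M_inv a y) \<in> SJ"
    proof (rule rid.span_sum)
      fix a assume a: "a \<in> {1..n} - {x}"
      consider "x < a" | "a < x" "a \<le> pmax wi y" | "a < x" "pmax wi y < a" using a by force
      then show "M_entry x a * M_inv a y \<in> SJ"
      proof cases
        case 2
        then have "pmax w a < x" using pmax_mono[of a "pmax wi y" w] \<open>pmax w (pmax wi y) < x\<close> by simp
        then have "M_entry x a \<in> SJ" using a less.prems by (intro M_entry_mem) auto
        then show ?thesis by (rule span_mult_right)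
      next
        case 3
        then have "y < a" using pmax_wi_ge[of y] by simp
        then have "M_inv a y \<in> SJ" using 3 a less.prems by (intro IH) auto
        then show ?thesis by (rule span_mult_left)
      qed (simp add: rid.span_zero)
    qed
    ultimately show ?thesis by (rule span_eq_cancel)
  next
    case 3
    \<comment> \<open>The first listed position whose block of \<open>N\<close> contains
      \<open>(x, y)\<close>; by the order it has minimal rank among these.\<close>
    let ?box = "\<lambda>m. m < length es \<and> y < fst (es ! m) \<and> snd (es ! m) < x"
    have "\<exists>m. ?box m"
    proof -
      obtain p q where "(p, q) \<in> E" "0 < rk w p q" "y < p" "q < x"
        using less.prems 3(2) by (rule essential_box)
      then show ?thesis using es_index[of p q] by (metis fst_conv snd_conv)
    qed
    then have box: "?box (Least ?box)" and least: "\<And>m'. m' < Least ?box \<Longrightarrow> \<not> ?box m'"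
      by (rule LeastI_ex) (rule not_less_Least)
    define m where "m = Least ?box"
    obtain p q where pq: "es ! m = (p, q)" by fastforce
    have m: "m < length es" "y < p" "q < x" using box pq by (auto simp: m_def)
    have e: "(p, q) \<in> E" "0 < rk w p q" by (rule es_nth[OF m(1) pq])+
    let ?r = "rk w p q"
    have min: "\<not> (y < p' \<and> q' < x)" if e': "(p', q') \<in> E" "0 < rk w p' q'" "rk w p' q' < ?r" for p' q'
    proof
      assume *: "y < p' \<and> q' < x"
      obtain m' where m': "m' < length es" "es ! m' = (p', q')" using e'(1,2) by (rule es_index)
      then have "m' < m" using es_sorted[of m m'] pq e'(3) by (cases "m' < m") auto
      then show False using least[of m'] m' * by (auto simp: m_def)
    qed
    have shift: "(x - ?r, y + ?r) \<in> D" "rk w (x - ?r) (y + ?r) = ?r" "p \<le> x - ?r" "y + ?r \<le> q"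
      using shifted_position_in_diagram[OF e less.prems(1) m(2,3) less.prems(2) min 3] by blast+
    have rpq: "?r + p = q + 1" by (rule rk_essential[OF e])
    have "(x - ?r, y + ?r) \<in> region n w es m"
    proof -
      \<comment> \<open>An earlier essential position with the shifted position weakly SW of it has
        rank \<open>?r\<close> as well. By \<open>rk_essential\<close> its block then also contains
        \<open>(x, y)\<close>, against the choice of \<open>m\<close>.\<close>
      have "\<not> weakly_SW (x - ?r, y + ?r) (es ! m')" if m': "m' < m" for m'
      proof
        assume sw: "weakly_SW (x - ?r, y + ?r) (es ! m')"
        obtain p' q' where pq': "es ! m' = (p', q')" by fastforce
        have sw': "p' \<le> x - ?r" "y + ?r \<le> q'" using sw pq' by (auto simp: weakly_SW_def)
        have e': "(p', q') \<in> E" "0 < rk w p' q'" using es_nth[OF _ pq'] m' m(1) by auto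
        have "rk w p' q' \<le> ?r" using es_sorted[of m' m] m' m(1) pq pq' by simp
        moreover have "?r \<le> rk w p' q'" using rk_mono[OF sw', of w] shift(2) by simp
        ultimately have "?r + p' = q' + 1" using rk_essential[OF e'] by simp
        then have "y < p'" "q' < x" using sw' shift(3) e(2) by auto
        then show False using least[of m'] m' m(1) pq' by (auto simp: m_def)
      qed
      then show ?thesis using shift e(2) pq by (auto simp: region_def diagram_pos_def weakly_SW_def)
    qed
    then have "f (x - ?r, y + ?r) =
        M_minor ({p..p + ?r - 1} \<union> {x - ?r + ?r}) ({y + ?r - ?r} \<union> {q - ?r + 1..q})"
      using shift by (intro f_region[OF m(1) pq]) auto
    moreover have "p + ?r - 1 = q" "x - ?r + ?r = x" "q - ?r + 1 = p" using rpq e(2) shift(3) m by auto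
    ultimately have "f (x - ?r, y + ?r) = M_minor ({p..q} \<union> {x}) ({y} \<union> {p..q})" by simp
    also have "\<dots> = lminor M_entry ([p..<Suc q] @ [x]) (y # [p..<Suc q])"
    proof -
      have "sorted_list_of_set ({p..q} \<union> {x}) = [p..<Suc q] @ [x]"
        using m by (intro sorted_list_of_set_eqI) (auto simp: sorted_append simp del: upt_Suc)
      moreover have "sorted_list_of_set ({y} \<union> {p..q}) = y # [p..<Suc q]"
        using m by (intro sorted_list_of_set_eqI) (auto simp del: upt_Suc)
      moreover have "card ({p..q} \<union> {x}) = card ({y} \<union> {p..q})" using m by simp
      ultimately show ?thesis by (simp only: M_minor_lminor)
    qed
    finally have "lminor M_entry ([p..<Suc q] @ [x]) (y # [p..<Suc q]) \<in> SJ"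
      using shift(1) by (metis image_eqI rid.span_base)
    then show ?thesis
    proof (rule M_inv_mem_of_f[OF e less.prems(1) m(2,3) less.prems(2)])
      fix a b assume ab: "q < a" "a \<le> x" "y \<le> b" "b < p" "(a, b) \<noteq> (x, y)"
      have "b \<le> p - 1" using ab by simp
      then have "pmax wi b < a" using pmax_mono[of b "p - 1" wi] rows_above_essential[OF e] ab by simp
      moreover have "b < a" using pmax_wi_ge[of b] calculation by simp
      moreover have "a - b < x - y" using ab \<open>b < a\<close> by auto
      ultimately show "M_inv a b \<in> SJ" using ab less.prems by (intro IH) auto
    qed
  qed
qed

theorem rank_minors_subset: "rank_minors n E (rk w) M_entry \<subseteq> SJ"
proof
  fix g assume "g \<in> rank_minors n E (rk w) M_entry"
  then obtain rs cs p q where g: "g = lminor M_entry rs cs" and e: "(p, q) \<in> E" and rs: "set rs \<subseteq> {p..n}"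
    and cs: "set cs \<subseteq> {1..q}" and len: "length rs = rk w p q + 1" "length cs = rk w p q + 1"
    unfolding rank_minors_def by auto
  have b: "1 \<le> p" "p \<le> n" "1 \<le> q" "q \<le> n" using essential_bounds[OF e] by auto
  show "g \<in> SJ"
  proof (cases "rk w p q = 0")
    case True
    then obtain x y where xy: "rs = [x]" "cs = [y]" using len by (auto simp: length_Suc_conv)
    have "pmax w y < x"
      using True rk_0_iff_pmax[of p q] pmax_mono[of y q w] b xy rs cs by simp
    then show ?thesis using M_entry_mem[of y x] xy rs cs g by (simp add: lminor_single)
  next
    case False
    then have r: "0 < rk w p q" by simp
    have pq: "p \<le> q" and rpq: "rk w p q + p = q + 1" using rk_essential[OF e r] False by auto
    define K where "K a y = (\<Sum>b \<in> {1..p - 1}. M_inv a b * M_entry b y)" for a y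
    \<comment> \<open>Coefficients that express the columns up to \<open>q\<close> by the columns
      \<open>p\<close> to \<open>q\<close>. For \<open>y < p\<close> they come from
      \<open>M N = I\<close>, with an error in the ideal of the block entries of
      \<open>N\<close>.\<close>
    define T where "T a y = (if y < p then - K a y else if a = y then 1 else 0)" for a y
    have col: "cong_mod (M_entry x y) (\<Sum>a \<in> {p..q}. M_entry x a * T a y) (f ` D)"
      if x: "p \<le> x" "x \<le> n" and y: "1 \<le> y" "y \<le> q" for x y
    proof (cases "y < p")
      case False
      have "(\<Sum>a \<in> {p..q}. M_entry x a * T a y) = (\<Sum>a \<in> {p..q}. if a = y then M_entry x y else 0)"
        using False by (intro sum.cong) (auto simp: T_def)
      then show ?thesis using False y by simp
    next
      case True
      have "(\<Sum>a \<in> {1..n}. M_entry x a * K a y) = (\<Sum>a \<in> {1..n}. \<Sum>b \<in> {1..p - 1}. M_entry x a * M_inv a b * M_entry b y)"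
        by (simp only: K_def sum_distrib_left mult.assoc)
      also have "\<dots> = (\<Sum>b \<in> {1..p - 1}. \<Sum>a \<in> {1..n}. M_entry x a * M_inv a b * M_entry b y)"
        by (rule sum.swap)
      also have "\<dots> = (\<Sum>b \<in> {1..p - 1}. (\<Sum>a \<in> {1..n}. M_entry x a * M_inv a b) * M_entry b y)"
        by (simp only: sum_distrib_right)
      also have "\<dots> = 0"
      proof (intro sum.neutral ballI)
        fix c assume "c \<in> {1..p - 1}"
        then have "(\<Sum>a \<in> {1..n}. M_entry x a * M_inv a c) = 0"
          using M_mult_M_inv[of x n c] x b by auto
        then show "(\<Sum>a \<in> {1..n}. M_entry x a * M_inv a c) * M_entry c y = 0" by simp
      qed
      finally have zero: "(\<Sum>a \<in> {1..n}. M_entry x a * K a y) = 0" .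
      have K_low: "K a y = (if a = y then 1 else 0)" if a: "1 \<le> a" "a < p" for a
      proof -
        have "K a y = (\<Sum>b \<in> {1..n}. M_inv a b * M_entry b y)"
          unfolding K_def using a b by (intro sum.mono_neutral_left) auto
        then show ?thesis using M_inv_mult_M[of a n y] a b y True by auto
      qed
      have "{1..n} = {1..<p} \<union> ({p..q} \<union> {q<..n})" using b pq by auto
      moreover have "(\<Sum>a \<in> {1..<p} \<union> ({p..q} \<union> {q<..n}). M_entry x a * K a y) =
          (\<Sum>a \<in> {1..<p}. M_entry x a * K a y) + ((\<Sum>a \<in> {p..q}. M_entry x a * K a y) + (\<Sum>a \<in> {q<..n}. M_entry x a * K a y))"
        using pq by (subst sum.union_disjoint; (subst sum.union_disjoint)?) auto
      moreover have "(\<Sum>a \<in> {1..<p}. M_entry x a * K a y) = M_entry x y"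
      proof -
        have "(\<Sum>a \<in> {1..<p}. M_entry x a * K a y) = (\<Sum>a \<in> {1..<p}. if a = y then M_entry x y else 0)"
          by (rule sum.cong) (auto simp: K_low)
        then show ?thesis using True y by simp
      qed
      ultimately have "M_entry x y + ((\<Sum>a \<in> {p..q}. M_entry x a * K a y) + (\<Sum>a \<in> {q<..n}. M_entry x a * K a y)) = 0"
        using zero by simp
      then have "M_entry x y + (\<Sum>a \<in> {p..q}. M_entry x a * K a y) = - (\<Sum>a \<in> {q<..n}. M_entry x a * K a y)"
        by (simp only: eq_neg_iff_add_eq_0 add.assoc)
      moreover have "(\<Sum>a \<in> {p..q}. M_entry x a * T a y) = - (\<Sum>a \<in> {p..q}. M_entry x a * K a y)"
        using True by (simp add: T_def sum_negf)
      ultimately have eq: "M_entry x y - (\<Sum>a \<in> {p..q}. M_entry x a * T a y) = - (\<Sum>a \<in> {q<..n}. M_entry x a * K a y)"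
        by (simp only: diff_minus_eq_add)
      have "(\<Sum>a \<in> {q<..n}. M_entry x a * K a y) \<in> SJ"
      proof (intro rid.span_sum span_mult_left)
        fix a assume a: "a \<in> {q<..n}"
        show "K a y \<in> SJ" unfolding K_def
        proof (rule rid.span_sum)
          fix c assume c: "c \<in> {1..p - 1}"
          have "pmax wi c < a" using pmax_mono[of c "p - 1" wi] rows_above_essential[OF e r] a c by simp
          then have "M_inv a c \<in> SJ" using a c by (intro M_inv_mem) auto
          then show "M_inv a c * M_entry c y \<in> SJ" by (rule span_mult_right)
        qed
      qed
      then show ?thesis unfolding cong_mod_def eq by (rule rid.span_neg)
    qed
    have "cong_mod g (lminor (\<lambda>x y. \<Sum>a \<in> {p..q}. M_entry x a * T a y) rs cs) (f ` D)"
      unfolding g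
    proof (rule lminor_cong_mod)
      fix x y assume "x \<in> set rs" "y \<in> set cs"
      then show "cong_mod (M_entry x y) (\<Sum>a \<in> {p..q}. M_entry x a * T a y) (f ` D)"
        using rs cs by (intro col) auto
    qed (use len in simp)
    moreover have "lminor (\<lambda>x y. \<Sum>a \<in> {p..q}. M_entry x a * T a y) rs cs \<in> SJ"
    proof (rule lminor_mult_mem_span)
      fix ls assume ls: "length ls = length cs" "set ls \<subseteq> {p..q}"
      \<comment> \<open>There are only \<open>rk w p q\<close> columns from \<open>p\<close> to
        \<open>q\<close>, so \<open>rk w p q + 1\<close> choices contain a repetition.\<close>
      have "card (set ls) \<le> card {p..q}" using ls(2) by (intro card_mono) auto
      then have "\<not> distinct ls" using distinct_card[of ls] ls(1) len rpq pq by auto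
      then have "lminor M_entry rs ls = 0" using ls len by (intro lminor_not_distinct) auto
      then show "lminor M_entry rs ls \<in> SJ" by (simp add: rid.span_zero)
    qed (use len in simp)
    ultimately show ?thesis using cong_mod_mem by blast
  qed
qed

end

section \<open>Localization and complete intersections\<close>

section \<open>Localization at a prime ideal\<close>

locale prime_localization = primeideal P R for P and R (structure)
begin

abbreviation "den \<equiv> carrier R - P"
abbreviation "lfrac \<equiv> loc_frac R P"
abbreviation "L \<equiv> localization R P"

lemma one_den [simp]: "\<one> \<in> den"
  using I_notcarr one_imp_carrier by auto

lemma one_notin [simp]: "\<one> \<notin> P"
  using one_den by blast

lemma mult_notin [simp]:
  "\<lbrakk>s \<in> carrier R; s \<notin> P; t \<in> carrier R; t \<notin> P\<rbrakk> \<Longrightarrow> s \<otimes> t \<notin> P"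
  using I_prime by auto

lemma den_mult: "s \<in> den \<Longrightarrow> t \<in> den \<Longrightarrow> s \<otimes> t \<in> den"
  using I_prime by auto

lemma mem_frac: "(b, t) \<in> lfrac a s \<longleftrightarrow> b \<in> carrier R \<and> t \<in> den \<and>
    (\<exists>u \<in> den. u \<otimes> (a \<otimes> t) = u \<otimes> (b \<otimes> s))"
  by (simp add: loc_frac_def)

lemma frac_self: "a \<in> carrier R \<Longrightarrow> s \<in> den \<Longrightarrow> (a, s) \<in> lfrac a s"
  unfolding mem_frac using one_den by blast

lemma frac_trans:
  assumes "a \<in> carrier R" "b \<in> carrier R" "c \<in> carrier R" "s \<in> den" "t \<in> den" "r \<in> den"
    and "u \<in> den" "u \<otimes> (a \<otimes> t) = u \<otimes> (b \<otimes> s)" and "v \<in> den" "v \<otimes> (b \<otimes> r) = v \<otimes> (c \<otimes> t)"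
  shows "\<exists>z \<in> den. z \<otimes> (a \<otimes> r) = z \<otimes> (c \<otimes> s)"
proof
  have cl: "s \<in> carrier R" "t \<in> carrier R" "r \<in> carrier R" "u \<in> carrier R" "v \<in> carrier R"
    using assms by auto
  have "(u \<otimes> v \<otimes> t) \<otimes> (a \<otimes> r) = (v \<otimes> r) \<otimes> (u \<otimes> (a \<otimes> t))"
    using assms(1-3) cl by (simp add: m_ac)
  also have "\<dots> = (u \<otimes> s) \<otimes> (v \<otimes> (b \<otimes> r))"
    unfolding assms(8) using assms(1-3) cl by (simp add: m_ac)
  also have "\<dots> = (u \<otimes> v \<otimes> t) \<otimes> (c \<otimes> s)"
    unfolding assms(10) using assms(1-3) cl by (simp add: m_ac)
  finally show "(u \<otimes> v \<otimes> t) \<otimes> (a \<otimes> r) = (u \<otimes> v \<otimes> t) \<otimes> (c \<otimes> s)" .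
  show "u \<otimes> v \<otimes> t \<in> den" using assms by (intro den_mult)
qed

lemma frac_eq_iff:
  assumes "a \<in> carrier R" "b \<in> carrier R" "s \<in> den" "t \<in> den"
  shows "lfrac a s = lfrac b t \<longleftrightarrow> (\<exists>u \<in> den. u \<otimes> (a \<otimes> t) = u \<otimes> (b \<otimes> s))"
proof
  assume "lfrac a s = lfrac b t"
  then have "(b, t) \<in> lfrac a s" using frac_self assms by simp
  then show "\<exists>u \<in> den. u \<otimes> (a \<otimes> t) = u \<otimes> (b \<otimes> s)" by (simp add: mem_frac)
next
  assume "\<exists>u \<in> den. u \<otimes> (a \<otimes> t) = u \<otimes> (b \<otimes> s)"
  then obtain u where u: "u \<in> den" "u \<otimes> (a \<otimes> t) = u \<otimes> (b \<otimes> s)" by blast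
  have sub: "lfrac b t \<subseteq> lfrac a s"
    if "a \<in> carrier R" "b \<in> carrier R" "s \<in> den" "t \<in> den" "u \<otimes> (a \<otimes> t) = u \<otimes> (b \<otimes> s)" for a b s t
  proof (rule subrelI)
    fix c r assume "(c, r) \<in> lfrac b t"
    then obtain v where "c \<in> carrier R" "r \<in> den" "v \<in> den" "v \<otimes> (b \<otimes> r) = v \<otimes> (c \<otimes> t)"
      by (auto simp: mem_frac)
    then show "(c, r) \<in> lfrac a s"
      using frac_trans[OF that(1,2) _ that(3,4) _ u(1) that(5)] by (simp add: mem_frac)
  qed
  show "lfrac a s = lfrac b t"
    using sub[OF assms(1,2,3,4) u(2)] sub[OF assms(2,1,4,3) u(2)[symmetric]] by blast
qed

lemma frac_eqI:
  assumes "a \<in> carrier R" "b \<in> carrier R" "s \<in> den" "t \<in> den" "a \<otimes> t = b \<otimes> s"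
  shows "lfrac a s = lfrac b t"
  using assms frac_eq_iff one_den by metis

lemma frac_cancel:
  assumes "a \<in> carrier R" "s \<in> den" "u \<in> den" shows "lfrac (u \<otimes> a) (u \<otimes> s) = lfrac a s"
  using assms by (intro frac_eqI den_mult) (auto simp: m_ac)

lemma mult_swap:
  "\<lbrakk>x \<in> carrier R; y \<in> carrier R; z \<in> carrier R; t \<in> carrier R\<rbrakk>
    \<Longrightarrow> (x \<otimes> y) \<otimes> (z \<otimes> t) = (x \<otimes> z) \<otimes> (y \<otimes> t)"
  by (simp add: m_ac)

lemma frac_mult_cong:
  assumes "a \<in> carrier R" "s \<in> den" "b \<in> carrier R" "t \<in> den" "(a', s') \<in> lfrac a s" "(b', t') \<in> lfrac b t"
  shows "lfrac (a' \<otimes> b') (s' \<otimes> t') = lfrac (a \<otimes> b) (s \<otimes> t)"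
proof -
  obtain u v where uv: "a' \<in> carrier R" "s' \<in> den" "u \<in> den" "u \<otimes> (a \<otimes> s') = u \<otimes> (a' \<otimes> s)"
    "b' \<in> carrier R" "t' \<in> den" "v \<in> den" "v \<otimes> (b \<otimes> t') = v \<otimes> (b' \<otimes> t)"
    using assms(5,6) by (auto simp: mem_frac)
  have cl: "s \<in> carrier R" "t \<in> carrier R" "s' \<in> carrier R" "t' \<in> carrier R" "u \<in> carrier R" "v \<in> carrier R"
    using assms(2,4) uv(2,3,6,7) by auto
  have "(u \<otimes> v) \<otimes> ((a' \<otimes> b') \<otimes> (s \<otimes> t)) = (u \<otimes> (a' \<otimes> s)) \<otimes> (v \<otimes> (b' \<otimes> t))"
    using uv(1,5) cl by (simp only: mult_swap[of a' b' s t] mult_swap[of u v] m_closed)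
  also have "\<dots> = (u \<otimes> v) \<otimes> ((a \<otimes> b) \<otimes> (s' \<otimes> t'))"
    unfolding uv(4,8)[symmetric] using assms(1,3) cl
    by (simp only: mult_swap[of a b s' t'] mult_swap[of u v] m_closed)
  finally have "(u \<otimes> v) \<otimes> ((a' \<otimes> b') \<otimes> (s \<otimes> t)) = (u \<otimes> v) \<otimes> ((a \<otimes> b) \<otimes> (s' \<otimes> t'))" .
  then show ?thesis
    using assms(1-4) uv(1-3,5-7) by (intro frac_eq_iff[THEN iffD2] bexI[of _ "u \<otimes> v"] m_closed den_mult)
qed

lemma add_swap:
  assumes "a \<in> carrier R" "b \<in> carrier R" "s \<in> carrier R" "t \<in> carrier R" "s' \<in> carrier R"
    "t' \<in> carrier R" "u \<in> carrier R" "v \<in> carrier R"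
  shows "(u \<otimes> v) \<otimes> ((a \<otimes> t \<oplus> b \<otimes> s) \<otimes> (s' \<otimes> t')) =
    (u \<otimes> (a \<otimes> s')) \<otimes> (v \<otimes> (t \<otimes> t')) \<oplus> (v \<otimes> (b \<otimes> t')) \<otimes> (u \<otimes> (s \<otimes> s'))"
proof -
  have "(a \<otimes> t \<oplus> b \<otimes> s) \<otimes> (s' \<otimes> t') = (a \<otimes> t) \<otimes> (s' \<otimes> t') \<oplus> (b \<otimes> s) \<otimes> (t' \<otimes> s')"
    using assms by (simp add: l_distr m_comm[of s' t'])
  also have "\<dots> = (a \<otimes> s') \<otimes> (t \<otimes> t') \<oplus> (b \<otimes> t') \<otimes> (s \<otimes> s')"
    using assms by (simp only: mult_swap[of a t] mult_swap[of b s])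
  finally have "(u \<otimes> v) \<otimes> ((a \<otimes> t \<oplus> b \<otimes> s) \<otimes> (s' \<otimes> t')) =
      (u \<otimes> v) \<otimes> ((a \<otimes> s') \<otimes> (t \<otimes> t')) \<oplus> (v \<otimes> u) \<otimes> ((b \<otimes> t') \<otimes> (s \<otimes> s'))"
    using assms by (simp add: r_distr m_comm[of u v])
  then show ?thesis using assms by (simp only: mult_swap[of u v] mult_swap[of v u] m_closed)
qed

lemma frac_add_cong:
  assumes "a \<in> carrier R" "s \<in> den" "b \<in> carrier R" "t \<in> den" "(a', s') \<in> lfrac a s" "(b', t') \<in> lfrac b t"
  shows "lfrac (a' \<otimes> t' \<oplus> b' \<otimes> s') (s' \<otimes> t') = lfrac (a \<otimes> t \<oplus> b \<otimes> s) (s \<otimes> t)"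
proof -
  obtain u v where uv: "a' \<in> carrier R" "s' \<in> den" "u \<in> den" "u \<otimes> (a \<otimes> s') = u \<otimes> (a' \<otimes> s)"
    "b' \<in> carrier R" "t' \<in> den" "v \<in> den" "v \<otimes> (b \<otimes> t') = v \<otimes> (b' \<otimes> t)"
    using assms(5,6) by (auto simp: mem_frac)
  have cl: "s \<in> carrier R" "t \<in> carrier R" "s' \<in> carrier R" "t' \<in> carrier R" "u \<in> carrier R" "v \<in> carrier R"
    using assms(2,4) uv(2,3,6,7) by auto
  have "(u \<otimes> v) \<otimes> ((a' \<otimes> t' \<oplus> b' \<otimes> s') \<otimes> (s \<otimes> t)) =
      (u \<otimes> (a' \<otimes> s)) \<otimes> (v \<otimes> (t' \<otimes> t)) \<oplus> (v \<otimes> (b' \<otimes> t)) \<otimes> (u \<otimes> (s' \<otimes> s))"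
    by (rule add_swap) (fact uv(1) uv(5) cl)+
  also have "\<dots> = (u \<otimes> (a \<otimes> s')) \<otimes> (v \<otimes> (t \<otimes> t')) \<oplus> (v \<otimes> (b \<otimes> t')) \<otimes> (u \<otimes> (s \<otimes> s'))"
    unfolding uv(4,8)[symmetric] m_comm[OF cl(4,2)] m_comm[OF cl(3,1)] ..
  also have "\<dots> = (u \<otimes> v) \<otimes> ((a \<otimes> t \<oplus> b \<otimes> s) \<otimes> (s' \<otimes> t'))"
    by (rule add_swap[symmetric]) (fact assms(1) assms(3) cl)+
  finally show ?thesis
    using assms(1-4) uv(1-3,5-7) cl
    by (intro frac_eq_iff[THEN iffD2] bexI[of _ "u \<otimes> v"] a_closed m_closed den_mult)
qed

text \<open>By \<open>frac_mult_cong\<close> every choice of representatives yields the same class,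
  so the union in the definition of \<open>localization\<close> is that class.\<close>

lemma L_mult:
  assumes "a \<in> carrier R" "s \<in> den" "b \<in> carrier R" "t \<in> den"
  shows "lfrac a s \<otimes>\<^bsub>L\<^esub> lfrac b t = lfrac (a \<otimes> b) (s \<otimes> t)"
proof -
  have "(\<Union>(a, s) \<in> lfrac a s. \<Union>(b, t) \<in> lfrac b t. lfrac (a \<otimes> b) (s \<otimes> t)) = lfrac (a \<otimes> b) (s \<otimes> t)"
    (is "?U = ?V")
  proof (intro equalityI subsetI)
    fix z assume "z \<in> ?U"
    then obtain a' s' b' t' where "(a', s') \<in> lfrac a s" "(b', t') \<in> lfrac b t" "z \<in> lfrac (a' \<otimes> b') (s' \<otimes> t')"
      by blast
    then show "z \<in> ?V" using frac_mult_cong[OF assms] by blast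
  next
    fix z assume "z \<in> ?V"
    then show "z \<in> ?U" using frac_self[OF assms(1,2)] frac_self[OF assms(3,4)] by blast
  qed
  then show ?thesis by (simp add: localization_def)
qed

lemma L_add:
  assumes "a \<in> carrier R" "s \<in> den" "b \<in> carrier R" "t \<in> den"
  shows "lfrac a s \<oplus>\<^bsub>L\<^esub> lfrac b t = lfrac (a \<otimes> t \<oplus> b \<otimes> s) (s \<otimes> t)"
proof -
  have "(\<Union>(a, s) \<in> lfrac a s. \<Union>(b, t) \<in> lfrac b t. lfrac (a \<otimes> t \<oplus> b \<otimes> s) (s \<otimes> t)) = lfrac (a \<otimes> t \<oplus> b \<otimes> s) (s \<otimes> t)"
    (is "?U = ?V")
  proof (intro equalityI subsetI)
    fix z assume "z \<in> ?U"
    then obtain a' s' b' t' where "(a', s') \<in> lfrac a s" "(b', t') \<in> lfrac b t"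
      "z \<in> lfrac (a' \<otimes> t' \<oplus> b' \<otimes> s') (s' \<otimes> t')"
      by blast
    then show "z \<in> ?V" using frac_add_cong[OF assms] by blast
  next
    fix z assume "z \<in> ?V"
    then show "z \<in> ?U" using frac_self[OF assms(1,2)] frac_self[OF assms(3,4)] by blast
  qed
  then show ?thesis by (simp add: localization_def)
qed

lemma L_one: "\<one>\<^bsub>L\<^esub> = lfrac \<one> \<one>" and L_zero: "\<zero>\<^bsub>L\<^esub> = lfrac \<zero> \<one>"
  by (simp_all add: localization_def)

lemma L_carrier: "carrier L = {lfrac a s | a s. a \<in> carrier R \<and> s \<in> den}"
  by (simp add: localization_def)

lemma frac_closed [simp]: "a \<in> carrier R \<Longrightarrow> s \<in> den \<Longrightarrow> lfrac a s \<in> carrier L"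
  by (auto simp: L_carrier)

lemma L_cases:
  assumes "X \<in> carrier L" obtains a s where "a \<in> carrier R" "s \<in> den" "X = lfrac a s"
  using assms by (auto simp: L_carrier)

lemma frac_zero: "s \<in> den \<Longrightarrow> lfrac \<zero> s = \<zero>\<^bsub>L\<^esub>"
  unfolding L_zero by (intro frac_eqI) auto

lemma cring_L: "cring L"
proof (intro cringI abelian_groupI comm_monoidI)
  fix x y assume "x \<in> carrier L" "y \<in> carrier L"
  then show "x \<oplus>\<^bsub>L\<^esub> y \<in> carrier L" "x \<otimes>\<^bsub>L\<^esub> y \<in> carrier L"
    by (auto elim!: L_cases simp: L_add L_mult)
next
  show "\<zero>\<^bsub>L\<^esub> \<in> carrier L" "\<one>\<^bsub>L\<^esub> \<in> carrier L"
    unfolding L_zero L_one by (rule frac_closed; simp)+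
next
  fix x y z assume "x \<in> carrier L" "y \<in> carrier L" "z \<in> carrier L"
  then obtain a s b t c r where x: "a \<in> carrier R" "s \<in> den" "x = lfrac a s" and y: "b \<in> carrier R" "t \<in> den" "y = lfrac b t"
    and z: "c \<in> carrier R" "r \<in> den" "z = lfrac c r" by (elim L_cases)
  have cl: "s \<in> carrier R" "t \<in> carrier R" "r \<in> carrier R" using x y z by auto
  have d: "s \<otimes> t \<in> den" "t \<otimes> r \<in> den" "s \<otimes> r \<in> den" using x y z den_mult by blast+
  have 1: "lfrac a s \<oplus>\<^bsub>L\<^esub> lfrac b t = lfrac (a \<otimes> t \<oplus> b \<otimes> s) (s \<otimes> t)"
    "lfrac b t \<oplus>\<^bsub>L\<^esub> lfrac c r = lfrac (b \<otimes> r \<oplus> c \<otimes> t) (t \<otimes> r)"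
    "lfrac a s \<otimes>\<^bsub>L\<^esub> lfrac b t = lfrac (a \<otimes> b) (s \<otimes> t)"
    "lfrac b t \<otimes>\<^bsub>L\<^esub> lfrac c r = lfrac (b \<otimes> c) (t \<otimes> r)"
    "lfrac a s \<otimes>\<^bsub>L\<^esub> lfrac c r = lfrac (a \<otimes> c) (s \<otimes> r)"
    using x y z by (auto simp: L_add L_mult)
  show "x \<oplus>\<^bsub>L\<^esub> y \<oplus>\<^bsub>L\<^esub> z = x \<oplus>\<^bsub>L\<^esub> (y \<oplus>\<^bsub>L\<^esub> z)"
    unfolding x(3) y(3) z(3) 1 using x y z d cl
    by (subst L_add; (subst L_add)?) (auto simp: m_ac l_distr r_distr a_ac intro!: arg_cong2[of _ _ _ _ lfrac])
  show "x \<otimes>\<^bsub>L\<^esub> y \<otimes>\<^bsub>L\<^esub> z = x \<otimes>\<^bsub>L\<^esub> (y \<otimes>\<^bsub>L\<^esub> z)"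
    unfolding x(3) y(3) z(3) 1 using x y z d cl
    by (subst L_mult; (subst L_mult)?) (auto simp: m_ac intro!: arg_cong2[of _ _ _ _ lfrac])
  show "(x \<oplus>\<^bsub>L\<^esub> y) \<otimes>\<^bsub>L\<^esub> z = x \<otimes>\<^bsub>L\<^esub> z \<oplus>\<^bsub>L\<^esub> y \<otimes>\<^bsub>L\<^esub> z"
  proof -
    have "(x \<oplus>\<^bsub>L\<^esub> y) \<otimes>\<^bsub>L\<^esub> z = lfrac ((a \<otimes> t \<oplus> b \<otimes> s) \<otimes> c) (s \<otimes> t \<otimes> r)"
      unfolding x(3) y(3) z(3) 1 using x y z d cl by (subst L_mult) auto
    also have "\<dots> = lfrac (r \<otimes> ((a \<otimes> t \<oplus> b \<otimes> s) \<otimes> c)) (r \<otimes> (s \<otimes> t \<otimes> r))"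
      by (rule frac_cancel[symmetric]) (use x y z d cl den_mult in auto)
    also have "\<dots> = lfrac ((a \<otimes> c) \<otimes> (t \<otimes> r) \<oplus> (b \<otimes> c) \<otimes> (s \<otimes> r)) ((s \<otimes> r) \<otimes> (t \<otimes> r))"
      using x y z cl by (intro arg_cong2[of _ _ _ _ lfrac]) (auto simp: m_ac l_distr r_distr)
    also have "\<dots> = x \<otimes>\<^bsub>L\<^esub> z \<oplus>\<^bsub>L\<^esub> y \<otimes>\<^bsub>L\<^esub> z"
      unfolding x(3) y(3) z(3) 1 using x y z d cl by (subst L_add) auto
    finally show ?thesis .
  qed
next
  fix x y assume "x \<in> carrier L" "y \<in> carrier L"
  then obtain a s b t where x: "a \<in> carrier R" "s \<in> den" "x = lfrac a s" and y: "b \<in> carrier R" "t \<in> den" "y = lfrac b t"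
    by (elim L_cases)
  then show "x \<oplus>\<^bsub>L\<^esub> y = y \<oplus>\<^bsub>L\<^esub> x" "x \<otimes>\<^bsub>L\<^esub> y = y \<otimes>\<^bsub>L\<^esub> x"
    by (auto simp: L_add L_mult m_comm a_comm)
next
  fix x assume "x \<in> carrier L"
  then obtain a s where x: "a \<in> carrier R" "s \<in> den" "x = lfrac a s" by (rule L_cases)
  show "\<zero>\<^bsub>L\<^esub> \<oplus>\<^bsub>L\<^esub> x = x" unfolding L_zero x(3) using x by (subst L_add) auto
  show "\<one>\<^bsub>L\<^esub> \<otimes>\<^bsub>L\<^esub> x = x" unfolding L_one x(3) using x by (subst L_mult) auto
  have "lfrac (\<ominus> a) s \<oplus>\<^bsub>L\<^esub> x = lfrac \<zero> (s \<otimes> s)"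
    unfolding x(3) using x by (subst L_add) (auto simp: l_minus l_neg)
  also have "\<dots> = \<zero>\<^bsub>L\<^esub>" using x by (intro frac_zero den_mult)
  finally show "\<exists>y \<in> carrier L. y \<oplus>\<^bsub>L\<^esub> x = \<zero>\<^bsub>L\<^esub>" using x by (intro bexI[of _ "lfrac (\<ominus> a) s"]) auto
qed

text \<open>The fractions on the right form an ideal, since sums can be brought to a common
  denominator. Conversely, the elements of \<open>R\<close> whose fractions lie on the left form an
  ideal that contains \<open>X\<close>.\<close>

lemma Idl_L:
  assumes X: "X \<subseteq> carrier R"
  shows "Idl\<^bsub>L\<^esub> ((\<lambda>x. lfrac x \<one>) ` X) = {lfrac a s | a s. a \<in> Idl X \<and> s \<in> den}" (is "?I = ?J")
proof -
  interpret L: cring L by (rule cring_L)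
  let ?X = "(\<lambda>x. lfrac x \<one>) ` X"
  have X': "?X \<subseteq> carrier L" using X by auto
  interpret IX: ideal "Idl X" R by (rule genideal_ideal[OF X])
  interpret IL: ideal ?I L by (rule L.genideal_ideal[OF X'])
  show ?thesis
  proof
    have "Idl X \<subseteq> {a \<in> carrier R. lfrac a \<one> \<in> ?I}"
    proof (rule genideal_minimal)
      show "ideal {a \<in> carrier R. lfrac a \<one> \<in> ?I} R"
      proof (rule idealI[OF ring_axioms])
        show "subgroup {a \<in> carrier R. lfrac a \<one> \<in> ?I} (add_monoid R)"
        proof (rule group.subgroupI[OF a_group])
          show "{a \<in> carrier R. lfrac a \<one> \<in> ?I} \<noteq> {}"
            using IL.additive_subgroup_axioms additive_subgroup.zero_closed[of ?I L] L_zero by auto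
          fix a assume a: "a \<in> {a \<in> carrier R. lfrac a \<one> \<in> ?I}"
          have "lfrac (\<ominus> \<one>) \<one> \<otimes>\<^bsub>L\<^esub> lfrac a \<one> \<in> ?I" using a by (intro IL.I_l_closed frac_closed) auto
          moreover have "lfrac (\<ominus> \<one>) \<one> \<otimes>\<^bsub>L\<^esub> lfrac a \<one> = lfrac (\<ominus> a) \<one>"
            using a by (subst L_mult) (auto simp: l_minus)
          ultimately show "inv\<^bsub>add_monoid R\<^esub> a \<in> {a \<in> carrier R. lfrac a \<one> \<in> ?I}"
            using a by (simp add: a_inv_def[symmetric])
          fix b assume b: "b \<in> {a \<in> carrier R. lfrac a \<one> \<in> ?I}"
          have "lfrac a \<one> \<oplus>\<^bsub>L\<^esub> lfrac b \<one> \<in> ?I" using a b by (intro IL.a_closed) auto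
          moreover have "lfrac a \<one> \<oplus>\<^bsub>L\<^esub> lfrac b \<one> = lfrac (a \<oplus> b) \<one>"
            using a b by (subst L_add) auto
          ultimately show "a \<otimes>\<^bsub>add_monoid R\<^esub> b \<in> {a \<in> carrier R. lfrac a \<one> \<in> ?I}" using a b by simp
        qed auto
        fix a x assume a: "a \<in> {a \<in> carrier R. lfrac a \<one> \<in> ?I}" and x: "x \<in> carrier R"
        have "lfrac x \<one> \<otimes>\<^bsub>L\<^esub> lfrac a \<one> \<in> ?I" using a x by (intro IL.I_l_closed frac_closed) auto
        moreover have "lfrac x \<one> \<otimes>\<^bsub>L\<^esub> lfrac a \<one> = lfrac (x \<otimes> a) \<one>" using a x by (subst L_mult) auto
        ultimately show "x \<otimes> a \<in> {a \<in> carrier R. lfrac a \<one> \<in> ?I}" using a x by simp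
        then show "a \<otimes> x \<in> {a \<in> carrier R. lfrac a \<one> \<in> ?I}" using a x by (simp add: m_comm)
      qed
      show "X \<subseteq> {a \<in> carrier R. lfrac a \<one> \<in> ?I}"
        using X L.genideal_self[OF X'] by auto
    qed
    then have *: "a \<in> carrier R \<and> lfrac a \<one> \<in> ?I" if "a \<in> Idl X" for a using that by blast
    show "?J \<subseteq> ?I"
    proof
      fix z assume "z \<in> ?J"
      then obtain a s where z: "z = lfrac a s" "a \<in> Idl X" "s \<in> den" by blast
      have "lfrac \<one> s \<otimes>\<^bsub>L\<^esub> lfrac a \<one> \<in> ?I" using *[OF z(2)] z(3) by (intro IL.I_l_closed frac_closed) auto
      moreover have "lfrac \<one> s \<otimes>\<^bsub>L\<^esub> lfrac a \<one> = z" using *[OF z(2)] z by (subst L_mult) auto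
      ultimately show "z \<in> ?I" by simp
    qed
    show "?I \<subseteq> ?J"
    proof (rule L.genideal_minimal)
      show "?X \<subseteq> ?J" using genideal_self[OF X] one_den by blast
      show "ideal ?J L"
      proof (rule idealI[OF L.ring_axioms])
        have mult: "x \<otimes>\<^bsub>L\<^esub> z \<in> ?J" if z: "z \<in> ?J" and x: "x \<in> carrier L" for x z
        proof -
          obtain a s where z: "z = lfrac a s" "a \<in> Idl X" "s \<in> den" using z by blast
          obtain b t where x: "b \<in> carrier R" "t \<in> den" "x = lfrac b t" using x by (rule L_cases)
          have "x \<otimes>\<^bsub>L\<^esub> z = lfrac (b \<otimes> a) (t \<otimes> s)" unfolding z x using z x IX.Icarr by (subst L_mult) auto
          then show ?thesis using IX.I_l_closed[OF z(2) x(1)] den_mult[OF x(2) z(3)] by blast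
        qed
        have sub: "?J \<subseteq> carrier L" using IX.Icarr frac_closed by blast
        show "subgroup ?J (add_monoid L)"
        proof (rule group.subgroupI[OF L.a_group])
          show "?J \<subseteq> carrier (add_monoid L)" using sub by simp
          show "?J \<noteq> {}" using IX.zero_closed one_den by blast
          fix z assume z: "z \<in> ?J"
          then have "(\<ominus>\<^bsub>L\<^esub> \<one>\<^bsub>L\<^esub>) \<otimes>\<^bsub>L\<^esub> z \<in> ?J" by (rule mult) simp
          moreover have "(\<ominus>\<^bsub>L\<^esub> \<one>\<^bsub>L\<^esub>) \<otimes>\<^bsub>L\<^esub> z = \<ominus>\<^bsub>L\<^esub> z"
            using subsetD[OF sub z] by (simp add: L.l_minus)
          ultimately show "inv\<^bsub>add_monoid L\<^esub> z \<in> ?J"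
            by (simp only: a_inv_def)
          fix y assume y: "y \<in> ?J"
          obtain a s b t where *: "z = lfrac a s" "a \<in> Idl X" "s \<in> den" "y = lfrac b t" "b \<in> Idl X" "t \<in> den"
            using z y by blast
          have "z \<oplus>\<^bsub>L\<^esub> y = lfrac (a \<otimes> t \<oplus> b \<otimes> s) (s \<otimes> t)"
            unfolding *(1,4) using * IX.Icarr by (subst L_add) auto
          moreover have "a \<otimes> t \<oplus> b \<otimes> s \<in> Idl X" using * by (intro IX.a_closed IX.I_r_closed) auto
          ultimately show "z \<otimes>\<^bsub>add_monoid L\<^esub> y \<in> ?J" using den_mult[OF *(3,6)] by auto
        qed
        show "x \<otimes>\<^bsub>L\<^esub> z \<in> ?J" "z \<otimes>\<^bsub>L\<^esub> x \<in> ?J" if "z \<in> ?J" "x \<in> carrier L" for x z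
          using mult[OF that] L.m_comm[OF that(2) subsetD[OF sub that(1)]] by auto
      qed
    qed
  qed
qed

lemma frac_mem_Idl_L:
  assumes X: "X \<subseteq> carrier R" and a: "a \<in> carrier R" "s \<in> den"
    and mem: "lfrac a s \<in> Idl\<^bsub>L\<^esub> ((\<lambda>x. lfrac x \<one>) ` X)"
  obtains u where "u \<in> den" "u \<otimes> a \<in> Idl X"
proof -
  interpret IX: ideal "Idl X" R by (rule genideal_ideal[OF X])
  obtain b t where bt: "lfrac a s = lfrac b t" "b \<in> Idl X" "t \<in> den" using mem unfolding Idl_L[OF X] by blast
  then obtain u where u: "u \<in> den" "u \<otimes> (a \<otimes> t) = u \<otimes> (b \<otimes> s)"
    using frac_eq_iff[of a b s t] a IX.Icarr by auto
  have "u \<otimes> (b \<otimes> s) \<in> Idl X" using u bt a by (intro IX.I_l_closed IX.I_r_closed) auto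
  then have "(u \<otimes> t) \<otimes> a \<in> Idl X" using u(2) a bt u(1) by (simp add: m_ac)
  then show ?thesis using that den_mult[OF u(1) bt(3)] by blast
qed

end

text \<open>A surjection whose kernel is generated by a sequence that is regular except possibly for
  properness, which is recovered at each prime of the quotient.\<close>

locale regular_quotient = A: cring A + B: cring B for A (structure) and B (structure) +
  fixes h and gs
  assumes hom: "h \<in> Ring.ring_hom A B" and surj: "h ` carrier A = carrier B"
    and gs: "set gs \<subseteq> carrier A" and ker: "a_kernel A B h = Idl (set gs)"
    and reg: "\<And>i g. i < length gs \<Longrightarrow> g \<in> carrier A \<Longrightarrow> gs ! i \<otimes> g \<in> Idl (set (take i gs)) \<Longrightarrow>
      g \<in> Idl (set (take i gs))"
begin

sublocale h: ring_hom_cring A B h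
  by (rule ring_hom_cringI[OF ring_hom_ringI2[OF A.ring_axioms B.ring_axioms hom] A.cring_axioms B.cring_axioms])

text \<open>A relation between fractions becomes one in \<open>A\<close> after multiplication by
  some \<open>u\<close> outside \<open>P\<close>, and there \<open>reg\<close> applies. The
  localized sequence is proper because \<open>P\<close>, as a preimage, contains the kernel.\<close>

theorem localization_complete_intersection:
  assumes Q: "primeideal Q B"
  defines "P \<equiv> {a \<in> carrier A. h a \<in> Q}"
  defines "fs \<equiv> map (\<lambda>x. loc_frac A P x \<one>) gs"
  shows "primeideal P A" "regular_sequence (localization A P) fs"
    "localization B Q \<simeq> localization A P Quot (Idl\<^bsub>localization A P\<^esub> (set fs))"
proof -
  interpret Q: primeideal Q B by (rule Q)
  show P: "primeideal P A"
  proof (rule primeidealI2[OF _ A.cring_axioms])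
    show "additive_subgroup P A"
    proof (rule additive_subgroup.intro, rule group.subgroupI[OF A.a_group])
      show "P \<noteq> {}" using Q.zero_closed by (auto simp: P_def intro!: exI[of _ "\<zero>"])
    qed (auto simp: P_def a_inv_def[symmetric] Q.a_closed)
    show "carrier A \<noteq> P"
    proof
      assume "carrier A = P"
      then have "h \<one> \<in> Q" unfolding P_def using A.one_closed by blast
      then show False using Q.one_imp_carrier Q.I_notcarr by simp
    qed
  qed (use Q.I_prime in \<open>auto simp: P_def Q.I_l_closed Q.I_r_closed\<close>)
  interpret LA: prime_localization P A using P by (simp add: prime_localization_def)
  interpret LB: prime_localization Q B using Q by (simp add: prime_localization_def)
  have den: "h s \<in> carrier B - Q" if "s \<in> carrier A - P" for s using that h.hom_closed[of s] unfolding P_def by blast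
  have kerP: "Idl (set gs) \<subseteq> P"
    unfolding ker[symmetric] P_def a_kernel_def' using Q.zero_closed by force
  have fs: "set (take i fs) = (\<lambda>x. LA.lfrac x \<one>) ` set (take i gs)" for i
    by (simp add: fs_def take_map)
  have fs_all: "set fs = (\<lambda>x. LA.lfrac x \<one>) ` set gs" by (simp add: fs_def)
  have take_sub: "set (take i gs) \<subseteq> carrier A" for i using gs set_take_subset by fast
  show "regular_sequence LA.L fs"
    unfolding regular_sequence_def
  proof (intro conjI allI impI ballI)
    show "set fs \<subseteq> carrier LA.L" unfolding fs_all using gs by auto
    show "Idl\<^bsub>LA.L\<^esub> (set fs) \<noteq> carrier LA.L"
    proof
      assume "Idl\<^bsub>LA.L\<^esub> (set fs) = carrier LA.L"
      then have "LA.lfrac \<one> \<one> \<in> Idl\<^bsub>LA.L\<^esub> (set fs)" by simp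
      then obtain u where "u \<in> carrier A - P" "u \<otimes> \<one> \<in> Idl (set gs)"
        unfolding fs_all by (rule LA.frac_mem_Idl_L[OF gs A.one_closed LA.one_den])
      then show False using kerP by auto
    qed
    fix i g assume i: "i < length fs" and g: "g \<in> carrier LA.L"
      and mem: "fs ! i \<otimes>\<^bsub>LA.L\<^esub> g \<in> Idl\<^bsub>LA.L\<^esub> (set (take i fs))"
    have il: "i < length gs" using i by (simp add: fs_def)
    then have gi: "gs ! i \<in> carrier A" using gs by auto
    obtain b t where bt: "b \<in> carrier A" "t \<in> carrier A - P" "g = LA.lfrac b t" using g by (rule LA.L_cases)
    have "fs ! i \<otimes>\<^bsub>LA.L\<^esub> g = LA.lfrac (gs ! i \<otimes> b) (\<one> \<otimes> t)"
      unfolding bt(3) using il gi bt(1,2) LA.one_den by (simp only: fs_def nth_map LA.L_mult)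
    then have "LA.lfrac (gs ! i \<otimes> b) t \<in> Idl\<^bsub>LA.L\<^esub> ((\<lambda>x. LA.lfrac x \<one>) ` set (take i gs))"
      using mem bt unfolding fs by simp
    then obtain u where u: "u \<in> carrier A - P" "u \<otimes> (gs ! i \<otimes> b) \<in> Idl (set (take i gs))"
      by (rule LA.frac_mem_Idl_L[OF take_sub _ bt(2), rotated]) (use gi bt in auto)
    have ub: "u \<in> carrier A" "u \<otimes> b \<in> carrier A" using u(1) bt(1) by simp_all
    have "gs ! i \<otimes> (u \<otimes> b) \<in> Idl (set (take i gs))"
      using u(2) unfolding A.m_lcomm[OF ub(1) gi bt(1)] .
    then have "u \<otimes> b \<in> Idl (set (take i gs))" by (rule reg[OF il ub(2)])
    moreover have "g = LA.lfrac (u \<otimes> b) (u \<otimes> t)" unfolding bt(3) using LA.frac_cancel[OF bt(1,2) u(1)] by simp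
    ultimately show "g \<in> Idl\<^bsub>LA.L\<^esub> (set (take i fs))"
      unfolding fs LA.Idl_L[OF take_sub] using LA.den_mult[OF u(1) bt(2)] by blast
  qed
  define \<Phi> where "\<Phi> X = (\<Union>(a, s) \<in> X. LB.lfrac (h a) (h s))" for X
  have \<Phi>: "\<Phi> (LA.lfrac a s) = LB.lfrac (h a) (h s)" if as: "a \<in> carrier A" "s \<in> carrier A - P" for a s
  proof -
    have "LB.lfrac (h b) (h t) = LB.lfrac (h a) (h s)" if bt: "(b, t) \<in> LA.lfrac a s" for b t
    proof -
      obtain u where u: "b \<in> carrier A" "t \<in> carrier A - P" "u \<in> carrier A - P"
        "u \<otimes> (a \<otimes> t) = u \<otimes> (b \<otimes> s)"
        using bt by (auto simp: LA.mem_frac)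
      have "h (u \<otimes> (b \<otimes> s)) = h (u \<otimes> (a \<otimes> t))" by (simp only: u(4))
      then have "h u \<otimes>\<^bsub>B\<^esub> (h b \<otimes>\<^bsub>B\<^esub> h s) = h u \<otimes>\<^bsub>B\<^esub> (h a \<otimes>\<^bsub>B\<^esub> h t)" using u(1-3) as by simp
      then show ?thesis
        using LB.frac_eq_iff[OF h.hom_closed[OF u(1)] h.hom_closed[OF as(1)] den[OF u(2)] den[OF as(2)]]
          den[OF u(3)] by blast
    qed
    then show ?thesis unfolding \<Phi>_def using LA.frac_self[OF as] by blast
  qed
  have \<Phi>_hom: "\<Phi> \<in> Ring.ring_hom LA.L LB.L"
  proof (rule ring_hom_memI)
    fix x assume "x \<in> carrier LA.L"
    then obtain a s where x: "a \<in> carrier A" "s \<in> carrier A - P" "x = LA.lfrac a s" by (rule LA.L_cases)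
    then show "\<Phi> x \<in> carrier LB.L" using den[OF x(2)] by (simp only: \<Phi> LB.frac_closed h.hom_closed)
    fix y assume "y \<in> carrier LA.L"
    then obtain b t where y: "b \<in> carrier A" "t \<in> carrier A - P" "y = LA.lfrac b t" by (rule LA.L_cases)
    have st: "s \<otimes> t \<in> carrier A - P" using x(2) y(2) by (rule LA.den_mult)
    note d = den[OF x(2)] den[OF y(2)] h.hom_closed[OF x(1)] h.hom_closed[OF y(1)]
    have cl: "s \<in> carrier A" "t \<in> carrier A" using x y by auto
    show "\<Phi> (x \<otimes>\<^bsub>LA.L\<^esub> y) = \<Phi> x \<otimes>\<^bsub>LB.L\<^esub> \<Phi> y"
      unfolding x(3) y(3) LA.L_mult[OF x(1,2) y(1,2)] \<Phi>[OF x(1,2)] \<Phi>[OF y(1,2)] LB.L_mult[OF d(3,1,4,2)]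
      using x y st cl by (subst \<Phi>) auto
    show "\<Phi> (x \<oplus>\<^bsub>LA.L\<^esub> y) = \<Phi> x \<oplus>\<^bsub>LB.L\<^esub> \<Phi> y"
      unfolding x(3) y(3) LA.L_add[OF x(1,2) y(1,2)] \<Phi>[OF x(1,2)] \<Phi>[OF y(1,2)] LB.L_add[OF d(3,1,4,2)]
      using x y st cl by (subst \<Phi>) auto
  next
    show "\<Phi> \<one>\<^bsub>LA.L\<^esub> = \<one>\<^bsub>LB.L\<^esub>" unfolding LA.L_one LB.L_one using LA.one_den by (subst \<Phi>) auto
  qed
  interpret CA: cring LA.L by (rule LA.cring_L)
  interpret CB: cring LB.L by (rule LB.cring_L)
  interpret \<Phi>: ring_hom_ring LA.L LB.L \<Phi> by (rule ring_hom_ringI2[OF CA.ring_axioms CB.ring_axioms \<Phi>_hom])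
  have "\<Phi> ` carrier LA.L = carrier LB.L"
  proof (intro equalityI subsetI)
    fix y assume "y \<in> carrier LB.L"
    then obtain b t where y: "b \<in> carrier B" "t \<in> carrier B - Q" "y = LB.lfrac b t" by (rule LB.L_cases)
    obtain a where a: "a \<in> carrier A" "h a = b" using y(1) unfolding surj[symmetric] by blast
    obtain s where s: "s \<in> carrier A" "h s = t" using y(2) unfolding surj[symmetric] by blast
    have sP: "s \<in> carrier A - P" using y(2) s unfolding P_def by blast
    have "y = \<Phi> (LA.lfrac a s)" unfolding \<Phi>[OF a(1) sP] a(2) s(2) by (rule y(3))
    moreover have "LA.lfrac a s \<in> carrier LA.L" using a(1) sP by (rule LA.frac_closed)
    ultimately show "y \<in> \<Phi> ` carrier LA.L" by blast
  qed (use \<Phi>.hom_closed in blast)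
  then have "LA.L Quot (a_kernel LA.L LB.L \<Phi>) \<simeq> LB.L" by (rule \<Phi>.FactRing_iso)
  moreover have "a_kernel LA.L LB.L \<Phi> = Idl\<^bsub>LA.L\<^esub> (set fs)"
  proof (intro equalityI subsetI)
    fix z assume "z \<in> a_kernel LA.L LB.L \<Phi>"
    then have z: "z \<in> carrier LA.L" "\<Phi> z = \<zero>\<^bsub>LB.L\<^esub>" unfolding a_kernel_def' by blast+
    then obtain a s where as: "a \<in> carrier A" "s \<in> carrier A - P" "z = LA.lfrac a s"
      by (elim LA.L_cases)
    have "LB.lfrac (h a) (h s) = LB.lfrac \<zero>\<^bsub>B\<^esub> \<one>\<^bsub>B\<^esub>"
      unfolding LB.L_zero[symmetric] \<Phi>[OF as(1,2), symmetric] as(3)[symmetric] by (rule z(2))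
    then obtain u where u: "u \<in> carrier B - Q" "u \<otimes>\<^bsub>B\<^esub> (h a \<otimes>\<^bsub>B\<^esub> \<one>\<^bsub>B\<^esub>) = u \<otimes>\<^bsub>B\<^esub> (\<zero>\<^bsub>B\<^esub> \<otimes>\<^bsub>B\<^esub> h s)"
      using LB.frac_eq_iff[OF h.hom_closed[OF as(1)] B.zero_closed den[OF as(2)] LB.one_den] by blast
    obtain v where v: "v \<in> carrier A" "h v = u" using u(1) unfolding surj[symmetric] by blast
    have vP: "v \<in> carrier A - P" using u(1) v unfolding P_def by blast
    have "h (v \<otimes> a) = u \<otimes>\<^bsub>B\<^esub> (h a \<otimes>\<^bsub>B\<^esub> \<one>\<^bsub>B\<^esub>)"
      unfolding h.hom_mult[OF v(1) as(1)] v(2) B.r_one[OF h.hom_closed[OF as(1)]] ..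
    also have "\<dots> = \<zero>\<^bsub>B\<^esub>" using u den[OF as(2)] by simp
    finally have "v \<otimes> a \<in> Idl (set gs)"
      unfolding ker[symmetric] a_kernel_def' using A.m_closed[OF v(1) as(1)] by blast
    moreover have "z = LA.lfrac (v \<otimes> a) (v \<otimes> s)" unfolding as(3) using LA.frac_cancel[OF as(1,2) vP] by simp
    ultimately show "z \<in> Idl\<^bsub>LA.L\<^esub> (set fs)"
      unfolding fs_all LA.Idl_L[OF gs] using LA.den_mult[OF vP as(2)] by blast
  next
    fix z assume "z \<in> Idl\<^bsub>LA.L\<^esub> (set fs)"
    then obtain a s where as: "z = LA.lfrac a s" "a \<in> Idl (set gs)" "s \<in> carrier A - P"
      unfolding fs_all LA.Idl_L[OF gs] by blast
    then have a: "a \<in> carrier A" "h a = \<zero>\<^bsub>B\<^esub>" unfolding ker[symmetric] a_kernel_def' by blast+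
    then have "\<Phi> z = \<zero>\<^bsub>LB.L\<^esub>" using \<Phi>[OF a(1) as(3)] LB.frac_zero[OF den[OF as(3)]] as(1) by simp
    then show "z \<in> a_kernel LA.L LB.L \<Phi>"
      unfolding a_kernel_def' using as(1) LA.frac_closed[OF a(1) as(3)] by simp
  qed
  ultimately have "LA.L Quot (Idl\<^bsub>LA.L\<^esub> (set fs)) \<simeq> LB.L" by simp
  moreover have "ring (LA.L Quot (Idl\<^bsub>LA.L\<^esub> (set fs)))"
    by (rule ideal.quotient_is_ring[OF CA.genideal_ideal]) (use gs in \<open>auto simp: fs_all\<close>)
  ultimately show "LB.L \<simeq> LA.L Quot (Idl\<^bsub>LA.L\<^esub> (set fs))"
    using ring_iso_set_sym unfolding is_ring_iso_def by blast
qed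

end

section \<open>Quotients of polynomial rings by ideals of maximal grade\<close>

lemma reg_seq_mod_append: "reg_seq_mod (xs @ ys) F \<longleftrightarrow> reg_seq_mod xs F \<and> reg_seq_mod ys (F \<union> set xs)"
  by (induction xs arbitrary: F) auto

lemma reg_seq_mod_cong: "rid.span F = rid.span G \<Longrightarrow> reg_seq_mod xs F = reg_seq_mod xs G"
proof (induction xs arbitrary: F G)
  case (Cons x xs)
  show ?case using nzd_mod_cong[OF Cons.prems] Cons.IH[OF span_insert_cong[OF Cons.prems]] by simp
qed simp

lemma reg_seq_mod_nth: "reg_seq_mod xs F \<Longrightarrow> i < length xs \<Longrightarrow> nzd_mod (xs ! i) (F \<union> set (take i xs))"
proof (induction xs arbitrary: F i)
  case (Cons x xs)
  then show ?case by (cases i) (auto dest: Cons.IH)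
qed simp

lemma psubst_cong_mod:
  assumes "\<And>v. v \<in> pvars f \<Longrightarrow> cong_mod (g v) (h v) F"
  shows "cong_mod (psubst g f) (psubst h f) F"
proof -
  have pow: "cong_mod (x ^ k) (y ^ k) F" if "cong_mod x y F" for x y k
    using that by (induction k) (auto intro: cong_mod_mult)
  show ?thesis
    unfolding psubst_def using assms
    by (intro cong_mod_sum cong_mod_mult cong_mod_prod cong_mod_refl pow) (auto simp: pvars_def)
qed

text \<open>Setting the other variables to 0 is a ring homomorphism that fixes
  \<open>poly_ring V\<close>; it carries statements about the ring with all variables back to
  \<open>poly_ring V\<close>.\<close>

definition prestrict :: "'v set \<Rightarrow> 'v cpoly \<Rightarrow> 'v cpoly" where
  "prestrict V = psubst (\<lambda>v. if v \<in> V then pvar v else 0)"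

lemma prestrict_id: "pvars f \<subseteq> V \<Longrightarrow> prestrict V f = f"
  unfolding prestrict_def by (subst psubst_cong[where h = pvar]) auto

lemma pvars_prestrict: "pvars (prestrict V f) \<subseteq> V"
  using pvars_psubst[of "\<lambda>v. if v \<in> V then pvar v else 0" f]
  by (auto simp: prestrict_def split: if_splits)

lemma carrier_poly_ring: "f \<in> carrier (poly_ring V) \<longleftrightarrow> pvars f \<subseteq> V"
  by (auto simp: poly_ring_def pvars_def)

lemma poly_ring_simps [simp]:
  "x \<otimes>\<^bsub>poly_ring V\<^esub> y = x * y" "x \<oplus>\<^bsub>poly_ring V\<^esub> y = x + y"
  "\<one>\<^bsub>poly_ring V\<^esub> = 1" "\<zero>\<^bsub>poly_ring V\<^esub> = 0"
  by (simp_all add: poly_ring_def)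

lemma poly_ring_closed:
  "pvars x \<subseteq> V \<Longrightarrow> pvars y \<subseteq> V \<Longrightarrow> pvars (x + y) \<subseteq> V"
  "pvars x \<subseteq> V \<Longrightarrow> pvars y \<subseteq> V \<Longrightarrow> pvars (x * y) \<subseteq> V"
  using pvars_add[of x y] pvars_mult[of x y] by blast+

lemma cring_poly_ring: "cring (poly_ring V)"
proof (intro cringI abelian_groupI comm_monoidI)
  fix x assume "x \<in> carrier (poly_ring V)"
  then show "\<exists>y \<in> carrier (poly_ring V). y \<oplus>\<^bsub>poly_ring V\<^esub> x = \<zero>\<^bsub>poly_ring V\<^esub>"
    by (intro bexI[of _ "- x"]) (auto simp: carrier_poly_ring)
qed (auto simp: carrier_poly_ring poly_ring_closed algebra_simps)

text \<open>The generators are fixed by \<open>prestrict V\<close>, so applying it to a combination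
  with arbitrary coefficients yields one with coefficients in \<open>poly_ring V\<close>.\<close>

lemma Idl_poly_ring:
  assumes X: "X \<subseteq> carrier (poly_ring V)"
  shows "Idl\<^bsub>poly_ring V\<^esub> X = rid.span X \<inter> carrier (poly_ring V)"
proof -
  interpret cring "poly_ring V" by (rule cring_poly_ring)
  interpret I: ideal "Idl\<^bsub>poly_ring V\<^esub> X" "poly_ring V" by (rule genideal_ideal[OF X])
  have inv: "inv\<^bsub>add_monoid (poly_ring V)\<^esub> x = - x" if "pvars x \<subseteq> V" for x
    using minus_equality[of "- x" x] that unfolding a_inv_def by (simp add: carrier_poly_ring)
  show ?thesis
  proof
    show "Idl\<^bsub>poly_ring V\<^esub> X \<subseteq> rid.span X \<inter> carrier (poly_ring V)"
    proof (rule genideal_minimal)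
      show "X \<subseteq> rid.span X \<inter> carrier (poly_ring V)" using X rid.span_base by blast
      show "ideal (rid.span X \<inter> carrier (poly_ring V)) (poly_ring V)"
      proof (rule idealI[OF ring_axioms])
        show "subgroup (rid.span X \<inter> carrier (poly_ring V)) (add_monoid (poly_ring V))"
          by (rule group.subgroupI[OF a_group])
            (auto simp: carrier_poly_ring inv[simplified] rid.span_neg rid.span_add poly_ring_closed intro: rid.span_zero
              intro!: exI[of _ 0])
      qed (auto simp: carrier_poly_ring poly_ring_closed span_mult_left span_mult_right)
    qed
    have "prestrict V f \<in> Idl\<^bsub>poly_ring V\<^esub> X" if "f \<in> rid.span X" for f
      using that
    proof (induction rule: rid.span_induct_alt)
      case base
      show ?case using I.zero_closed by (simp add: prestrict_def)
    next
      case (step c x y)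
      have "prestrict V x = x" using subsetD[OF X step.hyps] by (intro prestrict_id) (simp only: carrier_poly_ring)
      then have "prestrict V (c * x + y) = prestrict V c * x + prestrict V y"
        by (simp add: prestrict_def psubst_add psubst_mult)
      moreover have "prestrict V c * x \<in> Idl\<^bsub>poly_ring V\<^esub> X"
        using I.I_l_closed[OF subsetD[OF genideal_self[OF X] step.hyps], of "prestrict V c"]
        by (simp add: carrier_poly_ring pvars_prestrict)
      ultimately show ?case using I.a_closed[OF _ step.IH] by simp
    qed
    then show "rid.span X \<inter> carrier (poly_ring V) \<subseteq> Idl\<^bsub>poly_ring V\<^esub> X"
      using prestrict_id by (fastforce simp: carrier_poly_ring)
  qed
qed

text \<open>A regular sequence generating the ideal exists only after adjoining further variables; adding
  these variables to the sequence leads back to the given quotient.\<close>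

theorem Spec_lci_of_grade:
  fixes bs :: "(nat \<times> nat) cpoly list"
  assumes V: "finite V" and bs: "set bs \<subseteq> carrier (poly_ring V)" and grade: "grade_ge (length bs) {} (set bs)"
  shows "Spec_local_complete_intersection (poly_ring V Quot Idl\<^bsub>poly_ring V\<^esub> (set bs))"
proof -
  obtain ys where ys: "reg_seq_mod ys {}" "rid.span (set ys) = rid.span (set bs)"
    using grade_ge_imp_reg_seq[OF finite.emptyI grade] by auto
  define W where "W = V \<union> (\<Union>y \<in> set ys. pvars y)"
  have finW: "finite W" using V by (simp add: W_def)
  obtain vs where vs: "set vs = W - V" "distinct vs" using finite_distinct_list finW by blast
  let ?us = "map pvar vs" and ?A = "poly_ring W" and ?S = "poly_ring V"
  let ?I = "Idl\<^bsub>?S\<^esub> (set bs)" and ?gs = "ys @ map pvar vs"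
  have b: "pvars b \<subseteq> V" if "b \<in> set bs" for b using subsetD[OF bs that] by (simp only: carrier_poly_ring)
  \<comment> \<open>The new variables are regular modulo \<open>bs\<close>, which does not involve
    them, and hence modulo \<open>ys\<close>, which generates the same ideal.\<close>
  have "reg_seq_mod (map (\<lambda>v. pvar v + 0) vs) (set bs)"
    by (rule reg_seq_fresh_variables[OF vs(2)]) (use b vs(1) in auto)
  then have "reg_seq_mod ?gs {}"
    using ys reg_seq_mod_cong[OF ys(2)] by (simp add: reg_seq_mod_append)
  note nzd = reg_seq_mod_nth[OF this, simplified]
  interpret A: cring ?A by (rule cring_poly_ring)
  interpret S: cring ?S by (rule cring_poly_ring)
  interpret I: ideal ?I ?S by (rule S.genideal_ideal[OF bs])
  interpret B: cring "?S Quot ?I" by (rule I.quotient_is_cring[OF S.cring_axioms])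
  let ?h = "\<lambda>f. ?I +>\<^bsub>?S\<^esub> prestrict V f"
  have \<rho>: "prestrict V \<in> Ring.ring_hom ?A ?S"
    by (rule ring_hom_memI)
      (simp_all add: carrier_poly_ring pvars_prestrict, simp_all add: prestrict_def psubst_add psubst_mult)
  have hom: "?h \<in> Ring.ring_hom ?A (?S Quot ?I)"
    using ring_hom_trans[OF \<rho> I.rcos_ring_hom] by (simp add: comp_def)
  have \<rho>_id: "prestrict V f = f" if "f \<in> carrier ?S" for f
    using that prestrict_id by (simp add: carrier_poly_ring)
  have sub: "carrier ?S \<subseteq> carrier ?A" by (auto simp: carrier_poly_ring W_def)
  have gsA: "set ?gs \<subseteq> carrier ?A" using vs(1) by (auto simp: carrier_poly_ring W_def)
  have span_gs: "rid.span (set ?gs) = rid.span (set bs \<union> set ?us)"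
    unfolding set_append by (rule span_Un_cong[OF ys(2)])
  have \<rho>_closed: "prestrict V f \<in> carrier ?S" for f using pvars_prestrict by (simp add: carrier_poly_ring)
  \<comment> \<open>This identifies the kernel of \<open>?h\<close>: modulo the new variables
    \<open>f\<close> equals \<open>prestrict V f\<close>, and setting these variables to 0 maps the
    larger ideal into that of \<open>bs\<close>.\<close>
  have mem: "prestrict V f \<in> ?I \<longleftrightarrow> f \<in> Idl\<^bsub>?A\<^esub> (set ?gs)" if f: "f \<in> carrier ?A" for f
  proof -
    have "cong_mod (psubst pvar f) (prestrict V f) (set ?us)"
      unfolding prestrict_def
    proof (rule psubst_cong_mod)
      fix v assume "v \<in> pvars f"
      then have "v \<in> W" using f unfolding carrier_poly_ring by blast
      then show "cong_mod (pvar v) (if v \<in> V then pvar v else 0) (set ?us)"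
      proof (cases "v \<in> V")
        case False
        then have "pvar v \<in> set ?us" using vs(1) \<open>v \<in> W\<close> by simp
        then have "pvar v \<in> rid.span (set ?us)" by (rule rid.span_base)
        then show ?thesis using False by (simp only: cong_mod_def if_False diff_zero)
      qed (simp only: if_True cong_mod_refl)
    qed
    then have "cong_mod f (prestrict V f) (set bs \<union> set ?us)"
      unfolding psubst_id by (rule cong_mod_mono) (rule rid.span_mono, rule Un_upper2)
    then have "f \<in> rid.span (set ?gs) \<longleftrightarrow> prestrict V f \<in> rid.span (set bs \<union> set ?us)"
      unfolding span_gs by (rule cong_mod_mem)
    also have "\<dots> \<longleftrightarrow> prestrict V f \<in> rid.span (set bs)"
    proof
      assume "prestrict V f \<in> rid.span (set bs \<union> set ?us)"
      then have "prestrict V (prestrict V f) \<in> rid.span (prestrict V ` (set bs \<union> set ?us))"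
        unfolding prestrict_def by (rule psubst_span)
      moreover have sub: "prestrict V ` (set bs \<union> set ?us) \<subseteq> rid.span (set bs)"
        using vs(1) b by (auto simp: prestrict_id rid.span_base) (auto simp: prestrict_def rid.span_zero)
      ultimately show "prestrict V f \<in> rid.span (set bs)"
        unfolding \<rho>_id[OF \<rho>_closed] using span_subset_span[OF sub] by blast
    qed (use rid.span_mono[of "set bs" "set bs \<union> set ?us"] in blast)
    finally show ?thesis
      unfolding Idl_poly_ring[OF bs] Idl_poly_ring[OF gsA] using f \<rho>_closed by blast
  qed
  interpret regular_quotient ?A "?S Quot ?I" ?h ?gs
  proof
    show "?h \<in> Ring.ring_hom ?A (?S Quot ?I)" by (rule hom)
    show "set ?gs \<subseteq> carrier ?A" by (rule gsA)
    show "?h ` carrier ?A = carrier (?S Quot ?I)"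
    proof
      show "?h ` carrier ?A \<subseteq> carrier (?S Quot ?I)" using ring_hom_closed[OF hom] by blast
      show "carrier (?S Quot ?I) \<subseteq> ?h ` carrier ?A"
        using \<rho>_id sub by (force simp: FactRing_def A_RCOSETS_def')
    qed
    have "?h f = ?I \<longleftrightarrow> prestrict V f \<in> ?I" for f
      using I.rcos_const_imp_mem[OF \<rho>_closed] S.a_rcos_zero[OF I.is_ideal] by blast
    then show "a_kernel ?A (?S Quot ?I) ?h = Idl\<^bsub>?A\<^esub> (set ?gs)"
      using mem A.genideal_self[OF gsA] Idl_poly_ring[OF gsA] by (auto simp: a_kernel_def' FactRing_def)
    fix i g assume i: "i < length ?gs" and g: "g \<in> carrier ?A"
      and "?gs ! i \<otimes>\<^bsub>?A\<^esub> g \<in> Idl\<^bsub>?A\<^esub> (set (take i ?gs))"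
    moreover have take: "set (take i ?gs) \<subseteq> carrier ?A" using gsA set_take_subset by fast
    ultimately have "?gs ! i * g \<in> rid.span (set (take i ?gs))" using Idl_poly_ring[OF take] by simp
    then have "g \<in> rid.span (set (take i ?gs))"
      using nzd_modD[OF reg_seq_mod_nth[OF \<open>reg_seq_mod ?gs {}\<close> i]] by simp
    then show "g \<in> Idl\<^bsub>?A\<^esub> (set (take i ?gs))" using g Idl_poly_ring[OF take] by simp
  qed
  show ?thesis
    unfolding Spec_local_complete_intersection_def complete_intersection_local_ring_def
    using localization_complete_intersection finW by blast
qed

section \<open>Equality of the two ideals and the local structure of the quotient\<close>

section \<open>The Schubert determinantal ideals\<close>

context ordered_inclusion_permutation
begin

abbreviation "Svars \<equiv> {(p, q). 1 \<le> q \<and> q < p \<and> p \<le> n}"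

lemma M_minor_closed:
  assumes "card A = card B" "A \<subseteq> {1..n}" "B \<subseteq> {1..n}"
  shows "M_minor A B \<in> carrier (S_ring n)"
proof -
  have fin: "finite A" "finite B" using assms finite_subset by blast+
  show ?thesis
    unfolding S_ring_def carrier_poly_ring M_minor_lminor[OF assms(1)]
    by (rule pvars_lminor) (use assms fin in \<open>auto simp: M_entry_def subset_eq\<close>)
qed

abbreviation "minors p q \<equiv> {M_minor A B | A B.
  A \<subseteq> {p..n} \<and> B \<subseteq> {1..q} \<and> card A = rk w p q + 1 \<and> card B = rk w p q + 1}"

lemma minors_closed:
  assumes "(p, q) \<in> E" shows "minors p q \<subseteq> carrier (S_ring n)"
proof -
  have "{p..n} \<subseteq> {1..n}" "{1..q} \<subseteq> {1..n}" using essential_bounds[OF assms] by auto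
  then show ?thesis by (auto intro!: M_minor_closed)
qed

lemma rank_ideal_eq:
  assumes "(p, q) \<in> E"
  shows "rank_ideal n p q (rk w p q) = rid.span (minors p q) \<inter> carrier (S_ring n)"
  unfolding rank_ideal_def using minors_closed[OF assms] Idl_poly_ring unfolding S_ring_def by blast

lemma minors_subset: "(p, q) \<in> E \<Longrightarrow> minors p q \<subseteq> rank_minors n E (rk w) M_entry"
proof
  fix g assume e: "(p, q) \<in> E" and "g \<in> minors p q"
  then obtain A B where g: "g = M_minor A B" and AB: "A \<subseteq> {p..n}" "B \<subseteq> {1..q}"
    "card A = rk w p q + 1" "card B = rk w p q + 1" by blast
  have "finite A" "finite B" using AB finite_subset by blast+
  then have "lminor M_entry (sorted_list_of_set A) (sorted_list_of_set B) \<in> rank_minors n E (rk w) M_entry"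
    using e AB by (intro rank_minorsI[of p q]) simp_all
  then show "g \<in> rank_minors n E (rk w) M_entry" using g AB M_minor_lminor by simp
qed

lemma f_mem_minors:
  assumes "a \<in> D" obtains p q where "(p, q) \<in> E" "f a \<in> minors p q"
proof -
  obtain x y where a: "a = (x, y)" by (cases a)
  obtain A B p q where "(p, q) \<in> E" "f (x, y) = M_minor A B" "A \<subseteq> {p..n}" "B \<subseteq> {1..q}"
    "card A = rk w p q + 1" "card B = rk w p q + 1"
    using assms unfolding a by (rule f_cases)
  then show ?thesis using that[of p q] unfolding a by blast
qed

lemma f_closed: "f ` D \<subseteq> carrier (S_ring n)"
proof
  fix g assume "g \<in> f ` D"
  then obtain a where a: "a \<in> D" "g = f a" by blast
  obtain p q where pq: "(p, q) \<in> E" "f a \<in> minors p q" using a(1) by (rule f_mem_minors)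
  show "g \<in> carrier (S_ring n)" unfolding a(2) by (rule subsetD[OF minors_closed[OF pq(1)] pq(2)])
qed

lemma J_eq: "J_ideal n w es = SJ \<inter> carrier (S_ring n)"
  unfolding J_ideal_def using f_closed Idl_poly_ring unfolding S_ring_def by blast

theorem I_eq_J: "I_ideal n w = J_ideal n w es"
proof -
  let ?X = "\<Union>(p, q) \<in> E. rank_ideal n p q (rk w p q)"
  have X: "?X \<subseteq> carrier (S_ring n)" using rank_ideal_eq by auto
  have min: "minors p q \<subseteq> ?X" if "(p, q) \<in> E" for p q
    using rank_ideal_eq[OF that] minors_closed[OF that] rid.span_superset[of "minors p q"] that by blast
  have "?X \<subseteq> SJ"
  proof -
    have "rank_ideal n p q (rk w p q) \<subseteq> SJ" if e: "(p, q) \<in> E" for p q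
      using rank_ideal_eq[OF e] span_subset_span[OF subset_trans[OF minors_subset[OF e] rank_minors_subset]] by blast
    then show ?thesis by blast
  qed
  moreover have "f ` D \<subseteq> rid.span ?X"
  proof
    fix g assume "g \<in> f ` D"
    then obtain a where a: "a \<in> D" "g = f a" by blast
    obtain p q where pq: "(p, q) \<in> E" "f a \<in> minors p q" using a(1) by (rule f_mem_minors)
    show "g \<in> rid.span ?X" unfolding a(2) by (rule rid.span_base) (rule subsetD[OF min[OF pq(1)] pq(2)])
  qed
  ultimately have "rid.span ?X = SJ" using span_subset_span by (intro equalityI)
  moreover have "I_ideal n w = rid.span ?X \<inter> carrier (S_ring n)"
    unfolding I_ideal_def using X Idl_poly_ring unfolding S_ring_def by blast
  ultimately show ?thesis by (simp only: J_eq)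
qed

theorem Spec_quotient_lci: "Spec_local_complete_intersection (S_ring n Quot I_ideal n w)"
proof -
  obtain ds where ds: "set ds = D" "distinct ds" using finite_distinct_list finite_diagram by blast
  \<comment> \<open>The ideal of the generators contains all the minors, so its grade is at least
    theirs, the number of positions in the diagram.\<close>
  have "grade_ge (card D) {} (f ` D)"
    by (rule grade_ge_mono[OF grade_unitriangular]) (simp add: rank_minors_subset)
  moreover have "length ds = card D" using ds distinct_card by fastforce
  ultimately have "grade_ge (length (map f ds)) {} (set (map f ds))" using ds by simp
  moreover have "finite Svars" by (rule finite_subset[of _ "{..n} \<times> {..n}"]) auto
  moreover have "set (map f ds) \<subseteq> carrier (poly_ring Svars)" using f_closed ds by (simp add: S_ring_def)
  ultimately have "Spec_local_complete_intersection (poly_ring Svars Quot Idl\<^bsub>poly_ring Svars\<^esub> (set (map f ds)))"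
    by (intro Spec_lci_of_grade)
  then show ?thesis unfolding I_eq_J J_ideal_def S_ring_def using ds by simp
qed

end

theorem theorem4p2:
  fixes n :: nat and w :: "nat \<Rightarrow> nat"
  assumes "w permutes {1..n}"
    and "defined_by_inclusions n w"
  shows "(\<forall>es. admissible_order n w es \<longrightarrow> I_ideal n w = J_ideal n w es) \<and>
    Spec_local_complete_intersection (S_ring n Quot I_ideal n w)"
proof -
  interpret inclusion_permutation n w by unfold_locales (fact assms)+
  have loc: "ordered_inclusion_permutation n w es" if "admissible_order n w es" for es
    by unfold_locales (fact that)
  have "finite (essential_pos n w)"
    using finite_essential by (rule rev_finite_subset) (auto simp: essential_pos_def)
  then obtain es where "set es = essential_pos n w" "distinct es" using finite_distinct_list by blast
  \<comment> \<open>Sorting by rank provides an admissible order, through which the statement about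
    the quotient is reduced to \<open>J_ideal\<close>.\<close>
  then have "admissible_order n w (sort_key (\<lambda>(p, q). rk w p q) es)"
    by (simp add: admissible_order_def)
  then show ?thesis using ordered_inclusion_permutation.I_eq_J ordered_inclusion_permutation.Spec_quotient_lci loc by blast
qed

end
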